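(* Let $\Gamma^-$ be a lower differential game satisfying the standing assumptions in the context, with Hamiltonian $H$ and recession function $H_\infty$. (1) Assume that in $\Gamma^-$ the intersection of every dominion of player 1 with every dominion of player 2 in the torus is nonempty. Then the strong maximum principle holds, i.e. the constant functions are the only continuous viscosity solutions of $$H_\infty(x,Dw(x))=0\ \text{ in }\mathbb{R}^n,\qquad w\ \ \mathbb{Z}^n\text{-periodic}.$$ (2) If the structural equicontinuity property is true, then $\Gamma^-$ is uniquely ergodic if and only if the two players do not have disjoint dominions in the torus, i.e. if and only if $\overline{\pi(D^1)}\cap\overline{\pi(D^2)}\neq\emptyset$ for every dominion $D^1$ of player 1 and every dominion $D^2$ of player 2 in $\Gamma^-$.
   Context: Setting (standing assumptions). $A,B$ are nonempty compact metric spaces, $|\cdot|$ is the Euclidean norm. $f:\mathbb{R}^n\times A\times B\to\mathbb{R}^n$ is continuous, and there is $L_f\ge0$ with $|f(x,a,b)-f(y,a,b)|\le L_f|x-y|$ for all $x,y,a,b$. $\ell:\mathbb{R}^n\times A\times B\to\mathbb{R}$ is bounded and continuous, and there is a modulus of continuity $\omega_\ell$ (nondecreasing $[0,\infty)\to[0,\infty)$, vanishing and continuous at $0$) with $|\ell(x,a,b)-\ell(y,a,b)|\le\omega_\ell(|x-y|)$ for all $x,y,a,b$. Both $f$ and $\ell$ are $\mathbb{Z}^n$-periodic in $x$. $\mathscr{A}$ (resp. $\mathscr{B}$) is the set of Lebesgue measurable functions $[0,+\infty)\to A$ (resp. $B$), called controls of player 1 (resp. 2). For $x\in\mathbb{R}^n$,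 $a\in\mathscr{A}$, $b\in\mathscr{B}$, $X^{x,a,b}_t$ is the unique solution of $\dot X_t=f(X_t,a_t,b_t)$ for a.e. $t>0$, $X_0=x$. A nonanticipating strategy of player 1 is a map $\alpha:\mathscr{B}\to\mathscr{A}$ such that for all $t>0$ and $b^1,b^2\in\mathscr{B}$, if $b^1_s=b^2_s$ for a.e. $s\le t$ then $\alpha[b^1]_s=\alpha[b^2]_s$ for a.e. $s\le t$; $\mathfrak{A}$ is the set of these. Write $X^{x,\alpha,b}_t=X^{x,\alpha[b],b}_t$. The lower game $\Gamma^-$ with running payoff $\ell$ has discounted value, for $\delta>0$, $$v_\delta(x)=\inf_{\alpha\in\mathfrak{A}}\sup_{b\in\mathscr{B}}\int_0^\infty e^{-\delta s}\ell(X^{x,\alpha,b}_s,\alpha[b]_s,b_s)\,ds .$$ The game is ergodic if $\delta v_\delta(x)$ converges uniformly in $x$ to a constant as $\delta\to0$. It is uniquely ergodic if for every continuous $\mathbb{Z}^n$-periodic $g:\mathbb{R}^n\to\mathbb{R}$, the game with running payoff $(x,a,b)\mapsto\ell(x,a,b)+g(x)$, all other data being equal, is ergodic. The Hamiltonian of $\Gamma^-$ and its recession function are, with $\langle\cdot,\cdot\rangle$ the standard scalar product, $$H(x,p)=\min_{b\in B}\max_{a\in A}\{-\langle f(x,a,b),p\rangle-\ell(x,a,b)\},\qquad H_\infty(x,p)=\min_{b\in B}\max_{a\in A}\{-\langle f(x,a,b),p\rangle\}.$$ Structural equicontinuity property: for every continuous $\mathbb{Z}^n$-periodic $g:\mathbb{R}^n\to\mathbb{R}$,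 if $u_\delta$ denotes the unique continuous viscosity solution of $\delta u(x)+g(x)+H(x,Du(x))=0$ in $\mathbb{R}^n$, $u$ $\mathbb{Z}^n$-periodic, then the family $\{\delta u_\delta\}_{0<\delta\le1}$ is equicontinuous. For $K\subset\mathbb{R}^n$, $\operatorname{dist}_K(x)=\inf_{y\in K}|y-x|$. A dominion of player 1 in $\Gamma^-$ is a nonempty closed set $D\subset\mathbb{R}^n$ such that for all $x\in D$, $\varepsilon>0$, $T\ge0$ there is $\alpha\in\mathfrak{A}$ such that for all $b\in\mathscr{B}$ and $t\in[0,T]$, $\operatorname{dist}_D(X^{x,\alpha,b}_t)\le\varepsilon$. A dominion of player 2 in $\Gamma^-$ is a nonempty closed set $D\subset\mathbb{R}^n$ such that for all $x\in D$, $\varepsilon>0$, $T\ge0$ and all $\alpha\in\mathfrak{A}$ there is $b\in\mathscr{B}$ such that for all $t\in[0,T]$, $\operatorname{dist}_D(X^{x,\alpha,b}_t)\le\varepsilon$. $\pi:\mathbb{R}^n\to\mathbb{R}^n/\mathbb{Z}^n$ is the quotient map, and the overline denotes topological closure. A dominion in the torus of a player is a set $\overline{\pi(D)}$ with $D\subset\mathbb{R}^n$ a dominion of that player in $\Gamma^-$. *)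

theory Defs
  imports "HOL-Analysis.Analysis"
begin

definition int_lattice :: "(real^'n) set" where
  "int_lattice = {k. \<forall>i. k $ i \<in> \<int>}"

definition lattice_periodic :: "(real^'n \<Rightarrow> 'c) \<Rightarrow> bool" where
  "lattice_periodic g \<longleftrightarrow> (\<forall>x. \<forall>k\<in>int_lattice. g (x + k) = g x)"

locale differential_game =
  fixes A :: "'a::metric_space set" and B :: "'b::metric_space set"
    and f :: "real^'n \<Rightarrow> 'a \<Rightarrow> 'b \<Rightarrow> real^'n"
    and l :: "real^'n \<Rightarrow> 'a \<Rightarrow> 'b \<Rightarrow> real"
  assumes compact_A: "compact A" and nonempty_A: "A \<noteq> {}"
    and compact_B: "compact B" and nonempty_B: "B \<noteq> {}"
    and continuous_f: "continuous_on (UNIV \<times> A \<times> B) (\<lambda>(x, a, b). f x a b)"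
    and lipschitz_f: "\<exists>L\<ge>0. \<forall>x y. \<forall>a\<in>A. \<forall>b\<in>B. norm (f x a b - f y a b) \<le> L * norm (x - y)"
    and continuous_l: "continuous_on (UNIV \<times> A \<times> B) (\<lambda>(x, a, b). l x a b)"
    and bounded_l: "\<exists>M. \<forall>x. \<forall>a\<in>A. \<forall>b\<in>B. \<bar>l x a b\<bar> \<le> M"
    and modulus_l: "\<exists>\<omega> :: real \<Rightarrow> real.
          mono_on {0..} \<omega> \<and> (\<forall>r\<ge>0. 0 \<le> \<omega> r) \<and> \<omega> 0 = 0 \<and> continuous (at 0 within {0..}) \<omega> \<and>
          (\<forall>x y. \<forall>a\<in>A. \<forall>b\<in>B. \<bar>l x a b - l y a b\<bar> \<le> \<omega> (norm (x - y)))"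
    and periodic_f: "\<And>a b. a \<in> A \<Longrightarrow> b \<in> B \<Longrightarrow> lattice_periodic (\<lambda>x. f x a b)"
    and periodic_l: "\<And>a b. a \<in> A \<Longrightarrow> b \<in> B \<Longrightarrow> lattice_periodic (\<lambda>x. l x a b)"

text \<open>Maps with domain \<open>[0,\<infinity>)\<close> are represented by total functions on the reals that are
  \<open>undefined\<close> at negative times, so that \<open>controls S\<close> is exactly the set of measurable
  maps from \<open>[0,\<infinity>)\<close> to \<open>S\<close>.\<close>

definition controls :: "'c::metric_space set \<Rightarrow> (real \<Rightarrow> 'c) set" where
  "controls S = {c \<in> {0..} \<rightarrow>\<^sub>E S. c \<in> measurable (lebesgue_on {0..}) borel}"

definition agree_upto :: "real \<Rightarrow> (real \<Rightarrow> 'c) \<Rightarrow> (real \<Rightarrow> 'c) \<Rightarrow> bool" where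
  "agree_upto t c d \<longleftrightarrow> (AE s in lebesgue. 0 \<le> s \<and> s \<le> t \<longrightarrow> c s = d s)"

definition strategies ::
    "'a::metric_space set \<Rightarrow> 'b::metric_space set \<Rightarrow> ((real \<Rightarrow> 'b) \<Rightarrow> (real \<Rightarrow> 'a)) set" where
  "strategies A B = {\<alpha> \<in> controls B \<rightarrow> controls A.
     \<forall>t>0. \<forall>b1\<in>controls B. \<forall>b2\<in>controls B.
       agree_upto t b1 b2 \<longrightarrow> agree_upto t (\<alpha> b1) (\<alpha> b2)}"

definition absolutely_continuous_on_interval ::
    "real \<Rightarrow> real \<Rightarrow> (real \<Rightarrow> 'c::metric_space) \<Rightarrow> bool" where
  "absolutely_continuous_on_interval u v X \<longleftrightarrow>
     (\<forall>\<epsilon>>0. \<exists>\<eta>>0. \<forall>P :: (real \<times> real) set.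
        finite P \<and> (\<forall>(s, t)\<in>P. u \<le> s \<and> s \<le> t \<and> t \<le> v) \<and>
        disjoint_family_on (\<lambda>(s, t). {s<..<t}) P \<and> (\<Sum>(s, t)\<in>P. t - s) < \<eta>
        \<longrightarrow> (\<Sum>(s, t)\<in>P. dist (X s) (X t)) < \<epsilon>)"

text \<open>Solutions of the differential equation are meant in the sense of Caratheodory: locally
  absolutely continuous functions satisfying the equation almost everywhere.\<close>

definition is_trajectory ::
    "(real^'n \<Rightarrow> 'a \<Rightarrow> 'b \<Rightarrow> real^'n) \<Rightarrow> real^'n \<Rightarrow> (real \<Rightarrow> 'a) \<Rightarrow> (real \<Rightarrow> 'b)
      \<Rightarrow> (real \<Rightarrow> real^'n) \<Rightarrow> bool" where
  "is_trajectory f x a b X \<longleftrightarrow>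
     X \<in> extensional {0..} \<and> X 0 = x \<and>
     (\<forall>T\<ge>0. absolutely_continuous_on_interval 0 T X) \<and>
     (AE t in lebesgue. 0 < t \<longrightarrow> (X has_vector_derivative f (X t) (a t) (b t)) (at t))"

definition trajectory ::
    "(real^'n \<Rightarrow> 'a \<Rightarrow> 'b \<Rightarrow> real^'n) \<Rightarrow> real^'n \<Rightarrow> (real \<Rightarrow> 'a) \<Rightarrow> (real \<Rightarrow> 'b)
      \<Rightarrow> (real \<Rightarrow> real^'n)" where
  "trajectory f x a b = (THE X. is_trajectory f x a b X)"

definition discounted_payoff ::
    "(real^'n \<Rightarrow> 'a \<Rightarrow> 'b \<Rightarrow> real^'n) \<Rightarrow> (real^'n \<Rightarrow> 'a \<Rightarrow> 'b \<Rightarrow> real) \<Rightarrow> real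
      \<Rightarrow> real^'n \<Rightarrow> (real \<Rightarrow> 'a) \<Rightarrow> (real \<Rightarrow> 'b) \<Rightarrow> real" where
  "discounted_payoff f l \<delta> x a b =
     (LINT s:{0..}|lebesgue. exp (- \<delta> * s) * l (trajectory f x a b s) (a s) (b s))"

definition lower_value ::
    "'a::metric_space set \<Rightarrow> 'b::metric_space set \<Rightarrow> (real^'n \<Rightarrow> 'a \<Rightarrow> 'b \<Rightarrow> real^'n)
      \<Rightarrow> (real^'n \<Rightarrow> 'a \<Rightarrow> 'b \<Rightarrow> real) \<Rightarrow> real \<Rightarrow> real^'n \<Rightarrow> real" where
  "lower_value A B f l \<delta> x =
     (INF \<alpha>\<in>strategies A B. SUP b\<in>controls B. discounted_payoff f l \<delta> x (\<alpha> b) b)"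

definition ergodic ::
    "'a::metric_space set \<Rightarrow> 'b::metric_space set \<Rightarrow> (real^'n \<Rightarrow> 'a \<Rightarrow> 'b \<Rightarrow> real^'n)
      \<Rightarrow> (real^'n \<Rightarrow> 'a \<Rightarrow> 'b \<Rightarrow> real) \<Rightarrow> bool" where
  "ergodic A B f l \<longleftrightarrow>
     (\<exists>c. uniform_limit UNIV (\<lambda>\<delta> x. \<delta> * lower_value A B f l \<delta> x) (\<lambda>x. c) (at_right 0))"

definition uniquely_ergodic ::
    "'a::metric_space set \<Rightarrow> 'b::metric_space set \<Rightarrow> (real^'n \<Rightarrow> 'a \<Rightarrow> 'b \<Rightarrow> real^'n)
      \<Rightarrow> (real^'n \<Rightarrow> 'a \<Rightarrow> 'b \<Rightarrow> real) \<Rightarrow> bool" where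
  "uniquely_ergodic A B f l \<longleftrightarrow>
     (\<forall>g. continuous_on UNIV g \<and> lattice_periodic g \<longrightarrow> ergodic A B f (\<lambda>x a b. l x a b + g x))"

text \<open>For games satisfying the standing assumptions, the suprema and infima below are over
  nonempty compact sets of reals and hence are attained maxima and minima.\<close>

definition hamiltonian ::
    "'a set \<Rightarrow> 'b set \<Rightarrow> (real^'n \<Rightarrow> 'a \<Rightarrow> 'b \<Rightarrow> real^'n)
      \<Rightarrow> (real^'n \<Rightarrow> 'a \<Rightarrow> 'b \<Rightarrow> real) \<Rightarrow> real^'n \<Rightarrow> real^'n \<Rightarrow> real" where
  "hamiltonian A B f l x p = (INF b\<in>B. SUP a\<in>A. - (f x a b \<bullet> p) - l x a b)"

definition recession_hamiltonian ::
    "'a set \<Rightarrow> 'b set \<Rightarrow> (real^'n \<Rightarrow> 'a \<Rightarrow> 'b \<Rightarrow> real^'n) \<Rightarrow> real^'n \<Rightarrow> real^'n \<Rightarrow> real" where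
  "recession_hamiltonian A B f x p = (INF b\<in>B. SUP a\<in>A. - (f x a b \<bullet> p))"

definition C1_gradient :: "(real^'n \<Rightarrow> real) \<Rightarrow> (real^'n \<Rightarrow> real^'n) \<Rightarrow> bool" where
  "C1_gradient \<phi> D\<phi> \<longleftrightarrow> (\<forall>x. GDERIV \<phi> x :> D\<phi> x) \<and> continuous_on UNIV D\<phi>"

text \<open>Continuous viscosity solutions of \<open>F x (u x) (Du x) = 0\<close> in the whole space.\<close>

definition viscosity_subsolution ::
    "(real^'n \<Rightarrow> real \<Rightarrow> real^'n \<Rightarrow> real) \<Rightarrow> (real^'n \<Rightarrow> real) \<Rightarrow> bool" where
  "viscosity_subsolution F u \<longleftrightarrow>
     (\<forall>\<phi> D\<phi> x. C1_gradient \<phi> D\<phi> \<and> (\<forall>\<^sub>F y in nhds x. u y - \<phi> y \<le> u x - \<phi> x)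
        \<longrightarrow> F x (u x) (D\<phi> x) \<le> 0)"

definition viscosity_supersolution ::
    "(real^'n \<Rightarrow> real \<Rightarrow> real^'n \<Rightarrow> real) \<Rightarrow> (real^'n \<Rightarrow> real) \<Rightarrow> bool" where
  "viscosity_supersolution F u \<longleftrightarrow>
     (\<forall>\<phi> D\<phi> x. C1_gradient \<phi> D\<phi> \<and> (\<forall>\<^sub>F y in nhds x. u x - \<phi> x \<le> u y - \<phi> y)
        \<longrightarrow> 0 \<le> F x (u x) (D\<phi> x))"

definition continuous_viscosity_solution ::
    "(real^'n \<Rightarrow> real \<Rightarrow> real^'n \<Rightarrow> real) \<Rightarrow> (real^'n \<Rightarrow> real) \<Rightarrow> bool" where
  "continuous_viscosity_solution F u \<longleftrightarrow>
     continuous_on UNIV u \<and> viscosity_subsolution F u \<and> viscosity_supersolution F u"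

definition equicontinuous_family :: "'i set \<Rightarrow> ('i \<Rightarrow> real^'n \<Rightarrow> real) \<Rightarrow> bool" where
  "equicontinuous_family I h \<longleftrightarrow>
     (\<forall>x. \<forall>\<epsilon>>0. \<exists>\<eta>>0. \<forall>i\<in>I. \<forall>y. dist y x < \<eta> \<longrightarrow> dist (h i y) (h i x) < \<epsilon>)"

definition structural_equicontinuity ::
    "'a set \<Rightarrow> 'b set \<Rightarrow> (real^'n \<Rightarrow> 'a \<Rightarrow> 'b \<Rightarrow> real^'n)
      \<Rightarrow> (real^'n \<Rightarrow> 'a \<Rightarrow> 'b \<Rightarrow> real) \<Rightarrow> bool" where
  "structural_equicontinuity A B f l \<longleftrightarrow>
     (\<forall>g u. continuous_on UNIV g \<and> lattice_periodic g \<and>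
        (\<forall>\<delta>\<in>{0<..1}. lattice_periodic (u \<delta>) \<and>
           continuous_viscosity_solution (\<lambda>x r p. \<delta> * r + g x + hamiltonian A B f l x p) (u \<delta>))
        \<longrightarrow> equicontinuous_family {0<..1} (\<lambda>\<delta> x. \<delta> * u \<delta> x))"

definition dominion1 ::
    "'a::metric_space set \<Rightarrow> 'b::metric_space set \<Rightarrow> (real^'n \<Rightarrow> 'a \<Rightarrow> 'b \<Rightarrow> real^'n)
      \<Rightarrow> (real^'n) set \<Rightarrow> bool" where
  "dominion1 A B f D \<longleftrightarrow> D \<noteq> {} \<and> closed D \<and>
     (\<forall>x\<in>D. \<forall>\<epsilon>>0. \<forall>T\<ge>0. \<exists>\<alpha>\<in>strategies A B. \<forall>b\<in>controls B. \<forall>t\<in>{0..T}.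
        infdist (trajectory f x (\<alpha> b) b t) D \<le> \<epsilon>)"

definition dominion2 ::
    "'a::metric_space set \<Rightarrow> 'b::metric_space set \<Rightarrow> (real^'n \<Rightarrow> 'a \<Rightarrow> 'b \<Rightarrow> real^'n)
      \<Rightarrow> (real^'n) set \<Rightarrow> bool" where
  "dominion2 A B f D \<longleftrightarrow> D \<noteq> {} \<and> closed D \<and>
     (\<forall>x\<in>D. \<forall>\<epsilon>>0. \<forall>T\<ge>0. \<forall>\<alpha>\<in>strategies A B. \<exists>b\<in>controls B. \<forall>t\<in>{0..T}.
        infdist (trajectory f x (\<alpha> b) b t) D \<le> \<epsilon>)"

text \<open>Points of the torus are cosets of the integer lattice, and the torus carries the quotient
  topology.\<close>

definition torus_proj :: "real^'n \<Rightarrow> (real^'n) set" where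
  "torus_proj x = {y. y - x \<in> int_lattice}"

definition torus_topology :: "(real^'n) set topology" where
  "torus_topology = topology (\<lambda>U. U \<subseteq> range torus_proj \<and> open (torus_proj -` U))"

lemma openin_torus_topology:
  fixes U :: "(real^'n) set set"
  shows "openin torus_topology U \<longleftrightarrow> U \<subseteq> range torus_proj \<and> open (torus_proj -` U)"
proof -
  have "istopology (\<lambda>U :: (real^'n) set set. U \<subseteq> range torus_proj \<and> open (torus_proj -` U))"
    by (auto simp: istopology_def vimage_Union intro!: open_Int open_UN)
  then show ?thesis
    unfolding torus_topology_def by (simp add: topology_inverse')
qed

lemma topspace_torus_topology:
  "topspace torus_topology = range (torus_proj :: real^'n \<Rightarrow> _)"
proof -
  have "torus_proj -` range torus_proj = (UNIV :: (real^'n) set)"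
    by auto
  then have "openin torus_topology (range (torus_proj :: real^'n \<Rightarrow> _))"
    by (simp add: openin_torus_topology)
  then show ?thesis
    by (metis openin_subset openin_torus_topology openin_topspace subset_antisym)
qed

lemma quotient_map_torus_proj: "quotient_map euclidean torus_topology torus_proj"
  by (simp add: quotient_map_def topspace_torus_topology openin_torus_topology vimage_def)

definition torus_dominions1 ::
    "'a::metric_space set \<Rightarrow> 'b::metric_space set \<Rightarrow> (real^'n \<Rightarrow> 'a \<Rightarrow> 'b \<Rightarrow> real^'n)
      \<Rightarrow> (real^'n) set set set" where
  "torus_dominions1 A B f = {torus_topology closure_of (torus_proj ` D) |D. dominion1 A B f D}"

definition torus_dominions2 ::
    "'a::metric_space set \<Rightarrow> 'b::metric_space set \<Rightarrow> (real^'n \<Rightarrow> 'a \<Rightarrow> 'b \<Rightarrow> real^'n)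
      \<Rightarrow> (real^'n) set set set" where
  "torus_dominions2 A B f = {torus_topology closure_of (torus_proj ` D) |D. dominion2 A B f D}"

end

theory Submission
  imports Defs "HOL-Complex_Analysis.Great_Picard"
begin

text \<open>
  The theorem holds because a viscosity inequality can be turned into a guarantee in the game. Let
  \<open>w\<close> be continuous and periodic and let \<open>H\<close> be the Hamiltonian for a running payoff \<open>l\<close>. If
  \<open>H x (Dw x) \<ge> 0\<close> in the viscosity sense, then from every \<open>x\<close> and for every horizon \<open>T\<close> and
  tolerance \<open>e\<close> player 1 has a strategy that keeps \<open>w (X t) + (\<integral>s\<le>t. l) \<le> w x + e\<close> for all
  \<open>t \<le> T\<close> (\<open>supersolution_guarantee\<close>); if \<open>H x (Dw x) \<le> 0\<close>, player 2 can keep the same quantity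
  above \<open>w x - e\<close> against every strategy (\<open>subsolution_guarantee\<close>). The strategies aim at proximal
  points: if \<open>y\<close> minimises \<open>w z + c/2 |x - z|\<^sup>2\<close>, the inequality at \<open>y\<close> with slope \<open>p = c (x - y)\<close>
  provides actions that make \<open>f y a b \<bullet> p + l y a b\<close> almost nonpositive for player 1, or
  almost nonnegative for player 2 with the corresponding \<open>y\<close> and \<open>p\<close>. Since \<open>p\<close> is the slope of the
  Moreau envelope of \<open>w\<close> at \<open>x\<close>, the envelope plus the accumulated payoff then moves in the unwanted
  direction by at most a small multiple of the length of a short step (\<open>aiming_step\<close>), and the steps are
  concatenated.

  Part (1). With \<open>l = 0\<close> a solution \<open>w\<close> of the recession equation has both guarantees. Hence
  player 1 can stay near the set where \<open>w\<close> is minimal and player 2 near the set where it is maximal,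
  so that these sets are dominions. They are closed and invariant under the lattice, and their images
  in the torus can only meet if the minimum equals the maximum (\<open>guaranteed_function_constant\<close>).

  Part (2), necessity. If two dominions have disjoint closures in the torus, a periodic \<open>g\<close> can be
  chosen very negative on the first and very positive on the second. Each player stays near its own
  dominion during an arbitrarily long time, and \<open>\<delta> v\<^sub>\<delta>\<close> is at most \<open>-1\<close> on the one and at least \<open>1\<close>
  on the other, for all discount rates (\<open>uniquely_ergodic_no_disjoint_dominions\<close>).

  Part (2), sufficiency. Dynamic programming over short intervals shows that the values \<open>v\<^sub>\<delta>\<close> for the
  payoff \<open>l + g\<close> solve the discounted equation (\<open>value_subsolution\<close>, \<open>value_supersolution\<close>), so that
  structural equicontinuity applies to them and \<open>\<delta> v\<^sub>\<delta>\<close> converges uniformly along a sequence to some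
  \<open>w\<close>. Now \<open>v\<^sub>\<delta>\<close> also solves the undiscounted equation for the payoff \<open>l + g - \<delta> v\<^sub>\<delta>\<close>. Its guarantees,
  multiplied by \<open>\<delta>\<close>, become in the limit guarantees for \<open>w\<close> with payoff \<open>0\<close>, and as above \<open>w\<close> is a
  constant \<open>c\<close>. The same guarantees for one \<open>\<delta>\<close> with \<open>\<delta> v\<^sub>\<delta>\<close> close to \<open>c\<close> bound the payoff accumulated up
  to time \<open>t\<close> by \<open>c t\<close> up to a constant and a small multiple of \<open>t\<close>. By the second mean value theorem
  this carries over to every much smaller discount rate, so that the whole family converges to \<open>c\<close>
  (\<open>almost_constant_propagates\<close>).

  On the way, trajectories are identified with the solutions of the integral equation, by
  the fundamental theorem of calculus for absolutely continuous functions and Lebesgue differentiation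
  (\<open>solves_trajectory_equiv\<close>).
\<close>

section \<open>Periodic functions\<close>

lemma int_lattice_floor: "- (\<chi> i. of_int \<lfloor>x $ i\<rfloor>) \<in> (int_lattice :: (real^'n) set)"
  by (auto simp: int_lattice_def)

lemma int_lattice_closed:
  assumes "k \<in> int_lattice" "m \<in> int_lattice"
  shows "k + m \<in> int_lattice" "k - m \<in> int_lattice" "- k \<in> int_lattice"
  using assms by (auto simp: int_lattice_def)

lemma translate_to_cube:
  fixes x :: "real^'n"
  obtains k where "k \<in> int_lattice" "x + k \<in> cbox 0 1"
proof
  show "- (\<chi> i. of_int \<lfloor>x $ i\<rfloor>) \<in> (int_lattice :: (real^'n) set)"
    by (rule int_lattice_floor)
  show "x + - (\<chi> i. of_int \<lfloor>x $ i\<rfloor>) \<in> cbox 0 1"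
    by (auto simp: mem_box_cart) linarith
qed

lemma lattice_periodic_range:
  fixes g :: "real^'n \<Rightarrow> 'c"
  assumes "lattice_periodic g"
  shows "range g = g ` cbox 0 1"
proof -
  have "g x \<in> g ` cbox 0 1" for x
    by (metis assms image_eqI lattice_periodic_def translate_to_cube)
  then show ?thesis by auto
qed

lemma periodic_bounded:
  fixes g :: "real^'n \<Rightarrow> real"
  assumes "continuous_on UNIV g" "lattice_periodic g"
  shows "\<exists>C. \<forall>x. \<bar>g x\<bar> \<le> C"
proof -
  have "compact (g ` cbox 0 1)"
    using assms(1) by (intro compact_continuous_image) (auto intro: continuous_on_subset)
  then have "bounded (range g)"
    unfolding lattice_periodic_range[OF assms(2)] by (rule compact_imp_bounded)
  then show ?thesis by (auto simp: bounded_iff)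
qed

lemma periodic_attains_min:
  fixes g :: "real^'n \<Rightarrow> real"
  assumes "continuous_on UNIV g" "lattice_periodic g"
  shows "\<exists>x. \<forall>y. g x \<le> g y"
proof -
  have "continuous_on (cbox 0 1) g" using assms(1) continuous_on_subset by blast
  moreover have "cbox 0 (1::real^'n) \<noteq> {}" by (auto simp: interval_ne_empty_cart(1))
  ultimately obtain x where x: "\<forall>y\<in>cbox 0 1. g x \<le> g y"
    using continuous_attains_inf[of "cbox 0 (1::real^'n)" g] by auto
  have "g x \<le> g y" for y
  proof -
    have "g y \<in> g ` cbox 0 1" using lattice_periodic_range[OF assms(2)] by blast
    then show ?thesis using x by auto
  qed
  then show ?thesis by blast
qed

text \<open>
  Two points at distance less than 1 are moved by one lattice vector into the cube that is larger
  by 1 on each side, so uniform continuity on this compact cube is enough.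
\<close>

lemma periodic_uniformly_continuous:
  fixes g :: "real^'n \<Rightarrow> real"
  assumes "continuous_on UNIV g" "lattice_periodic g" "0 < e"
  shows "\<exists>d>0. \<forall>x y. norm (x - y) < d \<longrightarrow> \<bar>g x - g y\<bar> < e"
proof -
  have "uniformly_continuous_on (cbox (-1) (2::real^'n)) g"
    using assms(1) by (intro compact_uniformly_continuous) (auto intro: continuous_on_subset)
  then obtain d where d: "0 < d" "\<And>x y. \<lbrakk>x \<in> cbox (-1) 2; y \<in> cbox (-1) 2; dist x y < d\<rbrakk> \<Longrightarrow> dist (g x) (g y) < e"
    using assms(3) unfolding uniformly_continuous_on_def by blast
  have "\<bar>g x - g y\<bar> < e" if xy: "norm (x - y) < min d 1" for x y :: "real^'n"
  proof -
    obtain k where k: "k \<in> int_lattice" "x + k \<in> cbox 0 1" by (rule translate_to_cube)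
    have x01: "0 \<le> x $ i + k $ i" "x $ i + k $ i \<le> 1" for i using k(2) by (auto simp: mem_box_cart)
    have xy1: "\<bar>x $ i - y $ i\<bar> < 1" for i using xy component_le_norm_cart[of "x - y" i] by simp
    have "-1 \<le> y $ i + k $ i \<and> y $ i + k $ i \<le> 2" for i
      using x01[of i] xy1[of i] by (auto simp: abs_less_iff)
    then have "y + k \<in> cbox (-1) 2" by (simp add: mem_box_cart)
    moreover have "x + k \<in> cbox (-1) 2"
      using x01 by (auto simp: mem_box_cart intro: order_trans[of "-1" 0] order_trans[of _ 1 2])
    ultimately have "dist (g (x + k)) (g (y + k)) < e"
      using d xy by (auto simp: dist_norm)
    then show ?thesis using assms(2) k(1) by (simp add: lattice_periodic_def dist_real_def)
  qed
  then show ?thesis using d(1) by (intro exI[of _ "min d 1"]) simp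
qed

section \<open>Integration on the half-line\<close>

lemma bounded_measurable_integrable_on:
  fixes g :: "real \<Rightarrow> 'e::euclidean_space"
  assumes g: "g \<in> borel_measurable (lebesgue_on {0..})" and C: "\<And>s. 0 \<le> s \<Longrightarrow> norm (g s) \<le> C" and s: "0 \<le> s"
  shows "g integrable_on {s..t}"
proof (rule measurable_bounded_by_integrable_imp_integrable)
  show "g \<in> borel_measurable (lebesgue_on {s..t})"
  proof -
    have "{s..t} \<subseteq> {0..}" using s by auto
    then show ?thesis using measurable_restrict_mono[OF g] by blast
  qed
  show "(\<lambda>x. C) integrable_on {s..t}" by (rule integrable_const_ivl)
  show "{s..t} \<in> sets lebesgue" by simp
  show "\<And>x. x \<in> {s..t} \<Longrightarrow> norm (g x) \<le> C" using C s by auto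
qed

lemma integral_norm_le_const:
  fixes g :: "real \<Rightarrow> 'e::euclidean_space"
  assumes "g integrable_on {s..t}" "s \<le> t" "\<And>r. r \<in> {s..t} \<Longrightarrow> norm (g r) \<le> C"
  shows "norm (integral {s..t} g) \<le> C * (t - s)"
proof -
  have "norm (integral {s..t} g) \<le> integral {s..t} (\<lambda>_. C)"
    by (rule integral_norm_bound_integral) (use assms in \<open>auto intro: integrable_const_ivl\<close>)
  then show ?thesis using assms(2) by (simp add: mult.commute)
qed

lemma integral_le_const:
  fixes g :: "real \<Rightarrow> real"
  assumes "g integrable_on {s..t}" "s \<le> t" "\<And>r. r \<in> {s..t} \<Longrightarrow> g r \<le> C"
  shows "integral {s..t} g \<le> C * (t - s)"
proof -
  have "integral {s..t} g \<le> integral {s..t} (\<lambda>_. C)"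
    by (rule integral_le) (use assms in \<open>auto intro: integrable_const_ivl\<close>)
  then show ?thesis using assms(2) by (simp add: mult.commute)
qed

lemma integral_translate:
  fixes g :: "real \<Rightarrow> 'e::euclidean_space"
  shows "integral {0..t} (\<lambda>s. g (h + s)) = integral {h..h+t} g"
  using integral_shift_real_ivl[of h h "h+t" g] by (simp add: add.commute)

text \<open>
  With \<open>G t = integral {0..t} u\<close>, the hypothesis says that \<open>(c + L G) exp (- L t)\<close> is
  nonincreasing.
\<close>

lemma gronwall:
  fixes u :: "real \<Rightarrow> real"
  assumes u: "continuous_on {0..T} u" and L: "0 \<le> L"
    and le: "\<And>t. t \<in> {0..T} \<Longrightarrow> u t \<le> c + L * integral {0..t} u" and t: "t \<in> {0..T}"
  shows "u t \<le> c * exp (L * t)"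
proof -
  define G where "G = (\<lambda>t. integral {0..t} u)"
  have ut: "continuous_on {0..t} u" using u t by (auto intro: continuous_on_subset)
  have G: "(G has_real_derivative u s) (at s within {0..t})" if "s \<in> {0..t}" for s
    unfolding G_def using integral_has_vector_derivative[OF ut that]
    by (simp add: has_real_derivative_iff_has_vector_derivative)
  define k where "k = (\<lambda>s. (c + L * G s) * exp (- L * s))"
  have k: "(k has_real_derivative (L * (u s - (c + L * G s)) * exp (- L * s))) (at s within {0..t})"
    if "s \<in> {0..t}" for s
    unfolding k_def
    by (rule derivative_eq_intros G[OF that] refl | simp)+
      (simp add: algebra_simps)
  have "((\<lambda>s. L * (u s - (c + L * G s)) * exp (- L * s)) has_integral (k t - k 0)) {0..t}"
    by (rule fundamental_theorem_of_calculus) (use t k in \<open>auto simp: has_real_derivative_iff_has_vector_derivative\<close>)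
  moreover have "L * (u s - (c + L * G s)) * exp (- L * s) \<le> 0" if "s \<in> {0..t}" for s
    using le[of s] that t L by (intro mult_nonpos_nonneg mult_nonneg_nonpos) (auto simp: G_def)
  ultimately have "k t - k 0 \<le> 0" by (rule has_integral_le[OF _ has_integral_0])
  moreover have "k 0 = c" by (simp add: k_def G_def)
  ultimately have "c + L * G t \<le> c * exp (L * t)"
    by (simp add: k_def G_def exp_minus field_simps)
  then show ?thesis using le[OF t] by (simp add: G_def)
qed

subsection \<open>Indefinite integrals and absolutely continuous functions\<close>

text \<open>
  The one-sided form of Lebesgue's differentiation theorem, from which the two-sided one is
  deduced by reflection.
\<close>

lemma AE_indefinite_integral_derivative_right:
  fixes g :: "real \<Rightarrow> 'e::euclidean_space"
  assumes g: "\<And>a b. g integrable_on {a..b}"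
  obtains N where "negligible N"
    "\<And>x. x \<notin> N \<Longrightarrow> ((\<lambda>h. integral {x..x+h} g /\<^sub>R h) \<longlongrightarrow> g x) (at_right 0)"
proof -
  obtain N where N: "negligible N"
    "\<And>x e. \<lbrakk>x \<notin> N; 0 < e\<rbrakk> \<Longrightarrow> \<exists>d>0. \<forall>h. 0 < h \<and> h < d \<longrightarrow> norm(integral (cbox x (x + h *\<^sub>R One)) g /\<^sub>R h ^ DIM(real) - g x) < e"
    using integrable_ccontinuous_explicit[of g] g by (metis box_real(2))
  show thesis
  proof
    fix x assume "x \<notin> N"
    show "((\<lambda>h. integral {x..x+h} g /\<^sub>R h) \<longlongrightarrow> g x) (at_right 0)"
    proof (rule tendstoI)
      fix e :: real assume "0 < e"
      from N(2)[OF \<open>x \<notin> N\<close> this] show "\<forall>\<^sub>F h in at_right 0. dist (integral {x..x + h} g /\<^sub>R h) (g x) < e"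
        by (auto simp: eventually_at_right_field dist_norm)
    qed
  qed (fact N(1))
qed

text \<open>
  The left difference quotients of the integral of \<open>g\<close> at \<open>x\<close> are the right difference
  quotients of the integral of \<open>\<lambda>s. g (- s)\<close> at \<open>- x\<close>.
\<close>

lemma AE_indefinite_integral_derivative:
  fixes g :: "real \<Rightarrow> 'e::euclidean_space"
  assumes g: "\<And>a b. g integrable_on {a..b}"
  obtains N where "negligible N"
    "\<And>x. \<lbrakk>x \<notin> N; 0 < x\<rbrakk> \<Longrightarrow> ((\<lambda>t. integral {0..t} g) has_vector_derivative g x) (at x)"
proof -
  obtain N where N: "negligible N"
    "\<And>x. x \<notin> N \<Longrightarrow> ((\<lambda>h. integral {x..x+h} g /\<^sub>R h) \<longlongrightarrow> g x) (at_right 0)"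
    using AE_indefinite_integral_derivative_right[OF g] by blast
  have g': "(\<lambda>s. g (- s)) integrable_on {a..b}" for a b
    using g[of "-b" "-a"] Henstock_Kurzweil_Integration.integrable_reflect_real[where f=g and a="-b" and b="-a"] by simp
  obtain N' where N': "negligible N'"
    "\<And>x. x \<notin> N' \<Longrightarrow> ((\<lambda>h. integral {x..x+h} (\<lambda>s. g (-s)) /\<^sub>R h) \<longlongrightarrow> g (-x)) (at_right 0)"
    using AE_indefinite_integral_derivative_right[OF g'] by blast
  show thesis
  proof
    show "negligible (N \<union> uminus ` N')"
      using N(1) negligible_differentiable_image_negligible[OF order_refl N'(1) differentiable_on_minus[OF differentiable_on_ident]] by (simp add: negligible_Un)
    fix x :: real assume x: "x \<notin> N \<union> uminus ` N'" "0 < x"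
    define I where "I = (\<lambda>t. integral {0..t} g)"
    have "- x \<notin> N'" using x by (metis UnI2 image_eqI minus_minus)
    from N'(2)[OF this] have "((\<lambda>h. integral {-x..-x+h} (\<lambda>s. g (-s)) /\<^sub>R h) \<longlongrightarrow> g x) (at_right 0)" by simp
    moreover have "integral {-x..-x+h} (\<lambda>s. g (-s)) = integral {x-h..x} g" for h
      using Henstock_Kurzweil_Integration.integral_reflect_real[where f=g and a="x-h" and b=x] by simp
    ultimately have "((\<lambda>h. integral {x-h..x} g /\<^sub>R h) \<longlongrightarrow> g x) (at_right 0)" by simp
    moreover have "\<forall>\<^sub>F h in at_right 0. integral {x-h..x} g /\<^sub>R h = (I (x + (-h)) - I x) /\<^sub>R (-h)"
      unfolding eventually_at_right_field
    proof (intro exI[of _ x] conjI allI impI)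
      fix h assume h: "0 < h" "h < x"
      have "integral {0..x-h} g + integral {x-h..x} g = integral {0..x} g"
        by (rule Henstock_Kurzweil_Integration.integral_combine) (use h g in auto)
      then show "integral {x-h..x} g /\<^sub>R h = (I (x + (-h)) - I x) /\<^sub>R (-h)"
        by (auto simp: I_def algebra_simps) (metis scaleR_add_right)
    qed (use x in simp)
    ultimately have "((\<lambda>h. (I (x + (-h)) - I x) /\<^sub>R (-h)) \<longlongrightarrow> g x) (at_right 0)"
      by (rule Lim_transform_eventually)
    then have left: "((\<lambda>h. (I (x + h) - I x) /\<^sub>R h) \<longlongrightarrow> g x) (at_left 0)"
      by (simp add: filterlim_at_left_to_right)
    have "((\<lambda>h. integral {x..x+h} g /\<^sub>R h) \<longlongrightarrow> g x) (at_right 0)" using N(2) x by simp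
    moreover have "\<forall>\<^sub>F h in at_right 0. integral {x..x+h} g /\<^sub>R h = (I (x + h) - I x) /\<^sub>R h"
      unfolding eventually_at_right_field
    proof (intro exI[of _ 1] conjI allI impI)
      fix h :: real assume h: "0 < h" "h < 1"
      have "integral {0..x} g + integral {x..x+h} g = integral {0..x+h} g"
        by (rule Henstock_Kurzweil_Integration.integral_combine) (use h g x in auto)
      then have "integral {x..x+h} g = I (x + h) - I x" by (simp add: I_def algebra_simps)
      then show "integral {x..x+h} g /\<^sub>R h = (I (x + h) - I x) /\<^sub>R h" by simp
    qed simp
    ultimately have right: "((\<lambda>h. (I (x + h) - I x) /\<^sub>R h) \<longlongrightarrow> g x) (at_right 0)"
      by (rule Lim_transform_eventually)
    have "((\<lambda>h. (I (x + h) - I x) /\<^sub>R h) \<longlongrightarrow> g x) (at 0)"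
      using left right filterlim_split_at by blast
    then show "((\<lambda>t. integral {0..t} g) has_vector_derivative g x) (at x)"
      unfolding has_vector_derivative_def has_derivative_at I_def[symmetric]
    proof (intro conjI)
      have "\<forall>\<^sub>F h in at 0. norm ((I (x + h) - I x) /\<^sub>R h - g x) = norm (I (x + h) - I x - h *\<^sub>R g x) / norm h"
        unfolding eventually_at_filter
      proof (intro always_eventually allI impI)
        fix h :: real assume "h \<noteq> 0"
        then have "(I (x + h) - I x) /\<^sub>R h - g x = (I (x + h) - I x - h *\<^sub>R g x) /\<^sub>R h"
          by (simp add: scaleR_diff_right)
        then show "norm ((I (x + h) - I x) /\<^sub>R h - g x) = norm (I (x + h) - I x - h *\<^sub>R g x) / norm h"
          by (simp add: divide_inverse mult.commute)
      qed
      moreover assume "((\<lambda>h. (I (x + h) - I x) /\<^sub>R h) \<longlongrightarrow> g x) (at 0)"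
      then have "((\<lambda>h. norm ((I (x + h) - I x) /\<^sub>R h - g x)) \<longlongrightarrow> 0) (at 0)"
        using LIM_zero tendsto_norm_zero by blast
      ultimately show "((\<lambda>h. norm (I (x + h) - I x - h *\<^sub>R g x) / norm h) \<longlongrightarrow> 0) (at 0)"
        by (rule Lim_transform_eventually[rotated])
    qed (rule bounded_linear_scaleR_left)
  qed
qed


text \<open>
  The fundamental theorem of calculus for absolutely continuous functions, as a Henstock gauge
  argument. The exceptional null set is covered by an open set of measure less than \<open>\<eta>\<close>, where \<open>\<eta>\<close>
  comes from absolute continuity. Intervals tagged in the null set lie in the open set and contribute
  little; on the others the increment of \<open>X\<close> is the derivative times the length, up to a small
  multiple of the length.
\<close>

lemma absolutely_continuous_integral:
  fixes X :: "real \<Rightarrow> 'e::euclidean_space"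
  assumes ac: "absolutely_continuous_on_interval 0 T X" and T: "0 \<le> T"
    and N: "negligible N"
    and d: "\<And>t. \<lbrakk>t \<notin> N; 0 < t; t < T\<rbrakk> \<Longrightarrow> (X has_vector_derivative g t) (at t)"
  shows "(g has_integral (X T - X 0)) {0..T}"
proof (cases "T = 0")
  case False
  with T have T: "0 < T" by simp
  define N' where "N' = insert 0 (insert T N)"
  have N': "negligible N'" using N by (simp add: N'_def)
  define g' where "g' = (\<lambda>t. if t \<in> N' then 0 else g t)"
  have "(g' has_integral (X T - X 0)) {0..T}"
    unfolding has_integral_factor_content_real
  proof (intro allI impI)
    fix e0 :: real assume "0 < e0"
    define e where "e = e0 / 2"
    have e: "0 < e" using \<open>0 < e0\<close> by (simp add: e_def)
    obtain \<eta> where \<eta>: "0 < \<eta>" "\<And>P :: (real \<times> real) set.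
        \<lbrakk>finite P; \<forall>(s, t)\<in>P. 0 \<le> s \<and> s \<le> t \<and> t \<le> T;
        disjoint_family_on (\<lambda>(s, t). {s<..<t}) P; (\<Sum>(s, t)\<in>P. t - s) < \<eta>\<rbrakk>
        \<Longrightarrow> (\<Sum>(s, t)\<in>P. dist (X s) (X t)) < e * T"
      using ac[unfolded absolutely_continuous_on_interval_def, rule_format, OF mult_pos_pos[OF e T]]
      by blast
    obtain U where U: "open U" "N' \<subseteq> U" "U - N' \<in> lmeasurable" "emeasure lebesgue (U - N') < ennreal \<eta>"
      using sets_lebesgue_outer_open[OF _ \<eta>(1)] N' negligible_imp_sets by metis
    have Um: "U \<in> lmeasurable"
      using U(3) negligible_imp_measurable[OF N'] U(2) by (metis Un_Diff_cancel Un_absorb1 fmeasurable.Un)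
    have "measure lebesgue U = measure lebesgue (U - N')"
      using N' Um by (simp add: measure_Diff_null_set negligible_iff_null_sets fmeasurableD)
    then have Ueta: "measure lebesgue U < \<eta>"
      using U(3,4) \<eta>(1) by (simp add: emeasure_eq_measure2 ennreal_less_iff)
    have "\<exists>d>0. if x \<in> N' then ball x d \<subseteq> U else x \<in> {0..T} \<longrightarrow>
         (\<forall>y. norm (y-x) < d \<longrightarrow> norm (X y - X x - (y-x) *\<^sub>R g x) \<le> e * norm (y-x))" for x
    proof (cases "x \<in> N'")
      case True
      then show ?thesis using U(1,2) by (auto simp: open_contains_ball)
    next
      case False
      show ?thesis
      proof (cases "x \<in> {0..T}")
        case True
        with False have "(X has_vector_derivative g x) (at x)" by (intro d) (auto simp: N'_def)
        then have "\<exists>d>0. \<forall>y. norm (y-x) < d \<longrightarrow> norm (X y - X x - (y-x) *\<^sub>R g x) \<le> e * norm (y-x)"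
          using e unfolding has_vector_derivative_def has_derivative_at_alt by blast
        with False show ?thesis by auto
      qed (use False in \<open>auto intro: exI[of _ 1]\<close>)
    qed
    then obtain \<rho> where \<rho>: "\<And>x. 0 < \<rho> x" "\<And>x. x \<in> N' \<Longrightarrow> ball x (\<rho> x) \<subseteq> U"
      "\<And>x y. \<lbrakk>x \<notin> N'; x \<in> {0..T}; norm (y-x) < \<rho> x\<rbrakk> \<Longrightarrow> norm (X y - X x - (y-x) *\<^sub>R g x) \<le> e * norm (y-x)"
      by (metis (no_types, lifting))
    show "\<exists>d. gauge d \<and> (\<forall>p. p tagged_division_of {0..T} \<and> d fine p \<longrightarrow>
      norm ((\<Sum>(x, k)\<in>p. Henstock_Kurzweil_Integration.content k *\<^sub>R g' x) - (X T - X 0)) \<le> e0 * Henstock_Kurzweil_Integration.content {0..T})"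
    proof (rule exI, safe)
      show "gauge (\<lambda>x. ball x (\<rho> x))" using \<rho>(1) gauge_ball_dependent by blast
    next
      fix p assume ptag: "p tagged_division_of {0..T}" and finep: "(\<lambda>x. ball x (\<rho> x)) fine p"
      have finp: "finite p" using ptag by blast
      define p1 where "p1 = {(x,K) \<in> p. x \<notin> N'}"
      define p2 where "p2 = {(x,K) \<in> p. x \<in> N'}"
      have p12: "p = p1 \<union> p2" "p1 \<inter> p2 = {}" "finite p1" "finite p2"
        using finp by (auto simp: p1_def p2_def intro: rev_finite_subset)
      have "p \<noteq> {}" using ptag T by (auto simp: tagged_division_of_def)
      have K: "\<exists>u v. K = {u..v} \<and> u \<le> v \<and> x \<in> K \<and> 0 \<le> u \<and> v \<le> T \<and> K \<subseteq> ball x (\<rho> x)" if xK: "(x,K) \<in> p" for x K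
      proof -
        obtain u v where uv: "K = cbox u v" using tagged_division_ofD(4)[OF ptag xK] by blast
        moreover have "x \<in> K" "K \<subseteq> {0..T}" using tagged_division_ofD(2,3)[OF ptag xK] by auto
        moreover have "K \<subseteq> ball x (\<rho> x)" using finep xK by (rule fineD)
        ultimately show ?thesis by (intro exI[of _ u] exI[of _ v]) auto
      qed
      have sumX: "X T - X 0 = (\<Sum>(x,K)\<in>p. X(Sup K) - X(Inf K))"
        using additive_tagged_division_1[where f=X and a=0 and b=T] ptag T by auto
      have sumT: "T = (\<Sum>(x,K)\<in>p. Sup K - Inf K)"
        using additive_tagged_division_1[where f="\<lambda>x. x" and a=0 and b=T] ptag T by auto
      have nn: "0 \<le> Sup K - Inf K" if "(x,K) \<in> p" for x K
        using K[OF that] by auto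
      have "norm (\<Sum>(x, K) \<in> p1. (Henstock_Kurzweil_Integration.content K *\<^sub>R g' x) - (X (Sup K) - X (Inf K)))
          \<le> (\<Sum>n\<in>p1. e * (case n of (x, k) \<Rightarrow> Sup k - Inf k))"
      proof (rule sum_norm_le, safe)
        fix x K assume xK: "(x, K) \<in> p1"
        then have xN: "x \<notin> N'" and xp: "(x,K) \<in> p" by (auto simp: p1_def)
        obtain u v where uv: "K = {u..v}" "u \<le> v" "x \<in> K" "0 \<le> u" "v \<le> T" "K \<subseteq> ball x (\<rho> x)"
          using K[OF xp] by blast
        have "norm ((v - u) *\<^sub>R g x - (X v - X u)) = norm (X u - X x - (u - x) *\<^sub>R g x - (X v - X x - (v - x) *\<^sub>R g x))"
          by (auto simp: algebra_simps)
        also have "\<dots> \<le> norm (X u - X x - (u - x) *\<^sub>R g x) + norm (X v - X x - (v - x) *\<^sub>R g x)"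
          by (rule norm_triangle_ineq4)
        also have "\<dots> \<le> e * norm (u - x) + e * norm (v - x)"
        proof (intro add_mono \<rho>(3))
          have "u \<in> ball x (\<rho> x)" "v \<in> ball x (\<rho> x)" using uv by (meson atLeastAtMost_iff order_refl subsetD)+
          then show "norm (u - x) < \<rho> x" "norm (v - x) < \<rho> x" by (auto simp: dist_real_def)
        qed (use uv xN in auto)
        also have "\<dots> = e * (v - u)" using uv by (auto simp: algebra_simps)
        finally show "norm (Henstock_Kurzweil_Integration.content K *\<^sub>R g' x - (X (Sup K) - X (Inf K))) \<le> e * (Sup K - Inf K)"
          using uv(1,2) xN by (simp add: g'_def)
      qed
      also have "\<dots> \<le> (\<Sum>n\<in>p. e * (case n of (x, k) \<Rightarrow> Sup k - Inf k))"
      proof (rule sum_mono2)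
        show "0 \<le> e * (case n of (x, k) \<Rightarrow> Sup k - Inf k)" if "n \<in> p - p1" for n
          using nn[of "fst n" "snd n"] that e by (simp add: split_def)
      qed (use finp p12 in auto)
      also have "\<dots> = e * T" using sumT by (simp add: sum_distrib_left split_def)
      finally have 1: "norm (\<Sum>(x, K) \<in> p1. (Henstock_Kurzweil_Integration.content K *\<^sub>R g' x) - (X (Sup K) - X (Inf K))) \<le> e * T" .
      \<comment> \<open>The intervals tagged in the null set, as end point pairs for absolute continuity.\<close>
      define P where "P = (\<lambda>(x,K). (Inf K, Sup K)) ` p2"
      have disj: "interior K1 \<inter> interior K2 = {}" if "(x1,K1) \<in> p" "(x2,K2) \<in> p" "(x1,K1) \<noteq> (x2,K2)" for x1 K1 x2 K2
        using ptag that by (metis tagged_division_ofD(5))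
      have injP: "inj_on (\<lambda>(x,K). (Inf K, Sup K)) p2"
      proof (rule inj_onI, clarify)
        fix x K y J assume a: "(x,K) \<in> p2" "(y,J) \<in> p2" "Inf K = Inf J" "Sup K = Sup J"
        then have p: "(x,K) \<in> p" "(y,J) \<in> p" by (auto simp: p2_def)
        obtain u v where uv: "K = {u..v}" "u \<le> v" "x \<in> K" using K[OF p(1)] by blast
        obtain u' v' where uv': "J = {u'..v'}" "u' \<le> v'" "y \<in> J" using K[OF p(2)] by blast
        have KJ: "K = J" using a uv uv' by auto
        show "x = y \<and> K = J"
        proof (rule ccontr)
          assume neq: "\<not> (x = y \<and> K = J)"
          then have "interior K \<inter> interior J = {}" using disj[OF p] KJ by auto
          then have "interior {u..v} = {}" using KJ uv(1) by simp
          then have "{u<..<v} = {}" by simp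
          then show False using uv uv' KJ neq by auto
        qed
      qed
      have small: "(\<Sum>(s, t)\<in>P. t - s) < \<eta>"
      proof -
        have part: "p2 tagged_partial_division_of {0..T}"
          by (rule tagged_partial_division_subset[of p]) (use ptag p12(1) in \<open>auto simp: tagged_division_of_def\<close>)
        have div: "(snd ` p2) division_of \<Union>(snd ` p2)" by (rule partial_division_of_tagged_division[OF part])
        have "(\<Sum>(s, t)\<in>P. t - s) = (\<Sum>(x,K)\<in>p2. Sup K - Inf K)"
          unfolding P_def using injP by (subst sum.reindex) (auto simp: split_def)
        also have "\<dots> = (\<Sum>(x,K)\<in>p2. measure lebesgue K)"
        proof (rule sum.cong, safe)
          fix x K assume "(x,K) \<in> p2"
          then obtain u v where "K = {u..v}" "u \<le> v" using K p12 by blast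
          then show "Sup K - Inf K = measure lebesgue K" by simp
        qed
        also have "\<dots> = (\<Sum>K\<in>snd ` p2. measure lebesgue K)"
        proof -
          have "inj_on snd p2" by (rule inj_onI, rule inj_onD[OF injP]) (auto simp: split_def)
          then show ?thesis by (simp add: sum.reindex split_def)
        qed
        also have "\<dots> = measure lebesgue (\<Union>(snd ` p2))" by (rule content_division[OF div])
        also have "\<dots> \<le> measure lebesgue U"
        proof (rule measure_mono_fmeasurable)
          show "\<Union>(snd ` p2) \<subseteq> U"
          proof clarsimp
            fix x K t assume "(x,K) \<in> p2" "t \<in> K"
            then have "(x,K) \<in> p" "x \<in> N'" by (auto simp: p2_def)
            then have "K \<subseteq> U" using K[of x K] \<rho>(2)[of x] by blast
            then show "t \<in> U" using \<open>t \<in> K\<close> by blast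
          qed
          show "\<Union>(snd ` p2) \<in> sets lebesgue" using lmeasurable_division[OF div] by (rule fmeasurableD)
        qed (fact Um)
        finally show ?thesis using Ueta by simp
      qed
      have "norm (\<Sum>(x, K) \<in> p2. (Henstock_Kurzweil_Integration.content K *\<^sub>R g' x) - (X (Sup K) - X (Inf K)))
          \<le> (\<Sum>n\<in>p2. (case n of (x, K) \<Rightarrow> dist (X (Inf K)) (X (Sup K))))"
        by (rule sum_norm_le) (auto simp: p2_def g'_def dist_norm norm_minus_commute)
      also have "\<dots> = (\<Sum>(s, t)\<in>P. dist (X s) (X t))"
        unfolding P_def using injP by (subst sum.reindex) (auto simp: split_def)
      also have "\<dots> < e * T"
      proof (rule \<eta>(2))
        show "finite P" using p12 by (simp add: P_def)
        show "\<forall>(s, t)\<in>P. 0 \<le> s \<and> s \<le> t \<and> t \<le> T"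
        proof (clarsimp simp: P_def)
          fix x K assume "(x,K) \<in> p2"
          then obtain u v where "K = {u..v}" "u \<le> v" "0 \<le> u" "v \<le> T" using K p12 by blast
          then show "0 \<le> Inf K \<and> Inf K \<le> Sup K \<and> Sup K \<le> T" by simp
        qed
        show "disjoint_family_on (\<lambda>(s, t). {s<..<t}) P"
          unfolding disjoint_family_on_def
        proof (intro ballI impI)
          fix m n assume "m \<in> P" "n \<in> P" "m \<noteq> n"
          then obtain x K y J where a: "(x,K) \<in> p2" "(y,J) \<in> p2" "m = (Inf K, Sup K)" "n = (Inf J, Sup J)" "(x,K) \<noteq> (y,J)"
            unfolding P_def by auto
          then have p: "(x,K) \<in> p" "(y,J) \<in> p" by (auto simp: p2_def)
          obtain u v where uv: "K = {u..v}" "u \<le> v" using K[OF p(1)] by blast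
          obtain u' v' where uv': "J = {u'..v'}" "u' \<le> v'" using K[OF p(2)] by blast
          show "(case m of (s, t) \<Rightarrow> {s<..<t}) \<inter> (case n of (s, t) \<Rightarrow> {s<..<t}) = {}"
            using disj[OF p a(5)] uv uv' a(3,4) by simp
        qed
      qed (fact small)
      finally have 2: "norm (\<Sum>(x, K) \<in> p2. (Henstock_Kurzweil_Integration.content K *\<^sub>R g' x) - (X (Sup K) - X (Inf K))) \<le> e * T" by simp
      have "(\<Sum>(x, k)\<in>p. Henstock_Kurzweil_Integration.content k *\<^sub>R g' x) - (X T - X 0) = (\<Sum>(x, K) \<in> p. (Henstock_Kurzweil_Integration.content K *\<^sub>R g' x) - (X (Sup K) - X (Inf K)))"
        by (simp add: sumX sum_subtractf split_def)
      also have "\<dots> = (\<Sum>(x, K) \<in> p1. (Henstock_Kurzweil_Integration.content K *\<^sub>R g' x) - (X (Sup K) - X (Inf K))) + (\<Sum>(x, K) \<in> p2. (Henstock_Kurzweil_Integration.content K *\<^sub>R g' x) - (X (Sup K) - X (Inf K)))"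
        by (subst p12(1)) (rule sum.union_disjoint[OF p12(3,4,2)])
      finally have "norm ((\<Sum>(x, k)\<in>p. Henstock_Kurzweil_Integration.content k *\<^sub>R g' x) - (X T - X 0)) \<le> e * T + e * T"
        using order_trans[OF norm_triangle_ineq add_mono[OF 1 2]] by simp
      then show "norm ((\<Sum>(x, k)\<in>p. Henstock_Kurzweil_Integration.content k *\<^sub>R g' x) - (X T - X 0)) \<le> e0 * Henstock_Kurzweil_Integration.content {0..T}"
        using T by (simp add: e_def mult.commute)
    qed
  qed
  moreover have "g t = g' t" if "t \<in> {0..T} - N'" for t using that by (simp add: g'_def)
  ultimately show ?thesis using has_integral_spike[OF N'] by blast
qed (simp add: has_integral_refl)

section \<open>Controls\<close>

text \<open>
  A Borel way of rounding points of a compact set to a countable list of its points. The ambient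
  metric space need not be separable, so measurability of a function of two controls cannot be read
  off from the product \<open>\<sigma>\<close>-algebra; it is obtained by rounding. Player 1 also uses the rounding to
  reply measurably to the current control of player 2.
\<close>

lemma finite_borel_net:
  fixes S :: "'c::metric_space set"
  assumes "compact S" "S \<noteq> {}" "0 < e"
  obtains q :: "nat \<Rightarrow> 'c" and idx :: "'c \<Rightarrow> nat"
  where "\<And>n. q n \<in> S" "idx \<in> measurable borel (count_space UNIV)" "\<And>s. s \<in> S \<Longrightarrow> dist s (q (idx s)) < e"
proof -
  obtain K where K: "finite K" "K \<subseteq> S" "S \<subseteq> (\<Union>x\<in>K. ball x e)"
    by (rule compactE_image[OF assms(1), of S "\<lambda>x. ball x e"]) (use assms(3) in auto)
  then have "K \<noteq> {}" using assms(2) by auto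
  then have "range (from_nat_into K) = K"
    using K(1) by (intro range_from_nat_into countable_finite)
  then obtain q :: "nat \<Rightarrow> 'c" where q: "range q = K" by blast
  define idx where "idx = (\<lambda>s. LEAST i. dist s (q i) < e)"
  show thesis
  proof
    show "q n \<in> S" for n using q K(2) by auto
    show "idx \<in> measurable borel (count_space UNIV)"
      unfolding idx_def
    proof (rule measurable_Least)
      fix i
      have "open {s. dist s (q i) < e}"
        by (intro open_Collect_less continuous_intros)
      then show "Measurable.pred borel (\<lambda>s. dist s (q i) < e)"
        by (simp add: pred_def)
    qed
    show "dist s (q (idx s)) < e" if sS: "s \<in> S" for s
    proof -
      obtain x where "x \<in> K" "dist s x < e" using K(3) sS by (auto simp: dist_commute)
      then have "\<exists>i. dist s (q i) < e" using q by auto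
      then show ?thesis unfolding idx_def by (rule LeastI_ex)
    qed
  qed
qed

lemma controls_space: "c \<in> controls S \<Longrightarrow> 0 \<le> t \<Longrightarrow> c t \<in> S"
  by (auto simp: controls_def)

lemma controls_undefined: "c \<in> controls S \<Longrightarrow> t < 0 \<Longrightarrow> c t = undefined"
  by (rule PiE_arb[of c "{0..}" "\<lambda>_. S"]) (auto simp: controls_def)

lemma constant_control: "s \<in> S \<Longrightarrow> restrict (\<lambda>t. s) {0..} \<in> controls S"
  unfolding controls_def by (auto intro!: measurable_cong[THEN iffD1, OF _ measurable_const[of s borel "lebesgue_on {0..}"]])

definition shift_control :: "real \<Rightarrow> (real \<Rightarrow> 'c) \<Rightarrow> (real \<Rightarrow> 'c)" where
  "shift_control h c = restrict (\<lambda>t. c (h + t)) {0..}"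

definition join_control :: "real \<Rightarrow> (real \<Rightarrow> 'c) \<Rightarrow> (real \<Rightarrow> 'c) \<Rightarrow> (real \<Rightarrow> 'c)" where
  "join_control h c d = (\<lambda>t. if t < h then c t else d (t - h))"

lemma shift_control_apply [simp]: "0 \<le> t \<Longrightarrow> shift_control h c t = c (h + t)"
  by (simp add: shift_control_def)

lemma lebesgue_measurable_translate: "(\<lambda>t::real. h + t) \<in> measurable lebesgue lebesgue"
  using lebesgue_affine_measurable[where c="\<lambda>_::real. 1" and t=h] by simp

lemma shift_control_in [intro]:
  assumes c: "c \<in> controls S" and h: "0 \<le> h"
  shows "shift_control h c \<in> controls S"
proof -
  have "(\<lambda>t. h + t) \<in> measurable (lebesgue_on {0..}) (lebesgue_on {0..})"
    by (rule measurable_restrict_space3[OF lebesgue_measurable_translate]) (use h in auto)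
  then have "(\<lambda>t. c (h + t)) \<in> measurable (lebesgue_on {0..}) borel"
    using c by (auto simp: controls_def intro: measurable_compose)
  then have "shift_control h c \<in> measurable (lebesgue_on {0..}) borel"
    by (subst measurable_cong[of _ _ "\<lambda>t. c (h + t)"]) (auto simp: shift_control_def)
  moreover have "shift_control h c \<in> {0..} \<rightarrow>\<^sub>E S"
    using c h controls_space[OF c] by (auto simp: shift_control_def)
  ultimately show ?thesis by (simp add: controls_def)
qed

lemma join_control_in [intro]:
  assumes c: "c \<in> controls S" and d: "d \<in> controls S" and h: "0 \<le> h"
  shows "join_control h c d \<in> controls S"
proof -
  have "join_control h c d \<in> measurable (lebesgue_on {0..}) borel"
    unfolding join_control_def
  proof (subst measurable_If_restrict_space_iff, goal_cases)
    case 1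
    have "{x \<in> space (lebesgue_on {0..}). x < h} = {0..<h}" by auto
    moreover have "{0..<h} \<in> sets (lebesgue_on {0..})" by (subst sets_restrict_space_iff) auto
    ultimately show ?case by simp
  next
    case 2
    have 1: "c \<in> restrict_space (lebesgue_on {0..}) {x. x < h} \<rightarrow>\<^sub>M borel"
      using c by (auto simp: controls_def intro: measurable_restrict_space1)
    have "(\<lambda>t. -h + t) \<in> measurable (restrict_space (lebesgue_on {0..}) {x. \<not> x < h}) (lebesgue_on {0..})"
      by (rule measurable_restrict_space2[OF _ measurable_restrict_space1[OF measurable_restrict_space1[OF lebesgue_measurable_translate]]])
        (auto simp: space_restrict_space)
    from measurable_compose[OF this, of d borel]
    have "(\<lambda>x. d (x - h)) \<in> restrict_space (lebesgue_on {0..}) {x. \<not> x < h} \<rightarrow>\<^sub>M borel"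
      using d by (simp add: controls_def)
    with 1 show ?case by blast
  qed
  moreover have "join_control h c d \<in> {0..} \<rightarrow>\<^sub>E S"
  proof (rule PiE_I)
    show "join_control h c d t \<in> S" if "t \<in> {0..}" for t
      using that controls_space[OF c] controls_space[OF d] by (simp add: join_control_def)
    show "join_control h c d t = undefined" if "t \<notin> {0..}" for t
      using that controls_undefined[OF c] h by (simp add: join_control_def)
  qed
  ultimately show ?thesis by (simp add: controls_def)
qed

lemma shift_join_control:
  assumes "d \<in> controls S" "0 \<le> h"
  shows "shift_control h (join_control h c d) = d"
proof
  fix t show "shift_control h (join_control h c d) t = d t"
    using assms controls_undefined[OF assms(1)]
    by (cases "0 \<le> t") (auto simp: shift_control_def join_control_def)
qed

lemma agree_upto_iff:
  "agree_upto t c d \<longleftrightarrow> (\<exists>N. negligible N \<and> (\<forall>s. 0 \<le> s \<longrightarrow> s \<le> t \<longrightarrow> s \<notin> N \<longrightarrow> c s = d s))"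
  unfolding agree_upto_def eventually_ae_filter_negligible by blast

lemma agree_upto_refl [simp]: "agree_upto t c c"
  by (simp add: agree_upto_def)

lemma agree_upto_sym: "agree_upto t c d \<Longrightarrow> agree_upto t d c"
  unfolding agree_upto_def by (auto elim: eventually_mono)

lemma agree_upto_trans:
  assumes "agree_upto t c d" "agree_upto t d e" shows "agree_upto t c e"
  using assms unfolding agree_upto_def by eventually_elim auto

lemma agree_upto_mono: "agree_upto t c d \<Longrightarrow> s \<le> t \<Longrightarrow> agree_upto s c d"
  unfolding agree_upto_def by (auto elim: eventually_mono)

text \<open>
  Closed time intervals make the joined control differ from the first one at time \<open>h\<close> itself,
  which is a null set.
\<close>

lemma agree_upto_join1: "agree_upto h (join_control h c d) c"
  unfolding agree_upto_iff by (intro exI[of _ "{h}"]) (auto simp: join_control_def)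

lemma agree_upto_shift:
  assumes "agree_upto (h + t) c d" "0 \<le> h"
  shows "agree_upto t (shift_control h c) (shift_control h d)"
proof -
  obtain N where N: "negligible N" "\<And>s. \<lbrakk>0 \<le> s; s \<le> h + t; s \<notin> N\<rbrakk> \<Longrightarrow> c s = d s"
    using assms(1) unfolding agree_upto_iff by blast
  have "negligible ((+) (-h) ` N)" using N(1) by (rule negligible_translation)
  moreover have "shift_control h c s = shift_control h d s"
    if "0 \<le> s" "s \<le> t" "s \<notin> (+) (-h) ` N" for s
  proof -
    have "h + s \<notin> N"
    proof
      assume "h + s \<in> N"
      then have "-h + (h + s) \<in> (+) (-h) ` N" by blast
      with that(3) show False by simp
    qed
    then show ?thesis using N(2)[of "h + s"] that assms(2) by simp
  qed
  ultimately show ?thesis unfolding agree_upto_iff by blast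
qed

lemma agree_upto_join:
  assumes c: "agree_upto h c c'" and d: "agree_upto t d d'" and h: "0 \<le> h"
  shows "agree_upto (h + t) (join_control h c d) (join_control h c' d')"
proof -
  obtain N where N: "negligible N" "\<And>s. \<lbrakk>0 \<le> s; s \<le> h; s \<notin> N\<rbrakk> \<Longrightarrow> c s = c' s"
    using c unfolding agree_upto_iff by blast
  obtain N' where N': "negligible N'" "\<And>s. \<lbrakk>0 \<le> s; s \<le> t; s \<notin> N'\<rbrakk> \<Longrightarrow> d s = d' s"
    using d unfolding agree_upto_iff by blast
  have "negligible (N \<union> (+) h ` N')" by (intro negligible_Un N N' negligible_translation)
  moreover have "join_control h c d s = join_control h c' d' s"
    if "0 \<le> s" "s \<le> h + t" "s \<notin> N \<union> (+) h ` N'" for s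
  proof (cases "s < h")
    case False
    have "s - h \<notin> N'"
    proof
      assume "s - h \<in> N'"
      then have "h + (s - h) \<in> (+) h ` N'" by blast
      with that(3) show False by simp
    qed
    then show ?thesis using N'(2)[of "s - h"] that False by (simp add: join_control_def)
  qed (use that N in \<open>auto simp: join_control_def\<close>)
  ultimately show ?thesis unfolding agree_upto_iff by blast
qed

lemma agree_upto_join_early:
  assumes "agree_upto t c c'" "t \<le> h"
  shows "agree_upto t (join_control h c d) (join_control h c' d')"
  using agree_upto_mono[OF agree_upto_join1 assms(2)] assms(1) agree_upto_trans agree_upto_sym by metis

section \<open>Trajectories\<close>

lemma indefinite_integral_lipschitz:
  fixes g :: "real \<Rightarrow> 'e::euclidean_space"
  assumes int: "\<And>s t. 0 \<le> s \<Longrightarrow> g integrable_on {s..t}" and bd: "\<And>s. 0 \<le> s \<Longrightarrow> norm (g s) \<le> C"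
    and st: "0 \<le> s" "s \<le> t"
  shows "norm (integral {0..t} g - integral {0..s} g) \<le> C * (t - s)"
proof -
  have "integral {0..s} g + integral {s..t} g = integral {0..t} g"
    by (rule Henstock_Kurzweil_Integration.integral_combine) (use st int in auto)
  then have "integral {0..t} g - integral {0..s} g = integral {s..t} g" by (simp add: algebra_simps)
  moreover have "norm (integral {s..t} g) \<le> C * (t - s)"
    by (rule integral_norm_le_const) (use st int bd in auto)
  ultimately show ?thesis by simp
qed

lemma indefinite_integral_continuous_halfline:
  fixes g :: "real \<Rightarrow> 'e::euclidean_space"
  assumes int: "\<And>s t. 0 \<le> s \<Longrightarrow> g integrable_on {s..t}" and bd: "\<And>s. 0 \<le> s \<Longrightarrow> norm (g s) \<le> C"
  shows "continuous_on {0..} (\<lambda>t. integral {0..t} g)"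
proof (rule lipschitz_on_continuous_on)
  have "0 \<le> C" using bd[of 0] norm_ge_zero order_trans by blast
  then show "C-lipschitz_on {0..} (\<lambda>t. integral {0..t} g)"
  proof (intro lipschitz_onI)
    fix s t :: real assume "s \<in> {0..}" "t \<in> {0..}"
    then show "dist (integral {0..s} g) (integral {0..t} g) \<le> C * dist s t"
      using indefinite_integral_lipschitz[of g C, OF int bd, of s t] indefinite_integral_lipschitz[of g C, OF int bd, of t s]
      by (cases "s \<le> t") (auto simp: dist_norm norm_minus_commute)
  qed
qed

locale game_dynamics =
  fixes A :: "'a::metric_space set" and B :: "'b::metric_space set"
    and f :: "real^'n \<Rightarrow> 'a \<Rightarrow> 'b \<Rightarrow> real^'n" and L M :: real
  assumes compact_A: "compact A" and nonempty_A: "A \<noteq> {}"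
    and compact_B: "compact B" and nonempty_B: "B \<noteq> {}"
    and continuous_f: "continuous_on (UNIV \<times> A \<times> B) (\<lambda>(x, a, b). f x a b)"
    and L_nonneg: "0 \<le> L"
    and lipschitz_f: "\<And>x y a b. a \<in> A \<Longrightarrow> b \<in> B \<Longrightarrow> norm (f x a b - f y a b) \<le> L * norm (x - y)"
    and bounded_f: "\<And>x a b. a \<in> A \<Longrightarrow> b \<in> B \<Longrightarrow> norm (f x a b) \<le> M"
    and periodic_f: "\<And>x k a b. a \<in> A \<Longrightarrow> b \<in> B \<Longrightarrow> k \<in> int_lattice \<Longrightarrow> f (x + k) a b = f x a b"
begin

lemma M_nonneg: "0 \<le> M"
  using bounded_f nonempty_A nonempty_B norm_ge_zero order_trans by (metis ex_in_conv)

text \<open>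
  When both controls are replaced by their roundings, the function takes the form
  \<open>G (X s) (q i) (r j)\<close> with measurable indices \<open>i\<close>, \<open>j\<close>; by continuity of \<open>G\<close> it converges
  pointwise as the rounding gets finer.
\<close>

lemma measurable_along:
  fixes G :: "real^'n \<Rightarrow> 'a \<Rightarrow> 'b \<Rightarrow> 'e::euclidean_space"
  assumes G: "continuous_on (UNIV \<times> A \<times> B) (\<lambda>(x, a, b). G x a b)"
    and X: "continuous_on {0..} X" and c: "c \<in> controls A" and d: "d \<in> controls B"
  shows "(\<lambda>s. G (X s) (c s) (d s)) \<in> borel_measurable (lebesgue_on {0..})"
proof -
  have "\<exists>q idx. (\<forall>i. q i \<in> A) \<and> idx \<in> measurable borel (count_space UNIV) \<and>
          (\<forall>s\<in>A. dist s (q (idx s :: nat)) < 1 / real (Suc n))" for n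
    by (rule finite_borel_net[OF compact_A nonempty_A, of "1 / real (Suc n)"]) (simp, blast)
  then obtain q idx where q: "\<And>n i. q n i \<in> A"
    "\<And>n. idx n \<in> measurable borel (count_space UNIV)"
    "\<And>n s. s \<in> A \<Longrightarrow> dist s (q n (idx n s :: nat)) < 1 / real (Suc n)"
    by metis
  have "\<exists>q idx. (\<forall>i. q i \<in> B) \<and> idx \<in> measurable borel (count_space UNIV) \<and>
          (\<forall>s\<in>B. dist s (q (idx s :: nat)) < 1 / real (Suc n))" for n
    by (rule finite_borel_net[OF compact_B nonempty_B, of "1 / real (Suc n)"]) (simp, blast)
  then obtain r jdx where r: "\<And>n i. r n i \<in> B"
    "\<And>n. jdx n \<in> measurable borel (count_space UNIV)"
    "\<And>n s. s \<in> B \<Longrightarrow> dist s (r n (jdx n s :: nat)) < 1 / real (Suc n)"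
    by metis
  have c': "c \<in> measurable (lebesgue_on {0..}) borel" and d': "d \<in> measurable (lebesgue_on {0..}) borel"
    using c d by (auto simp: controls_def)
  show ?thesis
  proof (rule borel_measurable_LIMSEQ_metric)
    fix n
    have 1: "(\<lambda>s. G (X s) (q n i) (r n j)) \<in> borel_measurable (lebesgue_on {0..})" for i j
    proof (rule continuous_imp_measurable_on_sets_lebesgue)
      have "continuous_on {0..} (\<lambda>s. (\<lambda>(x, a, b). G x a b) (X s, q n i, r n j))"
        by (rule continuous_on_compose2[OF G]) (use X q(1) r(1) in \<open>auto intro!: continuous_intros\<close>)
      then show "continuous_on {0..} (\<lambda>s. G (X s) (q n i) (r n j))" by simp
    qed simp
    have 2: "(\<lambda>s. G (X s) (q n i) (r n (jdx n (d s)))) \<in> borel_measurable (lebesgue_on {0..})" for i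
      by (rule measurable_compose_countable[where f="\<lambda>j s. G (X s) (q n i) (r n j)", OF 1 measurable_compose[OF d' r(2)]])
    show "(\<lambda>s. G (X s) (q n (idx n (c s))) (r n (jdx n (d s)))) \<in> borel_measurable (lebesgue_on {0..})"
      by (rule measurable_compose_countable[where f="\<lambda>i s. G (X s) (q n i) (r n (jdx n (d s)))", OF 2 measurable_compose[OF c' q(2)]])
  next
    fix s assume "s \<in> space (lebesgue_on {0::real..})"
    then have s: "c s \<in> A" "d s \<in> B" using controls_space[OF c] controls_space[OF d] by auto
    have lim: "(\<lambda>n. 1 / real (Suc n)) \<longlonglongrightarrow> 0"
      using LIMSEQ_inverse_real_of_nat by (simp add: inverse_eq_divide)
    have "(\<lambda>n. dist (q n (idx n (c s))) (c s)) \<longlonglongrightarrow> 0"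
      by (rule tendsto_sandwich[OF _ _ tendsto_const lim]) (auto simp: dist_commute less_imp_le[OF q(3)[OF s(1)]] intro!: always_eventually simp del: of_nat_Suc)
    then have 1: "(\<lambda>n. q n (idx n (c s))) \<longlonglongrightarrow> c s" by (rule tendsto_dist_iff[THEN iffD2])
    have "(\<lambda>n. dist (r n (jdx n (d s))) (d s)) \<longlonglongrightarrow> 0"
      by (rule tendsto_sandwich[OF _ _ tendsto_const lim]) (auto simp: dist_commute less_imp_le[OF r(3)[OF s(2)]] intro!: always_eventually simp del: of_nat_Suc)
    then have 2: "(\<lambda>n. r n (jdx n (d s))) \<longlonglongrightarrow> d s" by (rule tendsto_dist_iff[THEN iffD2])
    have "(\<lambda>n. (\<lambda>(x, a, b). G x a b) (X s, q n (idx n (c s)), r n (jdx n (d s)))) \<longlonglongrightarrow> (\<lambda>(x, a, b). G x a b) (X s, c s, d s)"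
      by (rule continuous_on_tendsto_compose[OF G]) (use 1 2 s q(1) r(1) in \<open>auto intro!: tendsto_intros\<close>)
    then show "(\<lambda>n. G (X s) (q n (idx n (c s))) (r n (jdx n (d s)))) \<longlonglongrightarrow> G (X s) (c s) (d s)"
      by simp
  qed
qed

lemma velocity_measurable:
  assumes "continuous_on {0..} X" "a \<in> controls A" "b \<in> controls B"
  shows "(\<lambda>s. f (X s) (a s) (b s)) \<in> borel_measurable (lebesgue_on {0..})"
  by (rule measurable_along[OF continuous_f assms])

lemma velocity_bound:
  assumes "a \<in> controls A" "b \<in> controls B" "0 \<le> s"
  shows "norm (f y (a s) (b s)) \<le> M"
  using assms by (intro bounded_f controls_space)

lemma velocity_integrable:
  assumes "continuous_on {0..} X" "a \<in> controls A" "b \<in> controls B" "0 \<le> s"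
  shows "(\<lambda>s. f (X s) (a s) (b s)) integrable_on {s..t}"
  by (rule bounded_measurable_integrable_on[OF velocity_measurable]) (use assms velocity_bound in auto)

definition solves :: "real^'n \<Rightarrow> (real \<Rightarrow> 'a) \<Rightarrow> (real \<Rightarrow> 'b) \<Rightarrow> (real \<Rightarrow> real^'n) \<Rightarrow> bool" where
  "solves x a b X \<longleftrightarrow> continuous_on {0..} X \<and>
     (\<forall>t\<ge>0. X t = x + integral {0..t} (\<lambda>s. f (X s) (a s) (b s)))"

lemma solves_lipschitz:
  assumes X: "solves x a b X" and Y: "solves y a' b' Y"
    and c: "a \<in> controls A" "b \<in> controls B" "a' \<in> controls A" "b' \<in> controls B"
    and agree: "agree_upto T a a'" "agree_upto T b b'" and t: "t \<in> {0..T}"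
  shows "norm (X t - Y t) \<le> norm (x - y) * exp (L * t)"
proof -
  have cX: "continuous_on {0..} X" and cY: "continuous_on {0..} Y"
    using X Y by (auto simp: solves_def)
  obtain N where N: "negligible N" "\<And>s. \<lbrakk>0 \<le> s; s \<le> T; s \<notin> N\<rbrakk> \<Longrightarrow> a s = a' s"
    using agree(1) unfolding agree_upto_iff by blast
  obtain N' where N': "negligible N'" "\<And>s. \<lbrakk>0 \<le> s; s \<le> T; s \<notin> N'\<rbrakk> \<Longrightarrow> b s = b' s"
    using agree(2) unfolding agree_upto_iff by blast
  have "norm (X r - Y r) \<le> norm (x - y) + L * integral {0..r} (\<lambda>s. norm (X s - Y s))" if r: "r \<in> {0..T}" for r
  proof -
    have cont: "continuous_on {0..r} (\<lambda>s. norm (X s - Y s))"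
      by (intro continuous_intros continuous_on_subset[OF cX] continuous_on_subset[OF cY]) auto
    have "integral {0..r} (\<lambda>s. f (Y s) (a' s) (b' s)) = integral {0..r} (\<lambda>s. f (Y s) (a s) (b s))"
      by (rule integral_spike[OF negligible_Un[OF N(1) N'(1)]]) (use N(2) N'(2) r in auto)
    then have "X r - Y r = (x - y) + integral {0..r} (\<lambda>s. f (X s) (a s) (b s) - f (Y s) (a s) (b s))"
      using X Y r velocity_integrable[OF cX c(1,2)] velocity_integrable[OF cY c(1,2)]
      by (simp add: solves_def Henstock_Kurzweil_Integration.integral_diff)
    moreover have "norm (integral {0..r} (\<lambda>s. f (X s) (a s) (b s) - f (Y s) (a s) (b s)))
        \<le> integral {0..r} (\<lambda>s. L * norm (X s - Y s))"
    proof (rule integral_norm_bound_integral)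
      show "(\<lambda>s. f (X s) (a s) (b s) - f (Y s) (a s) (b s)) integrable_on {0..r}"
        using velocity_integrable[OF cX c(1,2)] velocity_integrable[OF cY c(1,2)] by (intro integrable_diff) auto
      show "(\<lambda>s. L * norm (X s - Y s)) integrable_on {0..r}"
        by (intro integrable_continuous_interval continuous_on_mult_left cont)
      show "norm (f (X s) (a s) (b s) - f (Y s) (a s) (b s)) \<le> L * norm (X s - Y s)" if "s \<in> {0..r}" for s
        using that controls_space[OF c(1)] controls_space[OF c(2)] by (intro lipschitz_f) auto
    qed
    ultimately show ?thesis
      using norm_triangle_ineq[of "x - y" "integral {0..r} (\<lambda>s. f (X s) (a s) (b s) - f (Y s) (a s) (b s))"] by simp
  qed
  then show ?thesis
    by (rule gronwall[where T=T, rotated 2])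
      (use t L_nonneg in \<open>auto intro!: continuous_intros continuous_on_subset[OF cX] continuous_on_subset[OF cY]\<close>)
qed

text \<open>
  Picard's fixed point argument on the whole half-line at once. Writing the unknown as
  \<open>x + exp (K t) Z t\<close> with \<open>K = L + 1\<close>, the integral operator acts on bounded continuous \<open>Z\<close> and
  is a contraction with factor \<open>L / K\<close>.
\<close>

lemma solves_exists:
  assumes a: "a \<in> controls A" and b: "b \<in> controls B"
  obtains X where "X \<in> extensional {0..}" "solves x a b X"
proof -
  define K where "K = L + 1"
  have K: "1 \<le> K" "L < K" "0 < K" using L_nonneg by (auto simp: K_def)
  define Y where "Y = (\<lambda>(Z :: real \<Rightarrow>\<^sub>C (real^'n)) s. x + exp (K * s) *\<^sub>R Z s)"
  define I where "I = (\<lambda>Z t. integral {0..t} (\<lambda>s. f (Y Z s) (a s) (b s)))"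
  \<comment> \<open>Bounded continuous functions live on the whole line, hence constant continuation to negative times.\<close>
  define P where "P = (\<lambda>Z t. exp (- K * max 0 t) *\<^sub>R I Z (max 0 t))"
  have cY: "continuous_on S (Y Z)" for Z S
    unfolding Y_def by (intro continuous_intros continuous_on_apply_bcontfun)
  have int: "(\<lambda>s. f (Y Z s) (a s) (b s)) integrable_on {s..t}" if "0 \<le> s" for Z s t
    using velocity_integrable[OF cY a b that] .
  have contP: "continuous_on UNIV (P Z)" for Z
  proof -
    have "continuous_on {0..} (I Z)"
      unfolding I_def by (rule indefinite_integral_continuous_halfline[OF int velocity_bound[OF a b]])
    then have "continuous_on UNIV (\<lambda>t. I Z (max 0 t))"
      by (rule continuous_on_compose2) (auto intro!: continuous_intros)
    then show ?thesis unfolding P_def by (intro continuous_intros)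
  qed
  have boundP: "norm (P Z t) \<le> M" for Z t
  proof -
    define r where "r = max 0 t"
    have r: "0 \<le> r" by (simp add: r_def)
    have "norm (I Z r) \<le> M * r"
      unfolding I_def using integral_norm_le_const[OF int[of 0 Z r] r, of M] velocity_bound[OF a b] r by auto
    also have "\<dots> \<le> M * exp (K * r)"
    proof (intro mult_left_mono M_nonneg)
      show "r \<le> exp (K * r)"
        using exp_ge_add_one_self[of "K * r"] mult_right_mono[OF K(1) r] by linarith
    qed
    finally have "exp (- K * r) * norm (I Z r) \<le> exp (- K * r) * (M * exp (K * r))"
      by (intro mult_left_mono) auto
    also have "\<dots> = M" by (simp add: exp_minus)
    finally show ?thesis by (simp add: P_def r_def)
  qed
  define \<Phi> where "\<Phi> = (\<lambda>Z. Bcontfun (P Z))"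
  have Phi: "apply_bcontfun (\<Phi> Z) = P Z" for Z
    unfolding \<Phi>_def by (rule Bcontfun_inverse, rule bcontfun_normI[OF contP boundP])
  have "\<exists>!Z. \<Phi> Z = Z"
  proof (rule banach_fix_type[where c="L / K"])
    show "0 \<le> L / K" "L / K < 1" using K L_nonneg by auto
    show "\<forall>Z W. dist (\<Phi> Z) (\<Phi> W) \<le> L / K * dist Z W"
    proof (intro allI dist_bound)
      fix Z W :: "real \<Rightarrow>\<^sub>C (real^'n)" and t :: real
      define r where "r = max 0 t"
      have r: "0 \<le> r" by (simp add: r_def)
      define D where "D = dist Z W"
      have D: "0 \<le> D" by (simp add: D_def)
      have ie: "((\<lambda>s. L * D * exp (K * s)) has_integral (L * D * exp (K * r) / K - L * D * exp (K * 0) / K)) {0..r}"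
        by (rule fundamental_theorem_of_calculus[OF r])
          (use K in \<open>auto intro!: derivative_eq_intros simp flip: has_real_derivative_iff_has_vector_derivative\<close>)
      have "norm (I Z r - I W r) = norm (integral {0..r} (\<lambda>s. f (Y Z s) (a s) (b s) - f (Y W s) (a s) (b s)))"
        unfolding I_def using int by (simp add: Henstock_Kurzweil_Integration.integral_diff)
      also have "\<dots> \<le> integral {0..r} (\<lambda>s. L * D * exp (K * s))"
      proof (rule integral_norm_bound_integral)
        show "(\<lambda>s. f (Y Z s) (a s) (b s) - f (Y W s) (a s) (b s)) integrable_on {0..r}"
          using int by (intro integrable_diff) auto
        show "(\<lambda>s. L * D * exp (K * s)) integrable_on {0..r}" using ie by blast
        fix s assume s: "s \<in> {0..r}"
        have "norm (f (Y Z s) (a s) (b s) - f (Y W s) (a s) (b s)) \<le> L * norm (Y Z s - Y W s)"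
          using s controls_space[OF a] controls_space[OF b] by (intro lipschitz_f) auto
        also have "Y Z s - Y W s = exp (K * s) *\<^sub>R (Z s - W s)"
          by (simp add: Y_def scaleR_diff_right)
        also have "norm \<dots> = exp (K * s) * dist (Z s) (W s)" by (simp add: dist_norm)
        also have "L * \<dots> \<le> L * (exp (K * s) * D)"
          unfolding D_def using L_nonneg by (intro mult_left_mono dist_bounded) auto
        finally show "norm (f (Y Z s) (a s) (b s) - f (Y W s) (a s) (b s)) \<le> L * D * exp (K * s)" by (simp add: ac_simps)
      qed
      also have "\<dots> \<le> L * D * exp (K * r) / K"
        using integral_unique[OF ie] L_nonneg D K by simp
      finally have "exp (- K * r) * norm (I Z r - I W r) \<le> exp (- K * r) * (L * D * exp (K * r) / K)"
        by (intro mult_left_mono) auto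
      also have "\<dots> = L / K * D" by (simp add: exp_minus)
      finally have "norm (exp (- K * r) *\<^sub>R (I Z r - I W r)) \<le> L / K * D" by simp
      then show "dist (\<Phi> Z t) (\<Phi> W t) \<le> L / K * dist Z W"
        by (simp add: Phi P_def r_def D_def dist_norm scaleR_diff_right)
    qed
  qed
  then obtain Z where Z: "\<Phi> Z = Z" by blast
  have YI: "Y Z t = x + I Z t" if "0 \<le> t" for t
  proof -
    have "Z t = exp (- K * t) *\<^sub>R I Z t"
      using Phi[of Z] Z that by (simp add: P_def max_absorb2)
    then show ?thesis by (simp add: Y_def exp_minus)
  qed
  show thesis
  proof
    show "restrict (Y Z) {0..} \<in> extensional {0..}" by simp
    have "continuous_on {0..} (restrict (Y Z) {0..})"
      using cY[of "{0..}" Z] by (rule continuous_on_eq) simp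
    moreover have "integral {0..t} (\<lambda>s. f (restrict (Y Z) {0..} s) (a s) (b s)) = I Z t" for t
      unfolding I_def by (rule integral_cong) simp
    ultimately show "solves x a b (restrict (Y Z) {0..})"
      using YI by (simp add: solves_def)
  qed
qed

text \<open>
  One direction is the fundamental theorem of calculus for absolutely continuous functions; in
  the other, a solution of the integral equation is Lipschitz and Lebesgue's differentiation theorem
  yields the derivative.
\<close>

lemma solves_trajectory_equiv:
  assumes a: "a \<in> controls A" and b: "b \<in> controls B"
  shows "is_trajectory f x a b X \<longleftrightarrow> X \<in> extensional {0..} \<and> solves x a b X"
proof
  assume X: "is_trajectory f x a b X"
  then have ac: "\<And>T. 0 \<le> T \<Longrightarrow> absolutely_continuous_on_interval 0 T X"
    and ae: "AE t in lebesgue. 0 < t \<longrightarrow> (X has_vector_derivative f (X t) (a t) (b t)) (at t)"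
    and X0: "X 0 = x" and ext: "X \<in> extensional {0..}"
    by (auto simp: is_trajectory_def)
  obtain N where N: "negligible N"
    "\<And>t. \<lbrakk>t \<notin> N; 0 < t\<rbrakk> \<Longrightarrow> (X has_vector_derivative f (X t) (a t) (b t)) (at t)"
    using ae unfolding eventually_ae_filter_negligible by blast
  have cont: "continuous_on {0..} X"
    unfolding continuous_on_iff
  proof (intro ballI allI impI)
    fix t e :: real assume t: "t \<in> {0..}" and e: "0 < e"
    obtain \<eta> where \<eta>: "0 < \<eta>" "\<And>P :: (real \<times> real) set.
        \<lbrakk>finite P; \<forall>(s, r)\<in>P. 0 \<le> s \<and> s \<le> r \<and> r \<le> t + 1;
        disjoint_family_on (\<lambda>(s, t). {s<..<t}) P; (\<Sum>(s, t)\<in>P. t - s) < \<eta>\<rbrakk>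
        \<Longrightarrow> (\<Sum>(s, t)\<in>P. dist (X s) (X t)) < e"
      using ac[of "t + 1", unfolded absolutely_continuous_on_interval_def, rule_format, OF _ e] t
      by auto
    have "dist (X s) (X t) < e" if s: "s \<in> {0..}" "dist s t < min \<eta> 1" for s
    proof (cases "s \<le> t")
      case True
      then show ?thesis
        using \<eta>(2)[of "{(s, t)}"] s t by (auto simp: dist_real_def disjoint_family_on_def)
    next
      case False
      then show ?thesis
        using \<eta>(2)[of "{(t, s)}"] s t by (auto simp: dist_real_def disjoint_family_on_def dist_commute)
    qed
    then show "\<exists>d>0. \<forall>x'\<in>{0..}. dist x' t < d \<longrightarrow> dist (X x') (X t) < e"
      using \<eta>(1) by (intro exI[of _ "min \<eta> 1"]) auto
  qed
  have "X t = x + integral {0..t} (\<lambda>s. f (X s) (a s) (b s))" if "0 \<le> t" for t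
    using integral_unique[OF absolutely_continuous_integral[OF ac[OF that] that N(1) N(2)]] X0 by simp
  then show "X \<in> extensional {0..} \<and> solves x a b X"
    using ext cont by (simp add: solves_def)
next
  assume "X \<in> extensional {0..} \<and> solves x a b X"
  then have ext: "X \<in> extensional {0..}" and cont: "continuous_on {0..} X"
    and eq: "\<And>t. 0 \<le> t \<Longrightarrow> X t = x + integral {0..t} (\<lambda>s. f (X s) (a s) (b s))"
    by (auto simp: solves_def)
  have lip: "dist (X s) (X t) \<le> M * (t - s)" if st: "0 \<le> s" "s \<le> t" for s t
    using indefinite_integral_lipschitz[OF velocity_integrable[OF cont a b] velocity_bound[OF a b] st] eq st
    by (simp add: dist_norm norm_minus_commute)
  have "absolutely_continuous_on_interval 0 T X" for T
    unfolding absolutely_continuous_on_interval_def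
  proof (intro allI impI)
    fix e :: real assume e: "0 < e"
    show "\<exists>\<eta>>0. \<forall>P. finite P \<and> (\<forall>(s, t)\<in>P. 0 \<le> s \<and> s \<le> t \<and> t \<le> T) \<and>
        disjoint_family_on (\<lambda>(s, t). {s<..<t}) P \<and> (\<Sum>(s, t)\<in>P. t - s) < \<eta> \<longrightarrow>
        (\<Sum>(s, t)\<in>P. dist (X s) (X t)) < e"
    proof (intro exI[of _ "e / (M + 1)"] conjI allI impI)
      show "0 < e / (M + 1)" using e M_nonneg by simp
      fix P assume P: "finite P \<and> (\<forall>(s, t)\<in>P. 0 \<le> s \<and> s \<le> t \<and> t \<le> T) \<and>
        disjoint_family_on (\<lambda>(s, t). {s<..<t}) P \<and> (\<Sum>(s, t)\<in>P. t - s) < e / (M + 1)"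
      have "(\<Sum>(s, t)\<in>P. dist (X s) (X t)) \<le> (\<Sum>p\<in>P. M * (case p of (s, t) \<Rightarrow> t - s))"
        by (rule sum_mono) (use P lip in auto)
      also have "\<dots> = M * (\<Sum>(s, t)\<in>P. t - s)" by (simp add: sum_distrib_left)
      also have "\<dots> \<le> M * (e / (M + 1))" using P M_nonneg by (intro mult_left_mono) auto
      also have "\<dots> < e" using e M_nonneg by (simp add: field_simps)
      finally show "(\<Sum>(s, t)\<in>P. dist (X s) (X t)) < e" .
    qed
  qed
  moreover have "AE t in lebesgue. 0 < t \<longrightarrow> (X has_vector_derivative f (X t) (a t) (b t)) (at t)"
  proof -
    define g where "g = (\<lambda>s. if s \<in> {0..} then f (X s) (a s) (b s) else 0)"
    have "g \<in> borel_measurable lebesgue"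
      unfolding g_def by (rule borel_measurable_if_I[OF velocity_measurable[OF cont a b]]) simp
    then have meas: "g \<in> borel_measurable (lebesgue_on {u..v})" for u v
      by (rule measurable_restrict_space1)
    have bound: "norm (g s) \<le> M" for s
      using velocity_bound[OF a b, of s "X s"] M_nonneg by (auto simp: g_def)
    have "g integrable_on {u..v}" for u v
      by (rule measurable_bounded_by_integrable_imp_integrable[OF meas integrable_const_ivl bound]) simp
    then obtain N where N: "negligible N"
      "\<And>t. \<lbrakk>t \<notin> N; 0 < t\<rbrakk> \<Longrightarrow> ((\<lambda>t. integral {0..t} g) has_vector_derivative g t) (at t)"
      using AE_indefinite_integral_derivative by blast
    have "(X has_vector_derivative f (X t) (a t) (b t)) (at t)" if t: "t \<notin> N" "0 < t" for t
    proof (rule has_vector_derivative_transform_within_open[where f = "\<lambda>t. x + integral {0..t} g" and S = "{0<..}"])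
      show "((\<lambda>t. x + integral {0..t} g) has_vector_derivative f (X t) (a t) (b t)) (at t)"
        using has_vector_derivative_add[OF has_vector_derivative_const N(2)[OF t]] t by (simp add: g_def)
      show "x + integral {0..s} g = X s" if "s \<in> {0<..}" for s
      proof -
        have "integral {0..s} g = integral {0..s} (\<lambda>s. f (X s) (a s) (b s))"
          by (rule integral_cong) (simp add: g_def)
        then show ?thesis using eq[of s] that by simp
      qed
    qed (use t in auto)
    then show ?thesis using N(1) unfolding eventually_ae_filter_negligible by blast
  qed
  moreover have "X 0 = x" using eq[of 0] by simp
  ultimately show "is_trajectory f x a b X" using ext by (simp add: is_trajectory_def)
qed

abbreviation traj :: "real^'n \<Rightarrow> (real \<Rightarrow> 'a) \<Rightarrow> (real \<Rightarrow> 'b) \<Rightarrow> real \<Rightarrow> real^'n" where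
  "traj \<equiv> trajectory f"

lemma traj_solves:
  assumes a: "a \<in> controls A" and b: "b \<in> controls B"
  shows "solves x a b (traj x a b)"
proof -
  obtain X where X: "X \<in> extensional {0..}" "solves x a b X" using solves_exists[OF a b] .
  have "is_trajectory f x a b (traj x a b)"
  proof -
    have "\<exists>!X. is_trajectory f x a b X"
    proof (rule ex1I[of _ X])
      show "is_trajectory f x a b X" using X solves_trajectory_equiv[OF a b] by blast
      fix Y assume "is_trajectory f x a b Y"
      then have Y: "Y \<in> extensional {0..}" "solves x a b Y" using solves_trajectory_equiv[OF a b] by blast+
      show "Y = X"
      proof (rule extensionalityI[OF Y(1) X(1)])
        fix t :: real assume "t \<in> {0..}"
        then show "Y t = X t" using solves_lipschitz[OF Y(2) X(2) a b a b, of t t] by simp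
      qed
    qed
    then show ?thesis unfolding trajectory_def by (rule theI'[of "is_trajectory f x a b"])
  qed
  then show ?thesis using solves_trajectory_equiv[OF a b] by blast
qed

text \<open>
  This is the tool for identifying trajectories: translates in time and in space of
  trajectories are recognised by the integral equation that they solve.
\<close>

lemma traj_unique:
  assumes "a \<in> controls A" "b \<in> controls B" "solves x a b X" "0 \<le> t"
  shows "traj x a b t = X t"
  using solves_lipschitz[OF traj_solves[OF assms(1,2)] assms(3,1,2,1,2), of t t x] assms(4) by simp

lemma traj_continuous: "a \<in> controls A \<Longrightarrow> b \<in> controls B \<Longrightarrow> continuous_on {0..} (traj x a b)"
  using traj_solves by (auto simp: solves_def)

lemma traj_eq:
  "a \<in> controls A \<Longrightarrow> b \<in> controls B \<Longrightarrow> 0 \<le> t \<Longrightarrow>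
    traj x a b t = x + integral {0..t} (\<lambda>s. f (traj x a b s) (a s) (b s))"
  using traj_solves unfolding solves_def by blast

lemma traj_0 [simp]: "a \<in> controls A \<Longrightarrow> b \<in> controls B \<Longrightarrow> traj x a b 0 = x"
  using traj_eq[of a b 0 x] by simp

lemma traj_lipschitz_initial:
  assumes "a \<in> controls A" "b \<in> controls B" "0 \<le> t"
  shows "norm (traj x a b t - traj y a b t) \<le> norm (x - y) * exp (L * t)"
  using solves_lipschitz[OF traj_solves[OF assms(1,2)] traj_solves[OF assms(1,2)] assms(1,2,1,2), of t t] assms(3) by simp

text \<open>
  Only the controls up to time \<open>t\<close>, and only up to null sets, matter; this is what makes
  concatenated strategies nonanticipating.
\<close>

lemma traj_cong:
  assumes "a \<in> controls A" "b \<in> controls B" "a' \<in> controls A" "b' \<in> controls B"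
    "agree_upto T a a'" "agree_upto T b b'" "0 \<le> t" "t \<le> T"
  shows "traj x a b t = traj x a' b' t"
  using solves_lipschitz[OF traj_solves[OF assms(1,2)] traj_solves[OF assms(3,4)] assms(1-6), of t x x] assms(7,8) by simp

lemma traj_shift:
  assumes a: "a \<in> controls A" and b: "b \<in> controls B" and h: "0 \<le> h" and t: "0 \<le> t"
  shows "traj x a b (h + t) = traj (traj x a b h) (shift_control h a) (shift_control h b) t"
proof -
  let ?v = "\<lambda>s. f (traj x a b s) (a s) (b s)"
  have "solves (traj x a b h) (shift_control h a) (shift_control h b) (\<lambda>t. traj x a b (h + t))"
    unfolding solves_def
  proof (intro conjI allI impI)
    show "continuous_on {0..} (\<lambda>t. traj x a b (h + t))"
      by (rule continuous_on_compose2[OF traj_continuous[OF a b]]) (use h in \<open>auto intro!: continuous_intros\<close>)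
    fix t :: real assume t: "0 \<le> t"
    have "integral {0..h} ?v + integral {h..h+t} ?v = integral {0..h+t} ?v"
      by (rule Henstock_Kurzweil_Integration.integral_combine) (use h t velocity_integrable[OF traj_continuous[OF a b] a b] in auto)
    moreover have "integral {h..h+t} ?v = integral {0..t} (\<lambda>s. f (traj x a b (h + s)) (a (h + s)) (b (h + s)))"
      using integral_translate[of t ?v h] by simp
    moreover have "\<dots> = integral {0..t} (\<lambda>s. f (traj x a b (h + s)) (shift_control h a s) (shift_control h b s))"
      by (rule integral_cong) simp
    ultimately show "traj x a b (h + t) = traj x a b h + integral {0..t} (\<lambda>s. f (traj x a b (h + s)) (shift_control h a s) (shift_control h b s))"
      using traj_eq[OF a b, of h x] traj_eq[OF a b, of "h + t" x] h t by simp
  qed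
  from traj_unique[OF shift_control_in[OF a h] shift_control_in[OF b h] this t] show ?thesis by simp
qed

lemma traj_periodic:
  assumes a: "a \<in> controls A" and b: "b \<in> controls B" and k: "k \<in> int_lattice" and t: "0 \<le> t"
  shows "traj (x + k) a b t = traj x a b t + k"
proof (rule traj_unique[OF a b _ t])
  show "solves (x + k) a b (\<lambda>t. traj x a b t + k)"
    unfolding solves_def
  proof (intro conjI allI impI)
    show "continuous_on {0..} (\<lambda>t. traj x a b t + k)"
      by (intro continuous_intros traj_continuous a b)
    fix t :: real assume t: "0 \<le> t"
    have "integral {0..t} (\<lambda>s. f (traj x a b s + k) (a s) (b s)) = integral {0..t} (\<lambda>s. f (traj x a b s) (a s) (b s))"
      by (rule integral_cong) (use periodic_f k controls_space[OF a] controls_space[OF b] in auto)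
    then show "traj x a b t + k = x + k + integral {0..t} (\<lambda>s. f (traj x a b s + k) (a s) (b s))"
      using traj_eq[OF a b t, of x] by simp
  qed
qed

lemma traj_speed:
  assumes a: "a \<in> controls A" and b: "b \<in> controls B" and t: "0 \<le> t"
  shows "norm (traj x a b t - x) \<le> M * t"
proof -
  have "norm (integral {0..t} (\<lambda>s. f (traj x a b s) (a s) (b s))) \<le> M * (t - 0)"
    by (rule integral_norm_le_const) (use t velocity_integrable[OF traj_continuous[OF a b] a b] velocity_bound[OF a b] in auto)
  then show ?thesis using traj_eq[OF a b t, of x] by simp
qed

end

lemma exponential_decay:
  fixes \<delta> :: real assumes "0 < \<delta>"
  shows "((\<lambda>t. C * exp (- \<delta> * t) / \<delta>) \<longlongrightarrow> 0) at_top"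
proof -
  have "filterlim (\<lambda>t. - \<delta> * t) at_bot at_top"
    using assms by (intro filterlim_tendsto_neg_mult_at_bot[OF tendsto_const _ filterlim_ident]) simp
  then have "((\<lambda>t. exp (- \<delta> * t)) \<longlongrightarrow> 0) at_top"
    by (rule filterlim_compose[OF exp_at_bot])
  from tendsto_mult_right_zero[OF this, of "C / \<delta>"] show ?thesis by simp
qed

context game_dynamics
begin

section \<open>Running payoffs\<close>

text \<open>
  Instead of a modulus of continuity the payoff is uniformly continuous in the state, uniformly
  in the controls. In this form the notion is preserved by adding a continuous periodic function of
  the state, which yields the payoffs \<open>l + g\<close> and \<open>l + g - \<delta> v\<^sub>\<delta>\<close> of the proof.
\<close>

definition running_payoff :: "(real^'n \<Rightarrow> 'a \<Rightarrow> 'b \<Rightarrow> real) \<Rightarrow> bool" where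
  "running_payoff l \<longleftrightarrow> continuous_on (UNIV \<times> A \<times> B) (\<lambda>(x, a, b). l x a b) \<and>
     (\<exists>C. \<forall>x. \<forall>a\<in>A. \<forall>b\<in>B. \<bar>l x a b\<bar> \<le> C) \<and>
     (\<forall>e>0. \<exists>d>0. \<forall>x y. norm (x - y) < d \<longrightarrow> (\<forall>a\<in>A. \<forall>b\<in>B. \<bar>l x a b - l y a b\<bar> < e)) \<and>
     (\<forall>x. \<forall>k\<in>int_lattice. \<forall>a\<in>A. \<forall>b\<in>B. l (x + k) a b = l x a b)"

lemma payoff_bounded:
  assumes "running_payoff l"
  shows "\<exists>C\<ge>0. \<forall>x. \<forall>a\<in>A. \<forall>b\<in>B. \<bar>l x a b\<bar> \<le> C"
proof -
  obtain C where C: "\<forall>x. \<forall>a\<in>A. \<forall>b\<in>B. \<bar>l x a b\<bar> \<le> C" using assms by (auto simp: running_payoff_def)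
  show ?thesis by (rule exI[of _ "max C 0"]) (use C in \<open>auto simp: max.coboundedI1\<close>)
qed

lemma payoff_uniform:
  assumes "running_payoff l" "0 < e"
  shows "\<exists>d>0. \<forall>x y. norm (x - y) < d \<longrightarrow> (\<forall>a\<in>A. \<forall>b\<in>B. \<bar>l x a b - l y a b\<bar> < e)"
  using assms unfolding running_payoff_def by blast

lemma payoff_continuous:
  "running_payoff l \<Longrightarrow> continuous_on (UNIV \<times> A \<times> B) (\<lambda>(x, a, b). l x a b)"
  by (simp add: running_payoff_def)

lemma payoff_periodic:
  "running_payoff l \<Longrightarrow> k \<in> int_lattice \<Longrightarrow> a \<in> A \<Longrightarrow> b \<in> B \<Longrightarrow> l (x + k) a b = l x a b"
  by (simp add: running_payoff_def)

lemma payoff_zero: "running_payoff (\<lambda>x a b. 0)"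
  by (auto simp: running_payoff_def case_prod_unfold intro: exI[of _ 1])

lemma payoff_minus:
  assumes l: "running_payoff l" shows "running_payoff (\<lambda>x a b. - l x a b)"
  unfolding running_payoff_def
proof (intro conjI allI impI ballI)
  show "continuous_on (UNIV \<times> A \<times> B) (\<lambda>(x, a, b). - l x a b)"
    using continuous_on_minus[OF payoff_continuous[OF l]] by (simp add: case_prod_unfold)
  show "\<exists>C. \<forall>x. \<forall>a\<in>A. \<forall>b\<in>B. \<bar>- l x a b\<bar> \<le> C" using l by (simp add: running_payoff_def)
  fix e :: real assume e: "0 < e"
  obtain d where "0 < d" "\<And>x y a b. norm (x - y) < d \<Longrightarrow> a \<in> A \<Longrightarrow> b \<in> B \<Longrightarrow> \<bar>l x a b - l y a b\<bar> < e"
    using payoff_uniform[OF l e] by blast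
  then show "\<exists>d>0. \<forall>x y. norm (x - y) < d \<longrightarrow> (\<forall>a\<in>A. \<forall>b\<in>B. \<bar>- l x a b - - l y a b\<bar> < e)"
    by (intro exI[of _ d]) (auto simp: abs_minus_commute)
qed (use payoff_periodic[OF l] in auto)

lemma payoff_add_function:
  assumes l: "running_payoff l" and g: "continuous_on UNIV g" "lattice_periodic g"
  shows "running_payoff (\<lambda>x a b. l x a b + g x)"
  unfolding running_payoff_def
proof (intro conjI allI impI ballI)
  have "continuous_on (UNIV \<times> A \<times> B) (\<lambda>p. g (fst p))"
    by (rule continuous_on_compose2[OF g(1)]) (auto intro!: continuous_intros)
  from continuous_on_add[OF payoff_continuous[OF l] this]
  show "continuous_on (UNIV \<times> A \<times> B) (\<lambda>(x, a, b). l x a b + g x)"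
    by (simp add: case_prod_unfold)
  obtain C where C0: "0 \<le> C" and C: "\<forall>x. \<forall>a\<in>A. \<forall>b\<in>B. \<bar>l x a b\<bar> \<le> C"
    using payoff_bounded[OF l] by blast
  obtain C' where C': "\<And>x. \<bar>g x\<bar> \<le> C'" using periodic_bounded[OF g] by blast
  have "\<bar>l x a b + g x\<bar> \<le> C + C'" if "a \<in> A" "b \<in> B" for x a b
    using bspec[OF bspec[OF spec[OF C, of x] that(1)] that(2)] C'[of x] by linarith
  then show "\<exists>C. \<forall>x. \<forall>a\<in>A. \<forall>b\<in>B. \<bar>l x a b + g x\<bar> \<le> C" by blast
  fix e :: real assume e: "0 < e"
  then have e2: "0 < e / 2" by simp
  obtain d where d: "0 < d" "\<And>x y a b. norm (x - y) < d \<Longrightarrow> a \<in> A \<Longrightarrow> b \<in> B \<Longrightarrow> \<bar>l x a b - l y a b\<bar> < e / 2"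
    using payoff_uniform[OF l e2] by blast
  obtain d' where d': "0 < d'" "\<And>x y. norm (x - y) < d' \<Longrightarrow> \<bar>g x - g y\<bar> < e / 2"
    using periodic_uniformly_continuous[OF g e2] by blast
  have "\<bar>l x a b + g x - (l y a b + g y)\<bar> < e" if "norm (x - y) < min d d'" "a \<in> A" "b \<in> B" for x y a b
    using d(2)[of x y a b] d'(2)[of x y] that by (simp add: abs_if split: if_splits)
  then show "\<exists>d>0. \<forall>x y. norm (x - y) < d \<longrightarrow> (\<forall>a\<in>A. \<forall>b\<in>B. \<bar>l x a b + g x - (l y a b + g y)\<bar> < e)"
    using d(1) d'(1) by (intro exI[of _ "min d d'"]) auto
qed (use payoff_periodic[OF l] g(2) in \<open>auto simp: lattice_periodic_def\<close>)

text \<open>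
  Discounted payoff accumulated up to time \<open>t\<close>; the rate \<open>0\<close> is allowed and gives the
  undiscounted payoff in the guarantees for the two players.
\<close>

definition acc :: "real \<Rightarrow> (real^'n \<Rightarrow> 'a \<Rightarrow> 'b \<Rightarrow> real) \<Rightarrow> real^'n \<Rightarrow> (real \<Rightarrow> 'a) \<Rightarrow> (real \<Rightarrow> 'b) \<Rightarrow> real \<Rightarrow> real" where
  "acc \<delta> l x a b t = integral {0..t} (\<lambda>s. exp (- \<delta> * s) * l (traj x a b s) (a s) (b s))"

lemma acc_0 [simp]: "acc \<delta> l x a b 0 = 0"
  by (simp add: acc_def)

lemma discounted_rate_measurable:
  assumes l: "running_payoff l" and a: "a \<in> controls A" and b: "b \<in> controls B"
  shows "(\<lambda>s. exp (- \<delta> * s) * l (traj x a b s) (a s) (b s)) \<in> borel_measurable (lebesgue_on {0..})"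
proof (rule borel_measurable_times)
  show "(\<lambda>s. exp (- \<delta> * s)) \<in> borel_measurable (lebesgue_on {0..})"
    by (rule continuous_imp_measurable_on_sets_lebesgue) (auto intro!: continuous_intros)
  show "(\<lambda>s. l (traj x a b s) (a s) (b s)) \<in> borel_measurable (lebesgue_on {0..})"
    by (rule measurable_along[OF payoff_continuous[OF l] traj_continuous[OF a b] a b])
qed

lemma rate_bound:
  assumes C: "\<forall>x. \<forall>a\<in>A. \<forall>b\<in>B. \<bar>l x a b\<bar> \<le> C" and "a \<in> controls A" "b \<in> controls B" "0 \<le> s"
  shows "\<bar>l (traj x a b s) (a s) (b s)\<bar> \<le> C"
  using C controls_space[OF assms(2,4)] controls_space[OF assms(3,4)] by blast

lemma discounted_rate_bound:
  assumes C: "\<forall>x. \<forall>a\<in>A. \<forall>b\<in>B. \<bar>l x a b\<bar> \<le> C" and c: "a \<in> controls A" "b \<in> controls B" "0 \<le> s"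
    and \<delta>: "0 \<le> \<delta>"
  shows "norm (exp (- \<delta> * s) * l (traj x a b s) (a s) (b s)) \<le> C"
proof -
  have "exp (- \<delta> * s) \<le> 1" using \<delta> c(3) by simp
  then have "exp (- \<delta> * s) * \<bar>l (traj x a b s) (a s) (b s)\<bar> \<le> 1 * C"
    using rate_bound[of l C a b s x, OF C c] by (intro mult_mono) auto
  then show ?thesis by (simp add: abs_mult)
qed

lemma discounted_rate_integrable:
  assumes l: "running_payoff l" and a: "a \<in> controls A" and b: "b \<in> controls B" and "0 \<le> \<delta>" "0 \<le> s"
  shows "(\<lambda>s. exp (- \<delta> * s) * l (traj x a b s) (a s) (b s)) integrable_on {s..t}"
proof -
  obtain C where C0: "0 \<le> C" and C: "\<forall>x. \<forall>a\<in>A. \<forall>b\<in>B. \<bar>l x a b\<bar> \<le> C"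
    using payoff_bounded[OF l] by blast
  show ?thesis
    by (rule bounded_measurable_integrable_on[OF discounted_rate_measurable[OF l a b] _ assms(5)])
      (rule discounted_rate_bound[OF C a b _ assms(4)])
qed

lemma rate_integrable:
  assumes l: "running_payoff l" and a: "a \<in> controls A" and b: "b \<in> controls B" and "0 \<le> s"
  shows "(\<lambda>s. l (traj x a b s) (a s) (b s)) integrable_on {s..t}"
  using discounted_rate_integrable[OF l a b order_refl assms(4)] by simp

lemma acc_bound:
  assumes l: "running_payoff l" and C: "\<forall>x. \<forall>a\<in>A. \<forall>b\<in>B. \<bar>l x a b\<bar> \<le> C"
    and a: "a \<in> controls A" and b: "b \<in> controls B" and "0 \<le> \<delta>" "0 \<le> t"
  shows "\<bar>acc \<delta> l x a b t\<bar> \<le> C * t"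
proof -
  have "norm (acc \<delta> l x a b t) \<le> C * (t - 0)"
    unfolding acc_def
    by (rule integral_norm_le_const[OF discounted_rate_integrable[OF l a b]])
      (use assms discounted_rate_bound[OF C a b] in auto)
  then show ?thesis by simp
qed

lemma acc_split:
  assumes l: "running_payoff l" and a: "a \<in> controls A" and b: "b \<in> controls B"
    and \<delta>: "0 \<le> \<delta>" and h: "0 \<le> h" and t: "0 \<le> t"
  shows "acc \<delta> l x a b (h + t) = acc \<delta> l x a b h +
    exp (- \<delta> * h) * acc \<delta> l (traj x a b h) (shift_control h a) (shift_control h b) t"
proof -
  let ?r = "\<lambda>s. exp (- \<delta> * s) * l (traj x a b s) (a s) (b s)"
  have "integral {0..h} ?r + integral {h..h+t} ?r = integral {0..h+t} ?r"
    by (rule Henstock_Kurzweil_Integration.integral_combine)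
      (use h t discounted_rate_integrable[OF l a b \<delta>] in auto)
  moreover have "integral {h..h+t} ?r = integral {0..t} (\<lambda>s. ?r (h + s))"
    using integral_translate[of t ?r h] by simp
  moreover have "\<dots> = integral {0..t} (\<lambda>s. exp (- \<delta> * h) * (exp (- \<delta> * s) *
      l (traj (traj x a b h) (shift_control h a) (shift_control h b) s) (shift_control h a s) (shift_control h b s)))"
  proof (rule integral_cong)
    fix s assume "s \<in> {0..t}"
    moreover have "exp (- \<delta> * (h + s)) = exp (- \<delta> * h) * exp (- \<delta> * s)"
      by (simp add: exp_add[symmetric] algebra_simps)
    ultimately show "?r (h + s) = exp (- \<delta> * h) * (exp (- \<delta> * s) *
      l (traj (traj x a b h) (shift_control h a) (shift_control h b) s) (shift_control h a s) (shift_control h b s))"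
      by (simp add: traj_shift[OF a b h])
  qed
  ultimately show ?thesis by (simp add: acc_def)
qed

lemma acc_cong:
  assumes "a \<in> controls A" "b \<in> controls B" "a' \<in> controls A" "b' \<in> controls B"
    "agree_upto T a a'" "agree_upto T b b'" "t \<le> T"
  shows "acc \<delta> l x a b t = acc \<delta> l x a' b' t"
proof -
  obtain N where N: "negligible N" "\<And>s. \<lbrakk>0 \<le> s; s \<le> T; s \<notin> N\<rbrakk> \<Longrightarrow> a s = a' s"
    using assms(5) unfolding agree_upto_iff by blast
  obtain N' where N': "negligible N'" "\<And>s. \<lbrakk>0 \<le> s; s \<le> T; s \<notin> N'\<rbrakk> \<Longrightarrow> b s = b' s"
    using assms(6) unfolding agree_upto_iff by blast
  show ?thesis
    unfolding acc_def
    by (rule integral_spike[OF negligible_Un[OF N(1) N'(1)]])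
      (use N(2) N'(2) assms(7) traj_cong[OF assms(1-6)] in auto)
qed

subsection \<open>The discounted payoff as a limit of finite horizons\<close>

text \<open>
  What is earned after time \<open>t\<close> is at most the integral of \<open>C exp (- \<delta> s)\<close> over \<open>s \<ge> t\<close>.
\<close>

lemma payoff_tail:
  assumes l: "running_payoff l" and C: "\<forall>x. \<forall>a\<in>A. \<forall>b\<in>B. \<bar>l x a b\<bar> \<le> C"
    and a: "a \<in> controls A" and b: "b \<in> controls B" and \<delta>: "0 < \<delta>" and t: "0 \<le> t"
  shows "\<bar>discounted_payoff f l \<delta> x a b - acc \<delta> l x a b t\<bar> \<le> C * exp (- \<delta> * t) / \<delta>"
proof -
  let ?r = "\<lambda>s. exp (- \<delta> * s) * l (traj x a b s) (a s) (b s)"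
  have le: "norm (?r s) \<le> C * exp (- \<delta> * s)" if "0 \<le> s" for s
    using mult_left_mono[OF rate_bound[of l C a b s x, OF C a b that], of "exp (- \<delta> * s)"] by (simp add: abs_mult mult.commute)
  have dom: "((\<lambda>s. C * exp (- \<delta> * s)) has_integral C * (exp (- \<delta> * c) / \<delta>)) {c..}" for c
    by (rule has_integral_mult_right[OF has_integral_exp_minus_to_infinity[OF \<delta>]])
  have abs: "?r absolutely_integrable_on {0..}"
    by (rule measurable_bounded_by_integrable_imp_absolutely_integrable[OF discounted_rate_measurable[OF l a b] _ has_integral_integrable[OF dom]])
      (use le in auto)
  have tail: "?r integrable_on {t..}"
    using set_lebesgue_integral_eq_integral(1)[OF set_integrable_subset[OF abs, of "{t..}"]] t by auto
  have "discounted_payoff f l \<delta> x a b = integral {0..} ?r"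
    unfolding discounted_payoff_def by (rule set_lebesgue_integral_eq_integral(2)[OF abs])
  also have "{0..} = {0..t} \<union> {t..}" using t by auto
  also have "integral ({0..t} \<union> {t..}) ?r = integral {0..t} ?r + integral {t..} ?r"
  proof (rule Henstock_Kurzweil_Integration.integral_Un)
    show "?r integrable_on {0..t}" using discounted_rate_integrable[OF l a b] \<delta> by simp
    have "{0..t} \<inter> {t..} = {t}" using t by auto
    then show "negligible ({0..t} \<inter> {t..})" by simp
  qed (fact tail)
  finally have "discounted_payoff f l \<delta> x a b - acc \<delta> l x a b t = integral {t..} ?r"
    by (simp add: acc_def)
  moreover have "norm (integral {t..} ?r) \<le> integral {t..} (\<lambda>s. C * exp (- \<delta> * s))"
    by (rule integral_norm_bound_integral[OF tail has_integral_integrable[OF dom]]) (use le t in auto)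
  ultimately show ?thesis using integral_unique[OF dom[of t]] by simp
qed

lemma payoff_bound:
  assumes l: "running_payoff l" and C: "\<forall>x. \<forall>a\<in>A. \<forall>b\<in>B. \<bar>l x a b\<bar> \<le> C"
    and a: "a \<in> controls A" and b: "b \<in> controls B" and \<delta>: "0 < \<delta>"
  shows "\<bar>discounted_payoff f l \<delta> x a b\<bar> \<le> C / \<delta>"
  using payoff_tail[OF l C a b \<delta> order_refl, of x] by simp

lemma payoff_limit:
  assumes l: "running_payoff l" and a: "a \<in> controls A" and b: "b \<in> controls B" and \<delta>: "0 < \<delta>"
  shows "((\<lambda>t. acc \<delta> l x a b t) \<longlongrightarrow> discounted_payoff f l \<delta> x a b) at_top"
proof -
  obtain C where C0: "0 \<le> C" and C: "\<forall>x. \<forall>a\<in>A. \<forall>b\<in>B. \<bar>l x a b\<bar> \<le> C"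
    using payoff_bounded[OF l] by blast
  have ev: "\<forall>\<^sub>F t in at_top. dist (acc \<delta> l x a b t) (discounted_payoff f l \<delta> x a b) \<le> C * exp (- \<delta> * t) / \<delta>"
    using eventually_ge_at_top[of 0]
    by eventually_elim (use payoff_tail[OF l C a b \<delta>, of _ x] in \<open>simp add: dist_real_def abs_minus_commute\<close>)
  have "\<forall>\<^sub>F t in at_top. 0 \<le> dist (acc \<delta> l x a b t) (discounted_payoff f l \<delta> x a b)" by simp
  from tendsto_sandwich[OF this ev tendsto_const exponential_decay[OF \<delta>]]
  have "((\<lambda>t. dist (acc \<delta> l x a b t) (discounted_payoff f l \<delta> x a b)) \<longlongrightarrow> 0) at_top" .
  then show ?thesis by (rule tendsto_dist_iff[THEN iffD2])
qed

text \<open>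
  Stationarity of the game: after time \<open>h\<close> it restarts from the state reached, with shifted
  controls. The formula passes to the limit from finite horizons.
\<close>

lemma payoff_split:
  assumes l: "running_payoff l" and a: "a \<in> controls A" and b: "b \<in> controls B" and \<delta>: "0 < \<delta>" and h: "0 \<le> h"
  shows "discounted_payoff f l \<delta> x a b = acc \<delta> l x a b h +
    exp (- \<delta> * h) * discounted_payoff f l \<delta> (traj x a b h) (shift_control h a) (shift_control h b)"
proof -
  let ?y = "traj x a b h" and ?a = "shift_control h a" and ?b = "shift_control h b"
  have "((\<lambda>t. acc \<delta> l x a b h + exp (- \<delta> * h) * acc \<delta> l ?y ?a ?b t) \<longlongrightarrow>
      acc \<delta> l x a b h + exp (- \<delta> * h) * discounted_payoff f l \<delta> ?y ?a ?b) at_top"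
    by (intro tendsto_intros payoff_limit l \<delta> shift_control_in a b h)
  moreover have "\<forall>\<^sub>F t in at_top. acc \<delta> l x a b h + exp (- \<delta> * h) * acc \<delta> l ?y ?a ?b t = acc \<delta> l x a b (h + t)"
    using eventually_ge_at_top[of 0] by eventually_elim (use acc_split[OF l a b _ h] \<delta> in simp)
  ultimately have "((\<lambda>t. acc \<delta> l x a b (h + t)) \<longlongrightarrow> acc \<delta> l x a b h + exp (- \<delta> * h) * discounted_payoff f l \<delta> ?y ?a ?b) at_top"
    by (rule Lim_transform_eventually)
  moreover have "((\<lambda>t. acc \<delta> l x a b (h + t)) \<longlongrightarrow> discounted_payoff f l \<delta> x a b) at_top"
    by (rule filterlim_compose[OF payoff_limit[OF l a b \<delta>]]) (rule filterlim_tendsto_add_at_top[OF tendsto_const filterlim_ident])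
  ultimately show ?thesis using tendsto_unique trivial_limit_at_top_linorder by blast
qed

lemma payoff_lattice_shift:
  assumes l: "running_payoff l" and a: "a \<in> controls A" and b: "b \<in> controls B" and k: "k \<in> int_lattice"
  shows "discounted_payoff f l \<delta> (x + k) a b = discounted_payoff f l \<delta> x a b"
  unfolding discounted_payoff_def
proof (rule set_lebesgue_integral_cong)
  show "\<forall>s. s \<in> {0..} \<longrightarrow> exp (- \<delta> * s) * l (traj (x + k) a b s) (a s) (b s) = exp (- \<delta> * s) * l (traj x a b s) (a s) (b s)"
    using traj_periodic[OF a b k] payoff_periodic[OF l k] controls_space[OF a] controls_space[OF b] by simp
qed simp

text \<open>
  Up to a time after which the payoff is negligible, Gronwall's inequality keeps trajectories
  with the same controls close to each other, uniformly in the controls.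
\<close>

lemma payoff_continuous_initial:
  assumes l: "running_payoff l" and \<delta>: "0 < \<delta>" and e: "0 < e"
  shows "\<exists>d>0. \<forall>x y. norm (x - y) < d \<longrightarrow> (\<forall>a\<in>controls A. \<forall>b\<in>controls B.
    \<bar>discounted_payoff f l \<delta> x a b - discounted_payoff f l \<delta> y a b\<bar> < e)"
proof -
  obtain C where C0: "0 \<le> C" and C: "\<forall>x. \<forall>a\<in>A. \<forall>b\<in>B. \<bar>l x a b\<bar> \<le> C"
    using payoff_bounded[OF l] by blast
  have "((\<lambda>t. C * exp (- \<delta> * t) / \<delta>) \<longlongrightarrow> 0) at_top" by (rule exponential_decay[OF \<delta>])
  then have "\<forall>\<^sub>F t in at_top. C * exp (- \<delta> * t) / \<delta> < e / 4" using e by (intro order_tendstoD) auto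
  then have "\<forall>\<^sub>F t in at_top. 0 \<le> t \<and> C * exp (- \<delta> * t) / \<delta> < e / 4"
    using eventually_ge_at_top[of "0::real"] by eventually_elim auto
  then obtain T where T: "0 \<le> T" "C * exp (- \<delta> * T) / \<delta> < e / 4"
    by (auto dest: eventually_happens)
  define e1 where "e1 = e / (4 * (T + 1))"
  have e1: "0 < e1" using e T by (simp add: e1_def)
  obtain d where d: "0 < d" "\<And>x y a b. norm (x - y) < d \<Longrightarrow> a \<in> A \<Longrightarrow> b \<in> B \<Longrightarrow> \<bar>l x a b - l y a b\<bar> < e1"
    using payoff_uniform[OF l e1] by blast
  show ?thesis
  proof (intro exI[of _ "d * exp (- L * T)"] conjI allI impI ballI)
    show "0 < d * exp (- L * T)" using d by simp
    fix x y :: "real^'n" and a b assume xy: "norm (x - y) < d * exp (- L * T)" and a: "a \<in> controls A" and b: "b \<in> controls B"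
    let ?rx = "\<lambda>s. exp (- \<delta> * s) * l (traj x a b s) (a s) (b s)" and ?ry = "\<lambda>s. exp (- \<delta> * s) * l (traj y a b s) (a s) (b s)"
    have int: "?rx integrable_on {0..T}" "?ry integrable_on {0..T}"
      using discounted_rate_integrable[OF l a b] \<delta> by auto
    have "norm (?rx s - ?ry s) \<le> e1" if s: "s \<in> {0..T}" for s
    proof -
      have "norm (traj x a b s - traj y a b s) \<le> norm (x - y) * exp (L * s)"
        using traj_lipschitz_initial[OF a b] s by simp
      also have "\<dots> \<le> norm (x - y) * exp (L * T)"
        using s L_nonneg by (intro mult_left_mono) (auto intro: mult_left_mono)
      also have "\<dots> < d * exp (- L * T) * exp (L * T)" using xy by (intro mult_strict_right_mono) auto
      also have "\<dots> = d" by (simp add: exp_minus)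
      finally have "\<bar>l (traj x a b s) (a s) (b s) - l (traj y a b s) (a s) (b s)\<bar> < e1"
        using d(2) controls_space[OF a] controls_space[OF b] s by simp
      moreover have "exp (- \<delta> * s) \<le> 1" using \<delta> s by simp
      ultimately have "exp (- \<delta> * s) * \<bar>l (traj x a b s) (a s) (b s) - l (traj y a b s) (a s) (b s)\<bar> \<le> 1 * e1"
        by (intro mult_mono) auto
      then show ?thesis by (simp add: abs_mult right_diff_distrib[symmetric])
    qed
    then have "norm (integral {0..T} (\<lambda>s. ?rx s - ?ry s)) \<le> e1 * (T - 0)"
      using T int by (intro integral_norm_le_const integrable_diff) auto
    then have "\<bar>acc \<delta> l x a b T - acc \<delta> l y a b T\<bar> \<le> e1 * T"
      using int by (simp add: acc_def Henstock_Kurzweil_Integration.integral_diff)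
    also have "\<dots> \<le> e / 4" using T e by (simp add: e1_def field_simps)
    finally have "\<bar>acc \<delta> l x a b T - acc \<delta> l y a b T\<bar> \<le> e / 4" .
    then show "\<bar>discounted_payoff f l \<delta> x a b - discounted_payoff f l \<delta> y a b\<bar> < e"
      using payoff_tail[OF l C a b \<delta> T(1), of x] payoff_tail[OF l C a b \<delta> T(1), of y] T(2) by linarith
  qed
qed

section \<open>Strategies\<close>

abbreviation strats :: "((real \<Rightarrow> 'b) \<Rightarrow> (real \<Rightarrow> 'a)) set" where "strats \<equiv> strategies A B"

lemma strategy_control [intro]: "\<alpha> \<in> strats \<Longrightarrow> b \<in> controls B \<Longrightarrow> \<alpha> b \<in> controls A"
  by (auto simp: strategies_def)

lemma strategy_nonanticipating:
  "\<lbrakk>\<alpha> \<in> strats; 0 < t; b1 \<in> controls B; b2 \<in> controls B; agree_upto t b1 b2\<rbrakk> \<Longrightarrow> agree_upto t (\<alpha> b1) (\<alpha> b2)"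
  by (auto simp: strategies_def)

lemma controls_A_nonempty: obtains a where "a \<in> controls A"
  using nonempty_A constant_control by (metis ex_in_conv)

lemma controls_B_nonempty: obtains b where "b \<in> controls B"
  using nonempty_B constant_control by (metis ex_in_conv)

lemma constant_strategy: "a \<in> controls A \<Longrightarrow> (\<lambda>b. a) \<in> strats"
  by (auto simp: strategies_def)

text \<open>
  Switching at time \<open>h\<close> to a strategy that depends on the state reached is nonanticipating, since
  that state depends on \<open>b\<close> only up to time \<open>h\<close>. The dependence of \<open>\<sigma>\<close> on the state may be arbitrary:
  for a fixed \<open>b\<close> only one of the strategies \<open>\<sigma> y\<close> is played.
\<close>

lemma join_strategy:
  assumes \<alpha>: "\<alpha> \<in> strats" and \<sigma>: "\<And>y. \<sigma> y \<in> strats" and h: "0 < h"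
  shows "(\<lambda>b. join_control h (\<alpha> b) (\<sigma> (traj x (\<alpha> b) b h) (shift_control h b))) \<in> strats"
proof -
  have in_A: "join_control h (\<alpha> b) (\<sigma> (traj x (\<alpha> b) b h) (shift_control h b)) \<in> controls A" if b: "b \<in> controls B" for b
    using \<alpha> \<sigma> b h by (intro join_control_in strategy_control shift_control_in) auto
  have "agree_upto t (join_control h (\<alpha> b1) (\<sigma> (traj x (\<alpha> b1) b1 h) (shift_control h b1)))
      (join_control h (\<alpha> b2) (\<sigma> (traj x (\<alpha> b2) b2 h) (shift_control h b2)))"
    if t: "0 < t" and b: "b1 \<in> controls B" "b2 \<in> controls B" and agree: "agree_upto t b1 b2" for t b1 b2
  proof (cases "t \<le> h")
    case True
    then show ?thesis by (intro agree_upto_join_early strategy_nonanticipating \<alpha> t b agree)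
  next
    case False
    have agree_h: "agree_upto h b1 b2" using agree_upto_mono[OF agree] False by simp
    have 1: "agree_upto h (\<alpha> b1) (\<alpha> b2)" by (intro strategy_nonanticipating \<alpha> h b agree_h)
    have y: "traj x (\<alpha> b1) b1 h = traj x (\<alpha> b2) b2 h"
      by (rule traj_cong[OF _ _ _ _ 1 agree_h]) (use \<alpha> b h in auto)
    have "agree_upto (t - h) (shift_control h b1) (shift_control h b2)"
      by (rule agree_upto_shift) (use agree h in auto)
    then have "agree_upto (t - h) (\<sigma> (traj x (\<alpha> b2) b2 h) (shift_control h b1)) (\<sigma> (traj x (\<alpha> b2) b2 h) (shift_control h b2))"
      using False h b by (intro strategy_nonanticipating \<sigma> shift_control_in) auto
    from agree_upto_join[OF 1 this] show ?thesis using h y by simp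
  qed
  with in_A show ?thesis by (auto simp: strategies_def)
qed

text \<open>
  What a strategy of player 1 does from time \<open>h\<close> on, when player 2 has played \<open>b0\<close> before, is a
  strategy for the game that restarts at time \<open>h\<close>.
\<close>

lemma tail_strategy:
  assumes \<alpha>: "\<alpha> \<in> strats" and b0: "b0 \<in> controls B" and h: "0 < h"
  shows "(\<lambda>b. shift_control h (\<alpha> (join_control h b0 b))) \<in> strats"
proof -
  have "agree_upto t (shift_control h (\<alpha> (join_control h b0 b1))) (shift_control h (\<alpha> (join_control h b0 b2)))"
    if t: "0 < t" and b: "b1 \<in> controls B" "b2 \<in> controls B" and agree: "agree_upto t b1 b2" for t b1 b2
  proof (rule agree_upto_shift)
    have "agree_upto (h + t) (join_control h b0 b1) (join_control h b0 b2)"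
      using h by (intro agree_upto_join agree agree_upto_refl) auto
    then show "agree_upto (h + t) (\<alpha> (join_control h b0 b1)) (\<alpha> (join_control h b0 b2))"
      using h t b b0 by (intro strategy_nonanticipating[OF \<alpha>] join_control_in) auto
  qed (use h in auto)
  moreover have "shift_control h (\<alpha> (join_control h b0 b)) \<in> controls A" if "b \<in> controls B" for b
    using that \<alpha> b0 h by (intro shift_control_in strategy_control join_control_in) auto
  ultimately show ?thesis by (auto simp: strategies_def)
qed

lemma join_strategy_play:
  assumes \<sigma>: "\<sigma> \<in> strats" and \<tau>: "\<And>y. \<tau> y \<in> strats" and h: "0 < h" and b: "b \<in> controls B"
    and y: "y = traj x (\<sigma> b) b h" and a: "a = join_control h (\<sigma> b) (\<tau> y (shift_control h b))"
  shows "a \<in> controls A" and "0 \<le> s \<Longrightarrow> s \<le> h \<Longrightarrow> traj x a b s = traj x (\<sigma> b) b s"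
    and "s \<le> h \<Longrightarrow> acc \<delta> l x a b s = acc \<delta> l x (\<sigma> b) b s"
    and "shift_control h a = \<tau> y (shift_control h b)"
proof -
  have h0: "0 \<le> h" using h by simp
  have sb: "\<sigma> b \<in> controls A" using \<sigma> b by blast
  have tb: "\<tau> y (shift_control h b) \<in> controls A" using \<tau> shift_control_in[OF b h0] by blast
  show ac: "a \<in> controls A" unfolding a by (rule join_control_in[OF sb tb h0])
  have agree: "agree_upto h a (\<sigma> b)" unfolding a by (rule agree_upto_join1)
  show "traj x a b s = traj x (\<sigma> b) b s" if "0 \<le> s" "s \<le> h"
    by (rule traj_cong[OF ac b sb b agree agree_upto_refl that])
  show "acc \<delta> l x a b s = acc \<delta> l x (\<sigma> b) b s" if "s \<le> h"
    by (rule acc_cong[OF ac b sb b agree agree_upto_refl that])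
  show "shift_control h a = \<tau> y (shift_control h b)"
    unfolding a by (rule shift_join_control[OF tb h0])
qed

lemma join_control_play:
  assumes \<alpha>: "\<alpha> \<in> strats" and b0: "b0 \<in> controls B" and b1: "b1 \<in> controls B" and h: "0 < h"
    and b: "b = join_control h b0 b1"
  shows "b \<in> controls B" and "0 \<le> s \<Longrightarrow> s \<le> h \<Longrightarrow> traj x (\<alpha> b) b s = traj x (\<alpha> b0) b0 s"
    and "s \<le> h \<Longrightarrow> acc \<delta> l x (\<alpha> b) b s = acc \<delta> l x (\<alpha> b0) b0 s"
    and "shift_control h b = b1"
proof -
  have h0: "0 \<le> h" using h by simp
  show bc: "b \<in> controls B" unfolding b by (rule join_control_in[OF b0 b1 h0])
  have agb: "agree_upto h b b0" unfolding b by (rule agree_upto_join1)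
  have aga: "agree_upto h (\<alpha> b) (\<alpha> b0)" by (rule strategy_nonanticipating[OF \<alpha> h bc b0 agb])
  have ab: "\<alpha> b \<in> controls A" "\<alpha> b0 \<in> controls A" using \<alpha> bc b0 by auto
  show "traj x (\<alpha> b) b s = traj x (\<alpha> b0) b0 s" if "0 \<le> s" "s \<le> h"
    by (rule traj_cong[OF ab(1) bc ab(2) b0 aga agb that])
  show "acc \<delta> l x (\<alpha> b) b s = acc \<delta> l x (\<alpha> b0) b0 s" if "s \<le> h"
    by (rule acc_cong[OF ab(1) bc ab(2) b0 aga agb that])
  show "shift_control h b = b1" unfolding b by (rule shift_join_control[OF b1 h0])
qed

text \<open>
  The reply is chosen for each point of a countable list in \<open>B\<close> and used for all controls that are
  rounded to that point, which makes it measurable. Uniform continuity of \<open>G\<close> absorbs the rounding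
  into \<open>e\<close>.
\<close>

lemma response_strategy:
  assumes G: "continuous_on (A \<times> B) (\<lambda>(a, b). G a b)" and r: "\<And>b. b \<in> B \<Longrightarrow> \<exists>a\<in>A. G a b \<le> r" and e: "0 < e"
  obtains \<sigma> where "\<sigma> \<in> strats" "\<And>b s. b \<in> controls B \<Longrightarrow> 0 \<le> s \<Longrightarrow> G (\<sigma> b s) (b s) \<le> r + (e::real)"
proof -
  have "uniformly_continuous_on (A \<times> B) (\<lambda>(a, b). G a b)"
    by (rule compact_uniformly_continuous[OF G compact_Times[OF compact_A compact_B]])
  then obtain d where d: "0 < d" "\<And>p q. \<lbrakk>p \<in> A \<times> B; q \<in> A \<times> B; dist q p < d\<rbrakk> \<Longrightarrow> dist ((\<lambda>(a, b). G a b) q) ((\<lambda>(a, b). G a b) p) < e"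
    using e unfolding uniformly_continuous_on_def by metis
  obtain q :: "nat \<Rightarrow> 'b" and idx where q: "\<And>n. q n \<in> B" "idx \<in> measurable borel (count_space UNIV)"
    "\<And>b. b \<in> B \<Longrightarrow> dist b (q (idx b)) < d"
    by (rule finite_borel_net[OF compact_B nonempty_B d(1)]) blast
  obtain \<psi> where \<psi>: "\<And>b. b \<in> B \<Longrightarrow> \<psi> b \<in> A" "\<And>b. b \<in> B \<Longrightarrow> G (\<psi> b) b \<le> r"
    using r by metis
  define \<sigma> where "\<sigma> = (\<lambda>b :: real \<Rightarrow> 'b. restrict (\<lambda>s. \<psi> (q (idx (b s)))) {0..})"
  have "\<sigma> b \<in> controls A" if b: "b \<in> controls B" for b
  proof -
    have b': "b \<in> measurable (lebesgue_on {0..}) borel" using b by (simp add: controls_def)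
    have "(\<lambda>s. \<psi> (q (idx (b s)))) \<in> measurable (lebesgue_on {0..}) borel"
      by (rule measurable_compose[OF measurable_compose[OF b' q(2)], of "\<lambda>n. \<psi> (q n)"]) simp
    then have "\<sigma> b \<in> measurable (lebesgue_on {0..}) borel"
      unfolding \<sigma>_def by (subst measurable_cong[of _ _ "\<lambda>s. \<psi> (q (idx (b s)))"]) auto
    then show ?thesis using \<psi>(1) q(1) by (auto simp: controls_def \<sigma>_def)
  qed
  moreover have "agree_upto t (\<sigma> b1) (\<sigma> b2)" if "agree_upto t b1 b2" for t b1 b2
    using that unfolding agree_upto_def by eventually_elim (simp add: \<sigma>_def)
  ultimately have "\<sigma> \<in> strats" by (auto simp: strategies_def)
  moreover have "G (\<sigma> b s) (b s) \<le> r + e" if b: "b \<in> controls B" and s: "0 \<le> s" for b s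
  proof -
    have bs: "b s \<in> B" by (rule controls_space[OF b s])
    have "dist (G (\<psi> (q (idx (b s)))) (b s)) (G (\<psi> (q (idx (b s)))) (q (idx (b s)))) < e"
      using d(2)[of "(\<psi> (q (idx (b s))), q (idx (b s)))" "(\<psi> (q (idx (b s))), b s)"] q(1,3) \<psi>(1) bs
      by (simp add: dist_Pair_Pair)
    then show ?thesis using \<psi>(2)[OF q(1), of "idx (b s)"] s by (simp add: \<sigma>_def dist_real_def)
  qed
  ultimately show thesis by (rule that)
qed

section \<open>The lower value\<close>

abbreviation lval :: "real \<Rightarrow> (real^'n \<Rightarrow> 'a \<Rightarrow> 'b \<Rightarrow> real) \<Rightarrow> real^'n \<Rightarrow> real" where
  "lval \<delta> l \<equiv> lower_value A B f l \<delta>"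

lemma payoff_bdd_above:
  assumes l: "running_payoff l" and \<delta>: "0 < \<delta>" and \<alpha>: "\<alpha> \<in> strats"
  shows "bdd_above ((\<lambda>b. discounted_payoff f l \<delta> x (\<alpha> b) b) ` controls B)"
proof -
  obtain C where C0: "0 \<le> C" and C: "\<forall>x. \<forall>a\<in>A. \<forall>b\<in>B. \<bar>l x a b\<bar> \<le> C"
    using payoff_bounded[OF l] by blast
  show ?thesis
  proof (rule bdd_aboveI2)
    fix b assume "b \<in> controls B"
    then show "discounted_payoff f l \<delta> x (\<alpha> b) b \<le> C / \<delta>"
      using payoff_bound[OF l C _ _ \<delta>, of "\<alpha> b" b x] \<alpha> by (auto simp: abs_le_iff)
  qed
qed

lemma sup_payoff_bdd_below:
  assumes l: "running_payoff l" and \<delta>: "0 < \<delta>"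
  shows "bdd_below ((\<lambda>\<alpha>. SUP b\<in>controls B. discounted_payoff f l \<delta> x (\<alpha> b) b) ` strats)"
proof -
  obtain C where C0: "0 \<le> C" and C: "\<forall>x. \<forall>a\<in>A. \<forall>b\<in>B. \<bar>l x a b\<bar> \<le> C"
    using payoff_bounded[OF l] by blast
  obtain b where b: "b \<in> controls B" using controls_B_nonempty .
  show ?thesis
  proof (rule bdd_belowI2)
    fix \<alpha> assume \<alpha>: "\<alpha> \<in> strats"
    show "- (C / \<delta>) \<le> (SUP b\<in>controls B. discounted_payoff f l \<delta> x (\<alpha> b) b)"
      using payoff_bound[OF l C strategy_control[OF \<alpha> b] b \<delta>, of x]
      by (intro cSUP_upper2[OF payoff_bdd_above[OF l \<delta> \<alpha>] b]) linarith
  qed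
qed

lemma value_le:
  assumes l: "running_payoff l" and \<delta>: "0 < \<delta>" and \<alpha>: "\<alpha> \<in> strats"
    and le: "\<And>b. b \<in> controls B \<Longrightarrow> discounted_payoff f l \<delta> x (\<alpha> b) b \<le> c"
  shows "lval \<delta> l x \<le> c"
proof -
  have "lval \<delta> l x \<le> (SUP b\<in>controls B. discounted_payoff f l \<delta> x (\<alpha> b) b)"
    unfolding lower_value_def by (rule cINF_lower[OF sup_payoff_bdd_below[OF l \<delta>] \<alpha>])
  also have "\<dots> \<le> c" using le controls_B_nonempty by (intro cSUP_least) auto
  finally show ?thesis .
qed

lemma value_ge:
  assumes l: "running_payoff l" and \<delta>: "0 < \<delta>"
    and ge: "\<And>\<alpha>. \<alpha> \<in> strats \<Longrightarrow> \<exists>b\<in>controls B. c \<le> discounted_payoff f l \<delta> x (\<alpha> b) b"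
  shows "c \<le> lval \<delta> l x"
  unfolding lower_value_def
proof (rule cINF_greatest)
  show "strats \<noteq> {}" using constant_strategy controls_A_nonempty by blast
  fix \<alpha> assume \<alpha>: "\<alpha> \<in> strats"
  then obtain b where b: "b \<in> controls B" "c \<le> discounted_payoff f l \<delta> x (\<alpha> b) b" using ge by blast
  then show "c \<le> (SUP b\<in>controls B. discounted_payoff f l \<delta> x (\<alpha> b) b)"
    by (intro cSUP_upper2[OF payoff_bdd_above[OF l \<delta> \<alpha>]])
qed

lemma value_near_optimal_strategy:
  assumes l: "running_payoff l" and \<delta>: "0 < \<delta>" and e: "0 < e"
  shows "\<exists>\<alpha>\<in>strats. \<forall>b\<in>controls B. discounted_payoff f l \<delta> x (\<alpha> b) b \<le> lval \<delta> l x + e"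
proof -
  have ne: "strats \<noteq> {}" using constant_strategy controls_A_nonempty by blast
  have "\<exists>\<alpha>\<in>strats. (SUP b\<in>controls B. discounted_payoff f l \<delta> x (\<alpha> b) b) < lval \<delta> l x + e"
    using cINF_less_iff[OF ne sup_payoff_bdd_below[OF l \<delta>], of x "lval \<delta> l x + e"] e
    by (simp add: lower_value_def)
  then obtain \<alpha> where \<alpha>: "\<alpha> \<in> strats" "(SUP b\<in>controls B. discounted_payoff f l \<delta> x (\<alpha> b) b) < lval \<delta> l x + e"
    by blast
  have "discounted_payoff f l \<delta> x (\<alpha> b) b \<le> lval \<delta> l x + e" if b: "b \<in> controls B" for b
    using cSUP_upper[OF b payoff_bdd_above[OF l \<delta> \<alpha>(1)], of x] \<alpha>(2) by linarith
  then show ?thesis using \<alpha>(1) by blast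
qed

lemma value_near_optimal_control:
  assumes l: "running_payoff l" and \<delta>: "0 < \<delta>" and e: "0 < e" and \<alpha>: "\<alpha> \<in> strats"
  shows "\<exists>b\<in>controls B. lval \<delta> l x - e \<le> discounted_payoff f l \<delta> x (\<alpha> b) b"
proof (rule ccontr)
  assume no: "\<not> ?thesis"
  have "discounted_payoff f l \<delta> x (\<alpha> b) b \<le> lval \<delta> l x - e" if "b \<in> controls B" for b
    using no that by (meson le_cases)
  from value_le[OF l \<delta> \<alpha> this] show False using e by simp
qed

lemma value_bound:
  assumes l: "running_payoff l" and C: "\<forall>x. \<forall>a\<in>A. \<forall>b\<in>B. \<bar>l x a b\<bar> \<le> C" and \<delta>: "0 < \<delta>"
  shows "\<bar>lval \<delta> l x\<bar> \<le> C / \<delta>"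
proof -
  have bd: "\<bar>discounted_payoff f l \<delta> x (\<alpha> b) b\<bar> \<le> C / \<delta>" if "\<alpha> \<in> strats" "b \<in> controls B" for \<alpha> b
    using payoff_bound[OF l C _ _ \<delta>] that by blast
  obtain a where a: "a \<in> controls A" using controls_A_nonempty .
  obtain b where b: "b \<in> controls B" using controls_B_nonempty .
  have "lval \<delta> l x \<le> C / \<delta>"
    by (rule value_le[OF l \<delta> constant_strategy[OF a]]) (use bd[OF constant_strategy[OF a]] in \<open>auto simp: abs_le_iff\<close>)
  moreover have "- (C / \<delta>) \<le> lval \<delta> l x"
    by (rule value_ge[OF l \<delta>]) (use bd b in \<open>force simp: abs_le_iff\<close>)
  ultimately show ?thesis by (simp add: abs_le_iff)
qed

lemma value_continuous:
  assumes l: "running_payoff l" and \<delta>: "0 < \<delta>"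
  shows "continuous_on UNIV (lval \<delta> l)"
  unfolding continuous_on_iff
proof (intro ballI allI impI)
  fix x :: "real^'n" and e :: real assume e: "0 < e"
  then have e3: "0 < e / 3" by simp
  obtain d where d: "0 < d" "\<And>x y a b. \<lbrakk>norm (x - y) < d; a \<in> controls A; b \<in> controls B\<rbrakk> \<Longrightarrow>
    \<bar>discounted_payoff f l \<delta> x a b - discounted_payoff f l \<delta> y a b\<bar> < e / 3"
    using payoff_continuous_initial[OF l \<delta> e3] by blast
  have le: "lval \<delta> l y \<le> lval \<delta> l z + 2 * (e / 3)" if yz: "norm (y - z) < d" for y z
  proof -
    obtain \<alpha> where \<alpha>: "\<alpha> \<in> strats" "\<And>b. b \<in> controls B \<Longrightarrow> discounted_payoff f l \<delta> z (\<alpha> b) b \<le> lval \<delta> l z + e / 3"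
      using value_near_optimal_strategy[OF l \<delta> e3] by blast
    show ?thesis
    proof (rule value_le[OF l \<delta> \<alpha>(1)])
      fix b assume b: "b \<in> controls B"
      show "discounted_payoff f l \<delta> y (\<alpha> b) b \<le> lval \<delta> l z + 2 * (e / 3)"
        using \<alpha>(2)[OF b] d(2)[OF yz strategy_control[OF \<alpha>(1) b] b] by linarith
    qed
  qed
  have "dist (lval \<delta> l y) (lval \<delta> l x) < e" if "dist y x < d" for y
    using le[of y x] le[of x y] that e by (auto simp: dist_norm norm_minus_commute abs_if)
  then show "\<exists>d>0. \<forall>y\<in>UNIV. dist y x < d \<longrightarrow> dist (lval \<delta> l y) (lval \<delta> l x) < e"
    using d(1) by blast
qed

lemma value_periodic:
  assumes l: "running_payoff l"
  shows "lattice_periodic (lval \<delta> l)"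
  unfolding lattice_periodic_def lower_value_def
proof (intro allI ballI INF_cong SUP_cong refl)
  fix x k :: "real^'n" and \<alpha> b assume "k \<in> int_lattice" "\<alpha> \<in> strats" "b \<in> controls B"
  then show "discounted_payoff f l \<delta> (x + k) (\<alpha> b) b = discounted_payoff f l \<delta> x (\<alpha> b) b"
    by (intro payoff_lattice_shift[OF l]) auto
qed

section \<open>Hamiltonians\<close>

lemma rate_inner_bounded:
  assumes l: "running_payoff l"
  shows "\<exists>K. \<forall>a\<in>A. \<forall>b\<in>B. \<bar>f x a b \<bullet> p + l x a b\<bar> \<le> K"
proof -
  obtain C where C0: "0 \<le> C" and C: "\<forall>x. \<forall>a\<in>A. \<forall>b\<in>B. \<bar>l x a b\<bar> \<le> C"
    using payoff_bounded[OF l] by blast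
  show ?thesis
  proof (intro exI ballI)
    fix a b assume ab: "a \<in> A" "b \<in> B"
    have "\<bar>f x a b \<bullet> p\<bar> \<le> M * norm p"
      using Cauchy_Schwarz_ineq2[of "f x a b" p] mult_right_mono[OF bounded_f[OF ab, of x], of "norm p"] by simp
    moreover have "\<bar>l x a b\<bar> \<le> C" using C ab by blast
    ultimately show "\<bar>f x a b \<bullet> p + l x a b\<bar> \<le> M * norm p + C" by linarith
  qed
qed

lemma le_SUP_iff_eps:
  fixes h :: "'c \<Rightarrow> real"
  assumes "bdd_above (h ` S)" "S \<noteq> {}"
  shows "r \<le> (SUP a\<in>S. h a) \<longleftrightarrow> (\<forall>e>0. \<exists>a\<in>S. r - e \<le> h a)"
proof
  assume r: "r \<le> (SUP a\<in>S. h a)"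
  show "\<forall>e>0. \<exists>a\<in>S. r - e \<le> h a"
  proof (intro allI impI)
    fix e :: real assume "0 < e"
    then have "r - e < (SUP a\<in>S. h a)" using r by simp
    then show "\<exists>a\<in>S. r - e \<le> h a"
      using less_cSUP_iff[OF assms(2,1), of "r - e"] by (auto intro: less_imp_le)
  qed
next
  assume e: "\<forall>e>0. \<exists>a\<in>S. r - e \<le> h a"
  show "r \<le> (SUP a\<in>S. h a)"
  proof (rule field_le_epsilon)
    fix e :: real assume "0 < e"
    then obtain a where a: "a \<in> S" "r - e \<le> h a" using e by blast
    then show "r \<le> (SUP a\<in>S. h a) + e" using cSUP_upper[OF a(1) assms(1)] by simp
  qed
qed

lemma INF_le_iff_eps:
  fixes h :: "'c \<Rightarrow> real"
  assumes "bdd_below (h ` S)" "S \<noteq> {}"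
  shows "(INF a\<in>S. h a) \<le> r \<longleftrightarrow> (\<forall>e>0. \<exists>a\<in>S. h a \<le> r + e)"
proof
  assume r: "(INF a\<in>S. h a) \<le> r"
  show "\<forall>e>0. \<exists>a\<in>S. h a \<le> r + e"
  proof (intro allI impI)
    fix e :: real assume "0 < e"
    then have "(INF a\<in>S. h a) < r + e" using r by simp
    then show "\<exists>a\<in>S. h a \<le> r + e"
      using cINF_less_iff[OF assms(2,1), of "r + e"] by (auto intro: less_imp_le)
  qed
next
  assume e: "\<forall>e>0. \<exists>a\<in>S. h a \<le> r + e"
  show "(INF a\<in>S. h a) \<le> r"
  proof (rule field_le_epsilon)
    fix e :: real assume "0 < e"
    then obtain a where a: "a \<in> S" "h a \<le> r + e" using e by blast
    then show "(INF a\<in>S. h a) \<le> r + e" using cINF_lower[OF assms(1) a(1)] by simp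
  qed
qed

lemma hamiltonian_bdd:
  assumes l: "running_payoff l"
  shows "b \<in> B \<Longrightarrow> bdd_above ((\<lambda>a. - (f x a b \<bullet> p) - l x a b) ` A)"
    and "bdd_below ((\<lambda>b. SUP a\<in>A. - (f x a b \<bullet> p) - l x a b) ` B)"
proof -
  obtain K where K: "\<And>a b. a \<in> A \<Longrightarrow> b \<in> B \<Longrightarrow> \<bar>f x a b \<bullet> p + l x a b\<bar> \<le> K"
    using rate_inner_bounded[OF l, of x p] by blast
  have above: "bdd_above ((\<lambda>a. - (f x a b \<bullet> p) - l x a b) ` A)" if b: "b \<in> B" for b
  proof (rule bdd_aboveI2)
    fix a assume "a \<in> A" then show "- (f x a b \<bullet> p) - l x a b \<le> K" using K[of a b] b by simp
  qed
  then show "b \<in> B \<Longrightarrow> bdd_above ((\<lambda>a. - (f x a b \<bullet> p) - l x a b) ` A)" .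
  obtain a where a: "a \<in> A" using nonempty_A by blast
  show "bdd_below ((\<lambda>b. SUP a\<in>A. - (f x a b \<bullet> p) - l x a b) ` B)"
  proof (rule bdd_belowI2)
    fix b assume b: "b \<in> B"
    show "- K \<le> (SUP a\<in>A. - (f x a b \<bullet> p) - l x a b)"
      by (rule cSUP_upper2[OF above[OF b] a]) (use K[OF a b] in simp)
  qed
qed

text \<open>
  Inequalities for the Hamiltonian are used only through the existence of replies: here, player 1
  has an approximate reply to every action of player 2, and in the next lemma, player 2 has an action
  that is approximately good against all actions of player 1.
\<close>

lemma hamiltonian_ge_iff:
  assumes l: "running_payoff l"
  shows "r \<le> hamiltonian A B f l x p \<longleftrightarrow> (\<forall>b\<in>B. \<forall>e>0. \<exists>a\<in>A. f x a b \<bullet> p + l x a b \<le> e - r)"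
proof -
  have "r \<le> hamiltonian A B f l x p \<longleftrightarrow> (\<forall>b\<in>B. r \<le> (SUP a\<in>A. - (f x a b \<bullet> p) - l x a b))"
    unfolding hamiltonian_def by (rule le_cINF_iff[OF nonempty_B hamiltonian_bdd(2)[OF l]])
  also have "\<dots> \<longleftrightarrow> (\<forall>b\<in>B. \<forall>e>0. \<exists>a\<in>A. r - e \<le> - (f x a b \<bullet> p) - l x a b)"
    using le_SUP_iff_eps[OF hamiltonian_bdd(1)[OF l] nonempty_A] by simp
  also have "\<dots> \<longleftrightarrow> (\<forall>b\<in>B. \<forall>e>0. \<exists>a\<in>A. f x a b \<bullet> p + l x a b \<le> e - r)"
    by (simp add: algebra_simps)
  finally show ?thesis .
qed

lemma hamiltonian_le_iff:
  assumes l: "running_payoff l"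
  shows "hamiltonian A B f l x p \<le> r \<longleftrightarrow> (\<forall>e>0. \<exists>b\<in>B. \<forall>a\<in>A. - r - e \<le> f x a b \<bullet> p + l x a b)"
proof -
  have "hamiltonian A B f l x p \<le> r \<longleftrightarrow> (\<forall>e>0. \<exists>b\<in>B. (SUP a\<in>A. - (f x a b \<bullet> p) - l x a b) \<le> r + e)"
    unfolding hamiltonian_def by (rule INF_le_iff_eps[OF hamiltonian_bdd(2)[OF l] nonempty_B])
  also have "\<dots> \<longleftrightarrow> (\<forall>e>0. \<exists>b\<in>B. \<forall>a\<in>A. - (f x a b \<bullet> p) - l x a b \<le> r + e)"
    by (simp add: cSUP_le_iff[OF nonempty_A hamiltonian_bdd(1)[OF l]] cong: bex_cong)
  also have "\<dots> \<longleftrightarrow> (\<forall>e>0. \<exists>b\<in>B. \<forall>a\<in>A. - r - e \<le> f x a b \<bullet> p + l x a b)"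
  proof -
    have "- (f x a b \<bullet> p) - l x a b \<le> r + e \<longleftrightarrow> - r - e \<le> f x a b \<bullet> p + l x a b" for a b e by auto
    then show ?thesis by simp
  qed
  finally show ?thesis .
qed

text \<open>
  A payoff that depends only on the state moves out of the Hamiltonian. This relates the games
  with payoffs \<open>l\<close>, \<open>l + g\<close> and \<open>l - \<delta> v\<^sub>\<delta>\<close>.
\<close>

lemma hamiltonian_add_function:
  assumes l: "running_payoff l" and lg: "running_payoff (\<lambda>x a b. l x a b + g x)"
  shows "hamiltonian A B f (\<lambda>x a b. l x a b + g x) x p = hamiltonian A B f l x p - g x"
proof -
  have "r \<le> hamiltonian A B f (\<lambda>x a b. l x a b + g x) x p \<longleftrightarrow> r + g x \<le> hamiltonian A B f l x p" for r
    unfolding hamiltonian_ge_iff[OF l] hamiltonian_ge_iff[OF lg] by (simp add: algebra_simps)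
  then have "r \<le> hamiltonian A B f (\<lambda>x a b. l x a b + g x) x p \<longleftrightarrow> r \<le> hamiltonian A B f l x p - g x" for r
    by (simp add: le_diff_eq)
  then show ?thesis by (meson order_antisym order_refl)
qed

lemma recession_hamiltonian_eq: "recession_hamiltonian A B f x p = hamiltonian A B f (\<lambda>x a b. 0) x p"
  by (simp add: recession_hamiltonian_def hamiltonian_def)

section \<open>The value is a viscosity solution\<close>

lemma exp_minus_le_quadratic: "0 \<le> z \<Longrightarrow> exp (- z) \<le> 1 - z + z\<^sup>2" for z :: real
proof -
  assume z: "0 \<le> z"
  have "exp (- z) \<le> 1 / (1 + z)"
    using exp_ge_add_one_self[of z] z by (simp add: exp_minus field_simps)
  also have "\<dots> \<le> 1 - z + z\<^sup>2"
  proof -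
    have "(1 - z + z\<^sup>2) * (1 + z) = 1 + z^3" by (simp add: algebra_simps power2_eq_square power3_eq_cube)
    then show ?thesis using z by (simp add: divide_le_eq)
  qed
  finally show ?thesis .
qed

text \<open>
  First-order expansion, over a short time \<open>h\<close> that works for all controls, of the payoff up to
  time \<open>h\<close> plus the discounted continuation \<open>v\<close>, when \<open>\<phi>\<close> touches \<open>v\<close> from above at \<open>x\<close>. The six
  errors come from differentiability of \<open>\<phi>\<close>, from freezing the state in \<open>f\<close> and in \<open>l\<close>, from the
  discount factor in the integral, from replacing \<open>v\<close> by \<open>v x\<close> in the discount, and from the second
  order term of \<open>exp (- \<delta> h)\<close>; each is at most \<open>\<theta> h / 6\<close>. Applied to \<open>- v\<close>, \<open>- \<phi>\<close> and \<open>- l\<close> it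
  also serves when \<open>\<phi>\<close> touches from below.
\<close>

lemma value_step:
  assumes l: "running_payoff l" and \<delta>: "0 < \<delta>" and v: "continuous_on UNIV v"
    and D: "GDERIV \<phi> x :> p" and max: "\<forall>\<^sub>F y in nhds x. v y - \<phi> y \<le> v x - \<phi> x" and \<theta>: "0 < \<theta>"
  shows "\<exists>h>0. \<forall>a\<in>controls A. \<forall>b\<in>controls B. \<forall>r. (\<forall>s\<ge>0. f x (a s) (b s) \<bullet> p + l x (a s) (b s) \<le> r) \<longrightarrow>
    acc \<delta> l x a b h + exp (- \<delta> * h) * v (traj x a b h) \<le> v x + (r - \<delta> * v x) * h + \<theta> * h"
proof -
  obtain C where C0: "0 \<le> C" and C: "\<forall>x. \<forall>a\<in>A. \<forall>b\<in>B. \<bar>l x a b\<bar> \<le> C"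
    using payoff_bounded[OF l] by blast
  have M1: "0 < M + 1" using M_nonneg by simp
  \<comment> \<open>Speed is at most \<open>M\<close>, so the remainder \<open>\<eta> |y - x|\<close> of \<open>\<phi>\<close> is at most \<open>\<theta> h / 6\<close>.\<close>
  define \<eta> where "\<eta> = \<theta> / 6 / (M + 1)"
  have \<eta>: "0 < \<eta>" using \<theta> M1 by (simp add: \<eta>_def)
  obtain d1 where d1: "0 < d1" "\<And>y. norm (y - x) < d1 \<Longrightarrow> \<bar>\<phi> y - \<phi> x - (y - x) \<bullet> p\<bar> \<le> \<eta> * norm (y - x)"
    using D \<eta> unfolding gderiv_def has_derivative_at_alt real_norm_def by blast
  obtain d2 where d2: "0 < d2" "\<And>y. dist y x < d2 \<Longrightarrow> v y - \<phi> y \<le> v x - \<phi> x"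
    using max unfolding eventually_nhds_metric by blast
  have "0 < \<theta> / (6 * \<delta>)" using \<theta> \<delta> by simp
  then obtain d3 where d3: "0 < d3" "\<And>y. dist y x < d3 \<Longrightarrow> dist (v y) (v x) < \<theta> / (6 * \<delta>)"
    using v unfolding continuous_on_iff by (metis UNIV_I)
  have "0 < \<theta> / 6" using \<theta> by simp
  from payoff_uniform[OF l this] obtain d4 where d4: "0 < d4" "\<And>x y a b. norm (x - y) < d4 \<Longrightarrow> a \<in> A \<Longrightarrow> b \<in> B \<Longrightarrow> \<bar>l x a b - l y a b\<bar> < \<theta> / 6"
    by blast
  define d where "d = min (min d1 d2) (min d3 d4)"
  have d: "0 < d" "d \<le> d1" "d \<le> d2" "d \<le> d3" "d \<le> d4" using d1 d2 d3 d4 by (auto simp: d_def)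
  define V where "V = \<bar>v x\<bar> + \<theta> / (6 * \<delta>)"
  have V: "0 \<le> V" using \<theta> \<delta> by (simp add: V_def)
  \<comment> \<open>\<open>K h \<le> \<theta> / 6\<close> controls the errors of order \<open>h\<^sup>2\<close>; \<open>V\<close> bounds \<open>v\<close> near \<open>x\<close>.\<close>
  define K where "K = norm p * L * M + \<delta> * C + \<delta>\<^sup>2 * V + 1"
  have K: "norm p * L * M \<le> K" "\<delta> * C \<le> K" "\<delta>\<^sup>2 * V \<le> K" "0 < K"
    using L_nonneg M_nonneg C0 V \<delta> by (auto simp: K_def add_nonneg_pos add_increasing)
  define h where "h = min (d / (2 * (M + 1))) (\<theta> / (6 * K))"
  have h: "0 < h" using d \<theta> K M1 by (simp add: h_def)
  have hd: "M * h < d"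
  proof -
    have "h \<le> d / (2 * (M + 1))" by (simp add: h_def)
    then have "h * (2 * (M + 1)) \<le> d" using M1 by (simp add: le_divide_eq)
    moreover have "M * h \<le> h * (M + 1)" "h * (2 * (M + 1)) = 2 * (h * (M + 1))" using h by (auto simp: algebra_simps)
    moreover have "0 < h * (M + 1)" using h M1 by simp
    ultimately show ?thesis by linarith
  qed
  have hK: "K' * h \<le> \<theta> / 6" if "K' \<le> K" for K'
  proof -
    have "h \<le> \<theta> / (6 * K)" by (simp add: h_def)
    then have "K * h \<le> \<theta> / 6" using K(4) by (simp add: field_simps)
    moreover have "K' * h \<le> K * h" using that h by simp
    ultimately show ?thesis by linarith
  qed
  show ?thesis
  proof (intro exI[of _ h] conjI ballI allI impI)
    show "0 < h" by (rule h)
    fix a b r assume a: "a \<in> controls A" and b: "b \<in> controls B" and r: "\<forall>s\<ge>0. f x (a s) (b s) \<bullet> p + l x (a s) (b s) \<le> r"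
    define y where "y = traj x a b h"
    have speed: "norm (traj x a b s - x) \<le> M * h" if "s \<in> {0..h}" for s
      using traj_speed[OF a b, of s x] that M_nonneg by (auto intro: order_trans mult_left_mono)
    have yd: "norm (y - x) < d" "norm (y - x) \<le> M * h"
      using speed[of h] h hd by (auto simp: y_def)
    let ?X = "traj x a b"
    have int: "(\<lambda>s. exp (- \<delta> * s) * l (?X s) (a s) (b s)) integrable_on {0..h}"
      using discounted_rate_integrable[OF l a b] \<delta> by simp
    have intf: "(\<lambda>s. f (?X s) (a s) (b s)) integrable_on {0..h}"
      using velocity_integrable[OF traj_continuous[OF a b] a b] by simp
    have intfp: "(\<lambda>s. f (?X s) (a s) (b s) \<bullet> p) integrable_on {0..h}"
      using integrable_linear[OF intf bounded_linear_inner_left, of p] by (simp add: o_def)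
    have "(y - x) \<bullet> p = integral {0..h} (\<lambda>s. f (?X s) (a s) (b s) \<bullet> p)"
      using traj_eq[OF a b, of h x] h integral_linear[OF intf bounded_linear_inner_left, of p]
      by (simp add: y_def o_def)
    then have "acc \<delta> l x a b h + (y - x) \<bullet> p =
        integral {0..h} (\<lambda>s. exp (- \<delta> * s) * l (?X s) (a s) (b s) + f (?X s) (a s) (b s) \<bullet> p)"
      using int intfp by (simp add: acc_def Henstock_Kurzweil_Integration.integral_add)
    also have "\<dots> \<le> (r + \<theta> / 2) * (h - 0)"
    proof (rule integral_le_const)
      show "(\<lambda>s. exp (- \<delta> * s) * l (?X s) (a s) (b s) + f (?X s) (a s) (b s) \<bullet> p) integrable_on {0..h}"
        by (intro integrable_add int intfp)
      fix s assume s: "s \<in> {0..h}"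
      have ab: "a s \<in> A" "b s \<in> B" using controls_space[OF a] controls_space[OF b] s by auto
      have "f (?X s) (a s) (b s) \<bullet> p - f x (a s) (b s) \<bullet> p = (f (?X s) (a s) (b s) - f x (a s) (b s)) \<bullet> p"
        by (simp add: inner_diff_left)
      also have "\<dots> \<le> norm (f (?X s) (a s) (b s) - f x (a s) (b s)) * norm p" by (rule norm_cauchy_schwarz)
      also have "\<dots> \<le> (L * (M * h)) * norm p"
        using lipschitz_f[OF ab, of "?X s" x] mult_left_mono[OF speed[OF s] L_nonneg] by (intro mult_right_mono) auto
      also have "\<dots> = (norm p * L * M) * h" by (simp add: ac_simps)
      also have "\<dots> \<le> \<theta> / 6" by (rule hK[OF K(1)])
      finally have 1: "f (?X s) (a s) (b s) \<bullet> p \<le> f x (a s) (b s) \<bullet> p + \<theta> / 6" by simp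
      have "norm (?X s - x) < d4" using speed[OF s] hd d(5) by simp
      then have 2: "\<bar>l (?X s) (a s) (b s) - l x (a s) (b s)\<bar> < \<theta> / 6" using d4(2) ab by blast
      have e: "exp (- \<delta> * s) \<le> 1" "1 - exp (- \<delta> * s) \<le> \<delta> * s"
        using exp_ge_add_one_self[of "- \<delta> * s"] s \<delta> by auto
      have "\<bar>exp (- \<delta> * s) * l (?X s) (a s) (b s) - l (?X s) (a s) (b s)\<bar> = (1 - exp (- \<delta> * s)) * \<bar>l (?X s) (a s) (b s)\<bar>"
      proof -
        have "exp (- \<delta> * s) * l (?X s) (a s) (b s) - l (?X s) (a s) (b s) = - ((1 - exp (- \<delta> * s)) * l (?X s) (a s) (b s))"
          by (simp add: algebra_simps)
        then show ?thesis using e(1) by (simp add: abs_mult)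
      qed
      also have "\<dots> \<le> (\<delta> * h) * C"
      proof (rule mult_mono)
        have "\<delta> * s \<le> \<delta> * h" using s \<delta> by (intro mult_left_mono) auto
        then show "1 - exp (- \<delta> * s) \<le> \<delta> * h" using e(2) by linarith
        show "\<bar>l (?X s) (a s) (b s)\<bar> \<le> C" using C ab by blast
      qed (use \<delta> h in auto)
      also have "\<dots> = (\<delta> * C) * h" by simp
      also have "\<dots> \<le> \<theta> / 6" by (rule hK[OF K(2)])
      finally have 3: "exp (- \<delta> * s) * l (?X s) (a s) (b s) \<le> l (?X s) (a s) (b s) + \<theta> / 6" by linarith
      have "f x (a s) (b s) \<bullet> p + l x (a s) (b s) \<le> r" using r s by auto
      with 1 2 3 show "exp (- \<delta> * s) * l (?X s) (a s) (b s) + f (?X s) (a s) (b s) \<bullet> p \<le> r + \<theta> / 2"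
        by linarith
    qed (use h in simp)
    finally have A1: "acc \<delta> l x a b h + (y - x) \<bullet> p \<le> (r + \<theta> / 2) * h" by simp
    have "v y \<le> v x + (\<phi> y - \<phi> x)" using d2(2)[of y] yd d by (simp add: dist_norm)
    moreover have "\<phi> y - \<phi> x \<le> (y - x) \<bullet> p + \<eta> * norm (y - x)" using d1(2)[of y] yd d by linarith
    moreover have "\<eta> * norm (y - x) \<le> \<theta> / 6 * h"
    proof -
      have "\<eta> * norm (y - x) \<le> \<eta> * ((M + 1) * h)" using yd(2) \<eta> h by (intro mult_left_mono) (auto simp: algebra_simps)
      also have "\<dots> = \<eta> * (M + 1) * h" by simp
      also have "\<eta> * (M + 1) = \<theta> / 6" by (rule iffD1[OF nonzero_eq_divide_eq \<eta>_def]) (use M1 in simp)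
      finally show ?thesis .
    qed
    ultimately have A2: "v y \<le> v x + (y - x) \<bullet> p + \<theta> / 6 * h" by linarith
    have vy: "\<bar>v y - v x\<bar> < \<theta> / (6 * \<delta>)" using d3(2)[of y] yd d by (simp add: dist_norm)
    then have vV: "\<bar>v y\<bar> \<le> V" by (simp add: V_def)
    define \<rho> where "\<rho> = exp (- (\<delta> * h)) - (1 - \<delta> * h)"
    have \<rho>: "0 \<le> \<rho>" "\<rho> \<le> (\<delta> * h)\<^sup>2"
      using exp_ge_add_one_self[of "- (\<delta> * h)"] exp_minus_le_quadratic[of "\<delta> * h"] \<delta> h by (auto simp: \<rho>_def)
    have "\<rho> * v y \<le> \<rho> * V" using vV \<rho>(1) by (intro mult_left_mono) auto
    also have "\<dots> \<le> (\<delta> * h)\<^sup>2 * V" using \<rho>(2) V by (intro mult_right_mono)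
    also have "\<dots> = (\<delta>\<^sup>2 * V * h) * h" by (simp add: power2_eq_square)
    also have "\<dots> \<le> \<theta> / 6 * h" using hK[OF K(3)] h by (intro mult_right_mono) auto
    finally have A3: "\<rho> * v y \<le> \<theta> / 6 * h" .
    have "\<delta> * h * (v x - v y) \<le> \<delta> * h * (\<theta> / (6 * \<delta>))" using vy \<delta> h by (intro mult_left_mono) auto
    also have "\<dots> = \<theta> / 6 * h" using \<delta> by simp
    finally have A4: "\<delta> * h * (v x - v y) \<le> \<theta> / 6 * h" .
    have "exp (- \<delta> * h) * v y = v y - \<delta> * h * v x + \<delta> * h * (v x - v y) + \<rho> * v y"
      by (simp add: \<rho>_def algebra_simps)
    then have "acc \<delta> l x a b h + exp (- \<delta> * h) * v y \<le> v x + (r + \<theta> / 2) * h - \<delta> * h * v x + \<theta> / 2 * h"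
      using A1 A2 A3 A4 by (simp add: algebra_simps)
    then show "acc \<delta> l x a b h + exp (- \<delta> * h) * v (traj x a b h) \<le> v x + (r - \<delta> * v x) * h + \<theta> * h"
      by (simp add: y_def algebra_simps)
  qed
qed

lemma inner_rate_continuous:
  assumes l: "running_payoff l"
  shows "continuous_on (A \<times> B) (\<lambda>(a, b). f y a b \<bullet> p + l y a b)"
proof -
  have "continuous_on (A \<times> B) (\<lambda>q. (\<lambda>(x, a, b). f x a b) (y, q))"
    by (rule continuous_on_compose2[OF continuous_f]) (auto intro!: continuous_intros)
  moreover have "continuous_on (A \<times> B) (\<lambda>q. (\<lambda>(x, a, b). l x a b) (y, q))"
    by (rule continuous_on_compose2[OF payoff_continuous[OF l]]) (auto intro!: continuous_intros)
  ultimately have "continuous_on (A \<times> B) (\<lambda>q. (\<lambda>(x, a, b). f x a b) (y, q) \<bullet> p + (\<lambda>(x, a, b). l x a b) (y, q))"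
    by (intro continuous_intros)
  then show ?thesis by (simp add: case_prod_unfold)
qed

text \<open>
  If the inequality failed, player 1 could reply to player 2 at rate below \<open>\<delta> v x\<close> during a short
  time and then switch to a nearly optimal strategy from the state reached. This would guarantee
  less than the value.
\<close>

lemma value_subsolution:
  assumes l: "running_payoff l" and \<delta>: "0 < \<delta>"
  shows "viscosity_subsolution (\<lambda>x r p. \<delta> * r + hamiltonian A B f l x p) (lval \<delta> l)"
  unfolding viscosity_subsolution_def
proof (intro allI impI, elim conjE)
  fix \<phi> D\<phi> x assume C1: "C1_gradient \<phi> D\<phi>" and max: "\<forall>\<^sub>F y in nhds x. lval \<delta> l y - \<phi> y \<le> lval \<delta> l x - \<phi> x"
  let ?v = "lval \<delta> l" and ?p = "D\<phi> x"
  show "\<delta> * ?v x + hamiltonian A B f l x ?p \<le> 0"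
  proof (rule ccontr)
    assume "\<not> ?thesis"
    define c where "c = \<delta> * ?v x + hamiltonian A B f l x ?p"
    have c: "0 < c" using \<open>\<not> _\<close> by (simp add: c_def)
    have "c - \<delta> * ?v x \<le> hamiltonian A B f l x ?p" by (simp add: c_def)
    then have "\<exists>a\<in>A. f x a b \<bullet> ?p + l x a b \<le> c / 4 - (c - \<delta> * ?v x)" if "b \<in> B" for b
      using that c unfolding hamiltonian_ge_iff[OF l] by (meson divide_pos_pos zero_less_numeral)
    from response_strategy[OF inner_rate_continuous[OF l] this, of "c / 4"]
    obtain \<sigma> where \<sigma>: "\<sigma> \<in> strats"
      "\<And>b s. b \<in> controls B \<Longrightarrow> 0 \<le> s \<Longrightarrow> f x (\<sigma> b s) (b s) \<bullet> ?p + l x (\<sigma> b s) (b s) \<le> c / 4 - (c - \<delta> * ?v x) + c / 4"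
      using c by (metis divide_pos_pos zero_less_numeral)
    have D: "GDERIV \<phi> x :> ?p" using C1 by (simp add: C1_gradient_def)
    have c4: "0 < c / 4" using c by simp
    obtain h where h: "0 < h" and step: "\<forall>a\<in>controls A. \<forall>b\<in>controls B. \<forall>r. (\<forall>s\<ge>0. f x (a s) (b s) \<bullet> ?p + l x (a s) (b s) \<le> r) \<longrightarrow>
        acc \<delta> l x a b h + exp (- \<delta> * h) * ?v (traj x a b h) \<le> ?v x + (r - \<delta> * ?v x) * h + c / 4 * h"
      using value_step[OF l \<delta> value_continuous[OF l \<delta>] D max c4] by blast
    \<comment> \<open>The short step gains \<open>c h / 4\<close>, and half of it pays for near-optimality afterwards.\<close>
    define e where "e = c * h / 8"
    have e: "0 < e" using c h by (simp add: e_def)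
    have "\<forall>y. \<exists>\<alpha>. \<alpha> \<in> strats \<and> (\<forall>b\<in>controls B. discounted_payoff f l \<delta> y (\<alpha> b) b \<le> ?v y + e)"
      using value_near_optimal_strategy[OF l \<delta> e] by blast
    then obtain \<tau> where \<tau>: "\<And>y. \<tau> y \<in> strats" "\<And>y b. b \<in> controls B \<Longrightarrow> discounted_payoff f l \<delta> y (\<tau> y b) b \<le> ?v y + e"
      by (metis (no_types, lifting))
    define \<alpha> where "\<alpha> = (\<lambda>b. join_control h (\<sigma> b) (\<tau> (traj x (\<sigma> b) b h) (shift_control h b)))"
    have \<alpha>: "\<alpha> \<in> strats" unfolding \<alpha>_def by (rule join_strategy[OF \<sigma>(1) \<tau>(1) h])
    have "?v x \<le> ?v x - c * h / 8"
    proof (rule value_le[OF l \<delta> \<alpha>])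
      fix b assume b: "b \<in> controls B"
      define y where "y = traj x (\<sigma> b) b h"
      have \<alpha>b: "\<alpha> b = join_control h (\<sigma> b) (\<tau> y (shift_control h b))" by (simp add: \<alpha>_def y_def)
      note play = join_strategy_play[where \<sigma>=\<sigma> and \<tau>=\<tau>, OF \<sigma>(1) \<tau>(1) h b y_def \<alpha>b]
      have sb: "\<sigma> b \<in> controls A" "shift_control h b \<in> controls B"
        using \<sigma>(1) b h by (auto intro: less_imp_le)
      have "discounted_payoff f l \<delta> x (\<alpha> b) b = acc \<delta> l x (\<sigma> b) b h +
          exp (- \<delta> * h) * discounted_payoff f l \<delta> y (\<tau> y (shift_control h b)) (shift_control h b)"
        using payoff_split[OF l play(1) b \<delta>, of h x] h by (simp add: play y_def)
      also have "\<dots> \<le> acc \<delta> l x (\<sigma> b) b h + exp (- \<delta> * h) * (?v y + e)"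
        using \<tau>(2)[OF sb(2), of y] by simp
      also have "\<dots> \<le> acc \<delta> l x (\<sigma> b) b h + exp (- \<delta> * h) * ?v y + e"
        using \<delta> h e by (simp add: algebra_simps)
      also have "\<dots> \<le> ?v x + ((c / 4 - (c - \<delta> * ?v x) + c / 4) - \<delta> * ?v x) * h + c / 4 * h + e"
        using step sb(1) b \<sigma>(2)[OF b] unfolding y_def by (metis (no_types, lifting) add_right_mono)
      also have "\<dots> = ?v x - c * h / 8" by (simp add: e_def field_simps)
      finally show "discounted_payoff f l \<delta> x (\<alpha> b) b \<le> ?v x - c * h / 8" .
    qed
    then show False using c h by (simp add: field_simps mult_le_0_iff)
  qed
qed

lemma acc_minus: "acc \<delta> (\<lambda>x a b. - l x a b) x a b t = - acc \<delta> l x a b t"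
  by (simp add: acc_def)

text \<open>
  If the inequality failed, one action of player 2 held constant during a short time would earn at
  a rate above \<open>\<delta> v x\<close> against everything, and a nearly optimal continuation would exceed the value.
\<close>

lemma value_supersolution:
  assumes l: "running_payoff l" and \<delta>: "0 < \<delta>"
  shows "viscosity_supersolution (\<lambda>x r p. \<delta> * r + hamiltonian A B f l x p) (lval \<delta> l)"
  unfolding viscosity_supersolution_def
proof (intro allI impI, elim conjE)
  fix \<phi> D\<phi> x assume C1: "C1_gradient \<phi> D\<phi>" and min: "\<forall>\<^sub>F y in nhds x. lval \<delta> l x - \<phi> x \<le> lval \<delta> l y - \<phi> y"
  let ?v = "lval \<delta> l" and ?p = "D\<phi> x"
  show "0 \<le> \<delta> * ?v x + hamiltonian A B f l x ?p"
  proof (rule ccontr)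
    assume "\<not> ?thesis"
    define c where "c = - (\<delta> * ?v x + hamiltonian A B f l x ?p)"
    have c: "0 < c" using \<open>\<not> _\<close> by (simp add: c_def)
    have c2: "0 < c / 2" using c by simp
    have "hamiltonian A B f l x ?p \<le> - c - \<delta> * ?v x" by (simp add: c_def)
    then obtain \<beta> where \<beta>: "\<beta> \<in> B" "\<And>a. a \<in> A \<Longrightarrow> - (- c - \<delta> * ?v x) - c / 2 \<le> f x a \<beta> \<bullet> ?p + l x a \<beta>"
      using c2 unfolding hamiltonian_le_iff[OF l] by blast
    have D: "GDERIV (\<lambda>x. - \<phi> x) x :> - ?p"
      using C1 has_derivative_minus[of \<phi> "\<lambda>h. h \<bullet> ?p" "at x"] by (simp add: C1_gradient_def gderiv_def)
    have c4: "0 < c / 4" using c by simp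
    have max: "\<forall>\<^sub>F y in nhds x. - ?v y - - \<phi> y \<le> - ?v x - - \<phi> x"
      using min by eventually_elim simp
    obtain h where h: "0 < h" and step: "\<forall>a\<in>controls A. \<forall>b\<in>controls B. \<forall>r. (\<forall>s\<ge>0. f x (a s) (b s) \<bullet> (- ?p) + - l x (a s) (b s) \<le> r) \<longrightarrow>
        acc \<delta> (\<lambda>x a b. - l x a b) x a b h + exp (- \<delta> * h) * (- ?v (traj x a b h)) \<le> - ?v x + (r - \<delta> * (- ?v x)) * h + c / 4 * h"
      using value_step[OF payoff_minus[OF l] \<delta> continuous_on_minus[OF value_continuous[OF l \<delta>]] D max c4] by blast
    \<comment> \<open>The short step gains \<open>c h / 4\<close>, and half of it pays for near-optimality afterwards.\<close>
    define e where "e = c * h / 8"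
    have e: "0 < e" using c h by (simp add: e_def)
    define b0 where "b0 = restrict (\<lambda>t::real. \<beta>) {0..}"
    have b0: "b0 \<in> controls B" unfolding b0_def by (rule constant_control[OF \<beta>(1)])
    have "?v x + c * h / 8 \<le> ?v x"
    proof (rule value_ge[OF l \<delta>])
      fix \<alpha> assume \<alpha>: "\<alpha> \<in> strats"
      define y where "y = traj x (\<alpha> b0) b0 h"
      define \<alpha>' where "\<alpha>' = (\<lambda>b. shift_control h (\<alpha> (join_control h b0 b)))"
      have \<alpha>': "\<alpha>' \<in> strats" unfolding \<alpha>'_def by (rule tail_strategy[OF \<alpha> b0 h])
      obtain b1 where b1: "b1 \<in> controls B" "?v y - e \<le> discounted_payoff f l \<delta> y (\<alpha>' b1) b1"
        using value_near_optimal_control[OF l \<delta> e \<alpha>'] by blast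
      define b where "b = join_control h b0 b1"
      note play = join_control_play[OF \<alpha> b0 b1(1) h b_def]
      have ab: "\<alpha> b \<in> controls A" "\<alpha> b0 \<in> controls A" using \<alpha> play(1) b0 by auto
      have sha: "shift_control h (\<alpha> b) = \<alpha>' b1" by (simp add: \<alpha>'_def b_def)
      have "\<forall>s\<ge>0. f x (\<alpha> b0 s) (b0 s) \<bullet> (- ?p) + - l x (\<alpha> b0 s) (b0 s) \<le> (- c - \<delta> * ?v x) + c / 2"
      proof (intro allI impI)
        fix s :: real assume s: "0 \<le> s"
        then have "b0 s = \<beta>" by (simp add: b0_def)
        then show "f x (\<alpha> b0 s) (b0 s) \<bullet> (- ?p) + - l x (\<alpha> b0 s) (b0 s) \<le> (- c - \<delta> * ?v x) + c / 2"
          using \<beta>(2)[OF controls_space[OF ab(2) s]] by simp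
      qed
      then have "acc \<delta> (\<lambda>x a b. - l x a b) x (\<alpha> b0) b0 h + exp (- \<delta> * h) * (- ?v (traj x (\<alpha> b0) b0 h)) \<le>
          - ?v x + (((- c - \<delta> * ?v x) + c / 2) - \<delta> * (- ?v x)) * h + c / 4 * h"
        using step ab(2) b0 by blast
      then have st: "?v x + c * h / 4 \<le> acc \<delta> l x (\<alpha> b0) b0 h + exp (- \<delta> * h) * ?v y"
        unfolding acc_minus y_def[symmetric] by (simp add: field_simps)
      have "discounted_payoff f l \<delta> x (\<alpha> b) b = acc \<delta> l x (\<alpha> b0) b0 h + exp (- \<delta> * h) * discounted_payoff f l \<delta> y (\<alpha>' b1) b1"
        using payoff_split[OF l ab(1) play(1) \<delta>, of h x] h by (simp add: play sha y_def)
      moreover have "exp (- \<delta> * h) * (?v y - e) \<le> exp (- \<delta> * h) * discounted_payoff f l \<delta> y (\<alpha>' b1) b1"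
        using b1(2) by simp
      moreover have "exp (- \<delta> * h) * (?v y - e) \<ge> exp (- \<delta> * h) * ?v y - e"
        using \<delta> h e by (simp add: algebra_simps)
      ultimately have "?v x + c * h / 8 \<le> discounted_payoff f l \<delta> x (\<alpha> b) b"
        using st unfolding e_def by linarith
      then show "\<exists>b\<in>controls B. ?v x + c * h / 8 \<le> discounted_payoff f l \<delta> x (\<alpha> b) b" using play(1) by blast
    qed
    then show False using c h by (simp add: field_simps mult_le_0_iff)
  qed
qed

section \<open>Moreau envelopes and aiming strategies\<close>

text \<open>
  Outside the ball of radius \<open>R\<close> the quadratic term exceeds the oscillation of \<open>w\<close>.
\<close>

lemma proximal_point_exists:
  fixes w :: "real^'n \<Rightarrow> real"
  assumes w: "continuous_on UNIV w" and W: "\<And>x. \<bar>w x\<bar> \<le> W" and c: "0 < c"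
  shows "\<exists>y. \<forall>z. w y + c / 2 * (norm (x - y))\<^sup>2 \<le> w z + c / 2 * (norm (x - z))\<^sup>2"
proof -
  have W0: "0 \<le> W" using W[of 0] by linarith
  define R where "R = 4 * W / c + 1"
  have R: "1 \<le> R" "0 \<le> R" using W0 c by (auto simp: R_def)
  have "continuous_on (cball x R) (\<lambda>z. w z + c / 2 * (norm (x - z))\<^sup>2)"
    by (intro continuous_intros continuous_on_subset[OF w]) auto
  then obtain y where y: "y \<in> cball x R" "\<forall>z\<in>cball x R. w y + c / 2 * (norm (x - y))\<^sup>2 \<le> w z + c / 2 * (norm (x - z))\<^sup>2"
    using continuous_attains_inf[of "cball x R" "\<lambda>z. w z + c / 2 * (norm (x - z))\<^sup>2"] R by auto
  have "w y + c / 2 * (norm (x - y))\<^sup>2 \<le> w z + c / 2 * (norm (x - z))\<^sup>2" for z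
  proof (cases "z \<in> cball x R")
    case False
    then have "R < norm (x - z)" by (simp add: dist_norm)
    then have "R * R \<le> norm (x - z) * norm (x - z)" using R by (intro mult_mono) auto
    moreover have "R * 1 \<le> R * R" using R by (intro mult_left_mono) auto
    ultimately have "4 * W / c \<le> (norm (x - z))\<^sup>2" by (simp add: R_def power2_eq_square)
    then have "2 * W \<le> c / 2 * (norm (x - z))\<^sup>2" using c by (simp add: field_simps)
    moreover have "w y + c / 2 * (norm (x - y))\<^sup>2 \<le> w x" using bspec[OF y(2), of x] R by simp
    ultimately show ?thesis using W[of x] W[of z] by linarith
  qed (use y in auto)
  then show ?thesis by blast
qed

definition prox :: "real \<Rightarrow> (real^'n \<Rightarrow> real) \<Rightarrow> real^'n \<Rightarrow> real^'n" where
  "prox c w x = (SOME y. \<forall>z. w y + c / 2 * (norm (x - y))\<^sup>2 \<le> w z + c / 2 * (norm (x - z))\<^sup>2)"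

definition moreau :: "real \<Rightarrow> (real^'n \<Rightarrow> real) \<Rightarrow> real^'n \<Rightarrow> real" where
  "moreau c w x = w (prox c w x) + c / 2 * (norm (x - prox c w x))\<^sup>2"

lemma moreau_le:
  assumes "continuous_on UNIV w" "lattice_periodic w" "0 < c"
  shows "moreau c w x \<le> w z + c / 2 * (norm (x - z))\<^sup>2"
proof -
  obtain W where W: "\<forall>x. \<bar>w x\<bar> \<le> W" using periodic_bounded[OF assms(1,2)] by blast
  from someI_ex[OF proximal_point_exists[OF assms(1) W[rule_format] assms(3), of x]] show ?thesis
    unfolding moreau_def prox_def by blast
qed

text \<open>
  The proximal point \<open>y\<close> of \<open>x\<close> satisfies \<open>c |x - y|\<^sup>2 \<le> 2 (w x - w y)\<close>, and the right-hand side
  tends to 0 as \<open>c\<close> grows, by uniform continuity of \<open>w\<close>. This is why the error \<open>L |x - y| |p|\<close>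
  caused by testing the dynamics at \<open>y\<close> instead of \<open>x\<close> is small although \<open>|p| = c |x - y|\<close> need not be
  bounded. First \<open>c\<close> is fixed, and then a step length \<open>h\<close>; both work for all states. The lemma is
  applied to \<open>w\<close> and \<open>l\<close> for player 1, and to \<open>- w\<close> and \<open>- l\<close> for player 2.
\<close>

lemma aiming_step:
  assumes l: "running_payoff l" and w: "continuous_on UNIV w" "lattice_periodic w" and e: "0 < e"
  shows "\<exists>c>0. \<exists>h>0. (\<forall>x. w x - e \<le> moreau c w x \<and> moreau c w x \<le> w x) \<and>
    (\<forall>x. \<forall>a\<in>controls A. \<forall>b\<in>controls B.
       (\<forall>s\<ge>0. f (prox c w x) (a s) (b s) \<bullet> (c *\<^sub>R (x - prox c w x)) + l (prox c w x) (a s) (b s) \<le> e) \<longrightarrow>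
       (\<forall>t\<in>{0..h}. moreau c w (traj x a b t) + acc 0 l x a b t \<le> moreau c w x + 4 * e * t))"
proof -
  obtain W where W: "\<forall>x. \<bar>w x\<bar> \<le> W" using periodic_bounded[OF w] by blast
  have W0: "0 \<le> W" using W[rule_format, of 0] by linarith
  \<comment> \<open>Chosen such that \<open>L c |x - y|\<^sup>2 \<le> 2 L e' \<le> e / 2\<close>.\<close>
  define e' where "e' = min e (e / (4 * (L + 1)))"
  have e': "0 < e'" "e' \<le> e" "L * (2 * e') \<le> e / 2"
  proof -
    show "0 < e'" "e' \<le> e" using e L_nonneg by (auto simp: e'_def)
    have "e' \<le> e / (4 * (L + 1))" by (simp add: e'_def)
    then have "e' * (4 * (L + 1)) \<le> e" using L_nonneg by (simp add: le_divide_eq)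
    then show "L * (2 * e') \<le> e / 2" using \<open>0 < e'\<close> by (simp add: algebra_simps)
  qed
  obtain d1 where d1: "0 < d1" "\<And>x y. norm (x - y) < d1 \<Longrightarrow> \<bar>w x - w y\<bar> < e'"
    using periodic_uniformly_continuous[OF w e'(1)] by blast
  obtain d2 where d2: "0 < d2" "\<And>x y a b. norm (x - y) < d2 \<Longrightarrow> a \<in> A \<Longrightarrow> b \<in> B \<Longrightarrow> \<bar>l x a b - l y a b\<bar> < e"
    using payoff_uniform[OF l e] by blast
  define \<rho> where "\<rho> = min d1 (d2 / 2)"
  have \<rho>: "0 < \<rho>" "\<rho> \<le> d1" "\<rho> \<le> d2 / 2" using d1 d2 by (auto simp: \<rho>_def)
  \<comment> \<open>Forces proximal points to lie within \<open>\<rho>\<close>, since \<open>c |x - y|\<^sup>2\<close> is at most twice the oscillation of \<open>w\<close>.\<close>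
  define c where "c = 4 * W / \<rho>\<^sup>2 + 1"
  have c: "0 < c" using W0 \<rho> by (simp add: c_def add_nonneg_pos)
  have c\<rho>: "4 * W < c * \<rho>\<^sup>2" using \<rho>(1) by (simp add: c_def field_simps)
  define K where "K = L * M * c * \<rho> + c * M\<^sup>2 + 1"
  have K: "L * M * c * \<rho> \<le> K" "c * M\<^sup>2 \<le> K" "0 < K"
    using L_nonneg M_nonneg c \<rho> by (auto simp: K_def add_nonneg_pos add_increasing)
  define h where "h = min (d2 / (2 * (M + 1))) (e / (2 * K))"
  have h: "0 < h" using d2 e K M_nonneg by (simp add: h_def)
  have hd: "M * h \<le> d2 / 2"
  proof -
    have "h \<le> d2 / (2 * (M + 1))" by (simp add: h_def)
    then have "h * (2 * (M + 1)) \<le> d2" using M_nonneg by (simp add: le_divide_eq)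
    then show ?thesis using h by (simp add: algebra_simps)
  qed
  have hK: "K' * h \<le> e / 2" if "K' \<le> K" for K'
  proof -
    have "h \<le> e / (2 * K)" by (simp add: h_def)
    then have "K * h \<le> e / 2" using K(3) by (simp add: field_simps)
    moreover have "K' * h \<le> K * h" using that h by simp
    ultimately show ?thesis by linarith
  qed
  have near: "norm (x - prox c w x) < \<rho>" "c * (norm (x - prox c w x))\<^sup>2 \<le> 2 * e'" "\<bar>w x - w (prox c w x)\<bar> < e'" for x
  proof -
    let ?y = "prox c w x"
    have le: "w ?y + c / 2 * (norm (x - ?y))\<^sup>2 \<le> w x"
      using moreau_le[OF w c, of x x] by (simp add: moreau_def)
    have "c * (norm (x - ?y))\<^sup>2 \<le> 4 * W"
      using le W[rule_format, of x] W[rule_format, of ?y] by linarith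
    then have "c * (norm (x - ?y))\<^sup>2 < c * \<rho>\<^sup>2" using c\<rho> by linarith
    then have near: "norm (x - ?y) < \<rho>" using c \<rho>(1) by (simp add: power2_less_imp_less)
    then have wy: "\<bar>w x - w ?y\<bar> < e'" using d1(2)[of x ?y] \<rho>(2) by linarith
    have "c * (norm (x - ?y))\<^sup>2 \<le> 2 * e'" using le wy by linarith
    with near wy show "norm (x - ?y) < \<rho>" "c * (norm (x - ?y))\<^sup>2 \<le> 2 * e'" "\<bar>w x - w ?y\<bar> < e'" by auto
  qed
  show ?thesis
  proof (rule exI[of _ c], rule conjI[OF c], rule exI[of _ h], intro conjI allI ballI impI)
    show "0 < h" by (fact h)
    fix x
    show "moreau c w x \<le> w x" using moreau_le[OF w c, of x x] by simp
    have "0 \<le> c / 2 * (norm (x - prox c w x))\<^sup>2" using c by simp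
    then show "w x - e \<le> moreau c w x"
      using near(3)[of x] e'(2) unfolding moreau_def by linarith
  next
    fix x a b t
    assume a: "a \<in> controls A" and b: "b \<in> controls B" and t: "t \<in> {0..h}"
      and aim: "\<forall>s\<ge>0. f (prox c w x) (a s) (b s) \<bullet> (c *\<^sub>R (x - prox c w x)) + l (prox c w x) (a s) (b s) \<le> e"
    let ?y = "prox c w x" and ?X = "traj x a b"
    define p where "p = c *\<^sub>R (x - ?y)"
    have t0: "0 \<le> t" "t \<le> h" using t by auto
    have speed: "norm (?X s - x) \<le> M * h" if "s \<in> {0..h}" for s
      using traj_speed[OF a b, of s x] that M_nonneg by (auto intro: order_trans mult_left_mono)
    have intl: "(\<lambda>s. l (?X s) (a s) (b s)) integrable_on {0..t}"
      using rate_integrable[OF l a b] by simp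
    have intf: "(\<lambda>s. f (?X s) (a s) (b s)) integrable_on {0..t}"
      using velocity_integrable[OF traj_continuous[OF a b] a b] by simp
    have intfp: "(\<lambda>s. f (?X s) (a s) (b s) \<bullet> p) integrable_on {0..t}"
      using integrable_linear[OF intf bounded_linear_inner_left, of p] by (simp add: o_def)
    have "(?X t - x) \<bullet> p = integral {0..t} (\<lambda>s. f (?X s) (a s) (b s) \<bullet> p)"
      using traj_eq[OF a b t0(1), of x] integral_linear[OF intf bounded_linear_inner_left, of p]
      by (simp add: o_def)
    then have "acc 0 l x a b t + (?X t - x) \<bullet> p =
        integral {0..t} (\<lambda>s. l (?X s) (a s) (b s) + f (?X s) (a s) (b s) \<bullet> p)"
      using intl intfp by (simp add: acc_def Henstock_Kurzweil_Integration.integral_add)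
    also have "\<dots> \<le> 3 * e * (t - 0)"
    proof (rule integral_le_const)
      show "(\<lambda>s. l (?X s) (a s) (b s) + f (?X s) (a s) (b s) \<bullet> p) integrable_on {0..t}"
        by (intro integrable_add intl intfp)
      fix s assume s: "s \<in> {0..t}"
      then have sh: "s \<in> {0..h}" using t0 by auto
      have ab: "a s \<in> A" "b s \<in> B" using controls_space[OF a] controls_space[OF b] s by auto
      have dist: "norm (?X s - ?y) \<le> norm (x - ?y) + M * h"
        using norm_triangle_ineq[of "?X s - x" "x - ?y"] speed[OF sh] by simp
      have np: "norm p = c * norm (x - ?y)" using c by (simp add: p_def)
      have "f (?X s) (a s) (b s) \<bullet> p - f ?y (a s) (b s) \<bullet> p = (f (?X s) (a s) (b s) - f ?y (a s) (b s)) \<bullet> p"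
        by (simp add: inner_diff_left)
      also have "\<dots> \<le> norm (f (?X s) (a s) (b s) - f ?y (a s) (b s)) * norm p" by (rule norm_cauchy_schwarz)
      also have "\<dots> \<le> (L * (norm (x - ?y) + M * h)) * norm p"
        using lipschitz_f[OF ab, of "?X s" ?y] mult_left_mono[OF dist L_nonneg] by (intro mult_right_mono) auto
      also have "\<dots> = L * (c * (norm (x - ?y))\<^sup>2) + (L * M * c * norm (x - ?y)) * h"
        by (simp add: np algebra_simps power2_eq_square)
      also have "\<dots> \<le> L * (2 * e') + (L * M * c * \<rho>) * h"
      proof (intro add_mono mult_left_mono mult_right_mono)
        show "norm (x - ?y) \<le> \<rho>" using near(1)[of x] by simp
        show "c * (norm (x - ?y))\<^sup>2 \<le> 2 * e'" by (rule near(2))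
      qed (use L_nonneg M_nonneg c h in auto)
      also have "\<dots> \<le> e" using e'(3) hK[OF K(1)] by linarith
      finally have 1: "f (?X s) (a s) (b s) \<bullet> p \<le> f ?y (a s) (b s) \<bullet> p + e" by simp
      have "norm (?X s - ?y) < d2" using dist near(1)[of x] \<rho>(3) hd by linarith
      then have 2: "\<bar>l (?X s) (a s) (b s) - l ?y (a s) (b s)\<bar> < e" using d2(2) ab by blast
      have "f ?y (a s) (b s) \<bullet> p + l ?y (a s) (b s) \<le> e" using aim s by (simp add: p_def)
      with 1 2 show "l (?X s) (a s) (b s) + f (?X s) (a s) (b s) \<bullet> p \<le> 3 * e" by linarith
    qed (use intl t0 in auto)
    finally have A1: "acc 0 l x a b t + (?X t - x) \<bullet> p \<le> 3 * e * t" by simp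
    have "(norm (?X t - ?y))\<^sup>2 = (norm (x - ?y))\<^sup>2 + 2 * ((?X t - x) \<bullet> (x - ?y)) + (norm (?X t - x))\<^sup>2"
      unfolding power2_norm_eq_inner by (simp add: inner_diff_left inner_diff_right inner_commute)
    moreover have "c / 2 * n = c / 2 * n1 + c * i + c / 2 * n2" if "n = n1 + 2 * i + n2" for n n1 i n2 :: real
      using that by (simp add: algebra_simps)
    ultimately have "c / 2 * (norm (?X t - ?y))\<^sup>2 = c / 2 * (norm (x - ?y))\<^sup>2 + c * ((?X t - x) \<bullet> (x - ?y)) + c / 2 * (norm (?X t - x))\<^sup>2"
      by blast
    moreover have "c * ((?X t - x) \<bullet> (x - ?y)) = (?X t - x) \<bullet> p" by (simp add: p_def)
    ultimately have "c / 2 * (norm (?X t - ?y))\<^sup>2 = c / 2 * (norm (x - ?y))\<^sup>2 + (?X t - x) \<bullet> p + c / 2 * (norm (?X t - x))\<^sup>2"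
      by simp
    then have A2: "moreau c w (?X t) \<le> moreau c w x + (?X t - x) \<bullet> p + c / 2 * (norm (?X t - x))\<^sup>2"
      using moreau_le[OF w c, of "?X t" ?y] unfolding moreau_def[of c w x] by linarith
    have "(norm (?X t - x))\<^sup>2 \<le> (M * t)\<^sup>2" using traj_speed[OF a b t0(1)] by (intro power_mono) auto
    then have "c / 2 * (norm (?X t - x))\<^sup>2 \<le> c / 2 * (M * t)\<^sup>2" using c by simp
    also have "\<dots> = (c * M\<^sup>2) * t / 2 * t" by (simp add: power2_eq_square)
    also have "\<dots> \<le> (c * M\<^sup>2) * h / 2 * t" using c t0 by (intro mult_right_mono divide_right_mono mult_left_mono) auto
    also have "\<dots> \<le> e * t" using hK[OF K(2)] e t0 by (intro mult_right_mono) auto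
    finally show "moreau c w (?X t) + acc 0 l x a b t \<le> moreau c w x + 4 * e * t"
      using A1 A2 by (simp add: algebra_simps)
  qed
qed

subsection \<open>Concatenating one-step guarantees\<close>

text \<open>
  The first step is played from \<open>x\<close>, the remaining \<open>n\<close> steps from the state reached at time \<open>h\<close>.
\<close>

lemma concatenate_strategies:
  assumes l: "running_payoff l" and h: "0 < h"
    and one: "\<And>x. \<exists>\<sigma>\<in>strats. \<forall>b\<in>controls B. \<forall>t\<in>{0..h}. V (traj x (\<sigma> b) b t) + acc 0 l x (\<sigma> b) b t \<le> V x + e * t"
  shows "\<exists>\<alpha>\<in>strats. \<forall>b\<in>controls B. \<forall>t\<in>{0..real n * h}. V (traj x (\<alpha> b) b t) + acc 0 l x (\<alpha> b) b t \<le> V x + e * t"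
proof (induction n arbitrary: x)
  case 0
  obtain a where a: "a \<in> controls A" using controls_A_nonempty .
  show ?case
    by (rule bexI[OF _ constant_strategy[OF a]]) (use a in auto)
next
  case (Suc n)
  obtain \<sigma> where \<sigma>: "\<sigma> \<in> strats" "\<forall>b\<in>controls B. \<forall>t\<in>{0..h}. V (traj x (\<sigma> b) b t) + acc 0 l x (\<sigma> b) b t \<le> V x + e * t"
    using one by blast
  have "\<forall>y. \<exists>\<alpha>. \<alpha> \<in> strats \<and> (\<forall>b\<in>controls B. \<forall>t\<in>{0..real n * h}. V (traj y (\<alpha> b) b t) + acc 0 l y (\<alpha> b) b t \<le> V y + e * t)"
    using Suc.IH by blast
  then obtain \<tau> where \<tau>: "\<And>y. \<tau> y \<in> strats"
    "\<And>y b t. b \<in> controls B \<Longrightarrow> t \<in> {0..real n * h} \<Longrightarrow> V (traj y (\<tau> y b) b t) + acc 0 l y (\<tau> y b) b t \<le> V y + e * t"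
    by (metis (no_types, lifting))
  define \<alpha> where "\<alpha> = (\<lambda>b. join_control h (\<sigma> b) (\<tau> (traj x (\<sigma> b) b h) (shift_control h b)))"
  have \<alpha>: "\<alpha> \<in> strats" unfolding \<alpha>_def by (rule join_strategy[OF \<sigma>(1) \<tau>(1) h])
  show ?case
  proof (rule bexI[OF _ \<alpha>], intro ballI)
    fix b t assume b: "b \<in> controls B" and t: "t \<in> {0..real (Suc n) * h}"
    define y where "y = traj x (\<sigma> b) b h"
    have \<alpha>b: "\<alpha> b = join_control h (\<sigma> b) (\<tau> y (shift_control h b))" by (simp add: \<alpha>_def y_def)
    note play = join_strategy_play[where \<sigma>=\<sigma> and \<tau>=\<tau>, OF \<sigma>(1) \<tau>(1) h b y_def \<alpha>b]
    have h0: "0 \<le> h" using h by simp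
    show "V (traj x (\<alpha> b) b t) + acc 0 l x (\<alpha> b) b t \<le> V x + e * t"
    proof (cases "t \<le> h")
      case True
      then show ?thesis using t \<sigma>(2) b by (simp add: play)
    next
      case False
      define s where "s = t - h"
      have s: "0 \<le> s" "s \<in> {0..real n * h}" "t = h + s" using False t by (auto simp: s_def algebra_simps)
      have "traj x (\<alpha> b) b t = traj y (\<tau> y (shift_control h b)) (shift_control h b) s"
        using traj_shift[OF play(1) b h0 s(1), of x] h by (simp add: s(3) play y_def)
      moreover have "acc 0 l x (\<alpha> b) b t = acc 0 l x (\<sigma> b) b h + acc 0 l y (\<tau> y (shift_control h b)) (shift_control h b) s"
        using acc_split[OF l play(1) b order_refl h0 s(1), of x] h by (simp add: s(3) play y_def)
      moreover have "V y + acc 0 l x (\<sigma> b) b h \<le> V x + e * h" using \<sigma>(2) b h by (auto simp: y_def)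
      moreover have "V (traj y (\<tau> y (shift_control h b)) (shift_control h b) s) + acc 0 l y (\<tau> y (shift_control h b)) (shift_control h b) s \<le> V y + e * s"
        by (rule \<tau>(2)[OF shift_control_in[OF b h0] s(2)])
      ultimately show ?thesis by (simp add: s(3) algebra_simps)
    qed
  qed
qed

text \<open>
  The control of each step is chosen against all reactions of player 1, so the remaining steps can
  be played against what is left of the strategy after time \<open>h\<close>.
\<close>

lemma concatenate_controls:
  assumes l: "running_payoff l" and h: "0 < h"
    and one: "\<And>x. \<exists>b\<in>controls B. \<forall>a\<in>controls A. \<forall>t\<in>{0..h}. V x - e * t \<le> V (traj x a b t) + acc 0 l x a b t"
  shows "\<alpha> \<in> strats \<Longrightarrow> \<exists>b\<in>controls B. \<forall>t\<in>{0..real n * h}. V x - e * t \<le> V (traj x (\<alpha> b) b t) + acc 0 l x (\<alpha> b) b t"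
proof (induction n arbitrary: x \<alpha>)
  case 0
  obtain b where b: "b \<in> controls B" using controls_B_nonempty .
  show ?case
    by (rule bexI[OF _ b]) (use strategy_control[OF 0 b] b in auto)
next
  case (Suc n)
  note \<alpha> = Suc.prems
  obtain b0 where b0: "b0 \<in> controls B" "\<forall>a\<in>controls A. \<forall>t\<in>{0..h}. V x - e * t \<le> V (traj x a b0 t) + acc 0 l x a b0 t"
    using one by blast
  define y where "y = traj x (\<alpha> b0) b0 h"
  define \<alpha>' where "\<alpha>' = (\<lambda>b. shift_control h (\<alpha> (join_control h b0 b)))"
  have \<alpha>': "\<alpha>' \<in> strats" unfolding \<alpha>'_def by (rule tail_strategy[OF \<alpha> b0(1) h])
  obtain b1 where b1: "b1 \<in> controls B" "\<forall>t\<in>{0..real n * h}. V y - e * t \<le> V (traj y (\<alpha>' b1) b1 t) + acc 0 l y (\<alpha>' b1) b1 t"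
    using Suc.IH[OF \<alpha>'] by blast
  define b where "b = join_control h b0 b1"
  have h0: "0 \<le> h" using h by simp
  note play = join_control_play[OF \<alpha> b0(1) b1(1) h b_def]
  have ab: "\<alpha> b \<in> controls A" "\<alpha> b0 \<in> controls A" using \<alpha> play(1) b0(1) by auto
  have sha: "shift_control h (\<alpha> b) = \<alpha>' b1" by (simp add: \<alpha>'_def b_def)
  show ?case
  proof (rule bexI[OF _ play(1)], intro ballI)
    fix t assume t: "t \<in> {0..real (Suc n) * h}"
    show "V x - e * t \<le> V (traj x (\<alpha> b) b t) + acc 0 l x (\<alpha> b) b t"
    proof (cases "t \<le> h")
      case True
      then show ?thesis using t b0(2) ab(2) by (simp add: play)
    next
      case False
      define s where "s = t - h"
      have s: "0 \<le> s" "s \<in> {0..real n * h}" "t = h + s" using False t by (auto simp: s_def algebra_simps)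
      have "traj x (\<alpha> b) b t = traj y (\<alpha>' b1) b1 s"
        using traj_shift[OF ab(1) play(1) h0 s(1), of x] h by (simp add: s(3) sha play y_def)
      moreover have "acc 0 l x (\<alpha> b) b t = acc 0 l x (\<alpha> b0) b0 h + acc 0 l y (\<alpha>' b1) b1 s"
        using acc_split[OF l ab(1) play(1) order_refl h0 s(1), of x] h by (simp add: s(3) sha play y_def)
      moreover have "V x - e * h \<le> V y + acc 0 l x (\<alpha> b0) b0 h" using b0(2) ab(2) h by (auto simp: y_def)
      moreover have "V y - e * s \<le> V (traj y (\<alpha>' b1) b1 s) + acc 0 l y (\<alpha>' b1) b1 s"
        using b1(2) s(2) by blast
      ultimately show ?thesis by (simp add: s(3) algebra_simps)
    qed
  qed
qed

subsection \<open>Guarantees from viscosity inequalities\<close>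

lemma quadratic_C1_gradient:
  fixes x :: "real^'n"
  shows "C1_gradient (\<lambda>z. k / 2 * (norm (x - z))\<^sup>2) (\<lambda>z. k *\<^sub>R (z - x))"
  unfolding C1_gradient_def gderiv_def
proof (intro conjI allI)
  fix z
  have "((\<lambda>z. k / 2 * ((x - z) \<bullet> (x - z))) has_derivative (\<lambda>h. k / 2 * ((x - z) \<bullet> (- h) + (- h) \<bullet> (x - z)))) (at z)"
    by (auto intro!: derivative_eq_intros)
  then show "((\<lambda>z. k / 2 * (norm (x - z))\<^sup>2) has_derivative (\<lambda>h. h \<bullet> (k *\<^sub>R (z - x)))) (at z)"
    unfolding power2_norm_eq_inner
    by (rule has_derivative_eq_rhs) (auto simp: fun_eq_iff inner_commute algebra_simps inner_diff_left inner_diff_right)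
qed (intro continuous_intros)

text \<open>
  The quadratic test function touches \<open>w\<close> from below at the proximal point, with gradient
  \<open>c (x - y)\<close>.
\<close>

lemma supersolution_guarantee:
  assumes l: "running_payoff l" and w: "continuous_on UNIV w" "lattice_periodic w"
    and super: "viscosity_supersolution (\<lambda>x r p. hamiltonian A B f l x p) w"
    and T: "0 \<le> T" and e: "0 < e"
  shows "\<exists>\<alpha>\<in>strats. \<forall>b\<in>controls B. \<forall>t\<in>{0..T}. w (traj x (\<alpha> b) b t) + acc 0 l x (\<alpha> b) b t \<le> w x + e"
proof -
  \<comment> \<open>One \<open>e1\<close> is lost in passing from \<open>w\<close> to its envelope, and \<open>4 e1 T\<close> along the way.\<close>
  define e1 where "e1 = e / (1 + 4 * T)"
  have e1: "0 < e1" "e1 * (1 + 4 * T) = e" "0 < e1 / 2" using e T by (auto simp: e1_def)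
  from aiming_step[OF l w e1(1)] obtain c h where c: "0 < c" and h: "0 < h"
    and near: "\<And>x. w x - e1 \<le> moreau c w x" "\<And>x. moreau c w x \<le> w x"
    and step: "\<And>x a b t. \<lbrakk>a \<in> controls A; b \<in> controls B;
       \<forall>s\<ge>0. f (prox c w x) (a s) (b s) \<bullet> (c *\<^sub>R (x - prox c w x)) + l (prox c w x) (a s) (b s) \<le> e1; t \<in> {0..h}\<rbrakk> \<Longrightarrow>
       moreau c w (traj x a b t) + acc 0 l x a b t \<le> moreau c w x + 4 * e1 * t"
    by blast
  have one: "\<exists>\<sigma>\<in>strats. \<forall>b\<in>controls B. \<forall>t\<in>{0..h}. moreau c w (traj x (\<sigma> b) b t) + acc 0 l x (\<sigma> b) b t \<le> moreau c w x + (4 * e1) * t" for x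
  proof -
    let ?y = "prox c w x" and ?p = "c *\<^sub>R (x - prox c w x)"
    have "w ?y - - c / 2 * (norm (x - ?y))\<^sup>2 \<le> w z - - c / 2 * (norm (x - z))\<^sup>2" for z
      using moreau_le[OF w c, of x z] by (simp add: moreau_def)
    then have "0 \<le> hamiltonian A B f l ?y ((- c) *\<^sub>R (?y - x))"
      using super quadratic_C1_gradient[of "- c" x] unfolding viscosity_supersolution_def
      by (meson always_eventually)
    moreover have "(- c) *\<^sub>R (?y - x) = ?p" by (simp add: algebra_simps)
    ultimately have "0 \<le> hamiltonian A B f l ?y ?p" by simp
    then have H: "\<forall>b\<in>B. \<forall>e>0. \<exists>a\<in>A. f ?y a b \<bullet> ?p + l ?y a b \<le> e - 0"
      unfolding hamiltonian_ge_iff[OF l] .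
    have "\<exists>a\<in>A. f ?y a b \<bullet> ?p + l ?y a b \<le> e1 / 2" if "b \<in> B" for b
      using H[rule_format, OF that e1(3)] by simp
    from response_strategy[OF inner_rate_continuous[OF l] this e1(3)]
    obtain \<sigma> where \<sigma>: "\<sigma> \<in> strats" "\<And>b s. b \<in> controls B \<Longrightarrow> 0 \<le> s \<Longrightarrow> f ?y (\<sigma> b s) (b s) \<bullet> ?p + l ?y (\<sigma> b s) (b s) \<le> e1 / 2 + e1 / 2"
      by metis
    show ?thesis
    proof (rule bexI[OF _ \<sigma>(1)], intro ballI)
      fix b t assume b: "b \<in> controls B" and t: "t \<in> {0..h}"
      show "moreau c w (traj x (\<sigma> b) b t) + acc 0 l x (\<sigma> b) b t \<le> moreau c w x + (4 * e1) * t"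
        by (rule step[OF strategy_control[OF \<sigma>(1) b] b _ t]) (use \<sigma>(2)[OF b] in simp)
    qed
  qed
  obtain n where n: "T / h \<le> real n" using real_arch_simple by blast
  then have nT: "T \<le> real n * h" using h by (simp add: divide_le_eq)
  from concatenate_strategies[OF l h one, of n x] obtain \<alpha> where \<alpha>: "\<alpha> \<in> strats"
    "\<And>b t. b \<in> controls B \<Longrightarrow> t \<in> {0..real n * h} \<Longrightarrow> moreau c w (traj x (\<alpha> b) b t) + acc 0 l x (\<alpha> b) b t \<le> moreau c w x + (4 * e1) * t"
    by blast
  show ?thesis
  proof (rule bexI[OF _ \<alpha>(1)], intro ballI)
    fix b t assume b: "b \<in> controls B" and t: "t \<in> {0..T}"
    have "4 * e1 * t \<le> 4 * e1 * T" using t e1(1) by (intro mult_left_mono) auto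
    moreover have "moreau c w (traj x (\<alpha> b) b t) + acc 0 l x (\<alpha> b) b t \<le> moreau c w x + (4 * e1) * t"
      by (rule \<alpha>(2)[OF b]) (use t nT in auto)
    ultimately show "w (traj x (\<alpha> b) b t) + acc 0 l x (\<alpha> b) b t \<le> w x + e"
      using near(1)[of "traj x (\<alpha> b) b t"] near(2)[of x] e1(2) by (simp add: algebra_simps)
  qed
qed

text \<open>
  Player 2 holds an action constant during each step. With \<open>- w\<close> and \<open>- l\<close> in the aiming lemma, the
  quadratic test function touches \<open>w\<close> from above at the proximal point.
\<close>

lemma subsolution_guarantee:
  assumes l: "running_payoff l" and w: "continuous_on UNIV w" "lattice_periodic w"
    and sub: "viscosity_subsolution (\<lambda>x r p. hamiltonian A B f l x p) w"
    and T: "0 \<le> T" and e: "0 < e" and \<alpha>: "\<alpha> \<in> strats"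
  shows "\<exists>b\<in>controls B. \<forall>t\<in>{0..T}. w x - e \<le> w (traj x (\<alpha> b) b t) + acc 0 l x (\<alpha> b) b t"
proof -
  \<comment> \<open>One \<open>e1\<close> is lost in passing from \<open>w\<close> to its envelope, and \<open>4 e1 T\<close> along the way.\<close>
  define e1 where "e1 = e / (1 + 4 * T)"
  have e1: "0 < e1" "e1 * (1 + 4 * T) = e" using e T by (auto simp: e1_def)
  let ?w = "\<lambda>x. - w x"
  have w': "continuous_on UNIV ?w" "lattice_periodic ?w"
    using w by (auto simp: lattice_periodic_def intro: continuous_intros)
  from aiming_step[OF payoff_minus[OF l] w' e1(1)] obtain c h where c: "0 < c" and h: "0 < h"
    and near: "\<And>x. - w x - e1 \<le> moreau c ?w x" "\<And>x. moreau c ?w x \<le> - w x"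
    and step: "\<And>x a b t. \<lbrakk>a \<in> controls A; b \<in> controls B;
       \<forall>s\<ge>0. f (prox c ?w x) (a s) (b s) \<bullet> (c *\<^sub>R (x - prox c ?w x)) + - l (prox c ?w x) (a s) (b s) \<le> e1; t \<in> {0..h}\<rbrakk> \<Longrightarrow>
       moreau c ?w (traj x a b t) + acc 0 (\<lambda>x a b. - l x a b) x a b t \<le> moreau c ?w x + 4 * e1 * t"
    by blast
  have one: "\<exists>b\<in>controls B. \<forall>a\<in>controls A. \<forall>t\<in>{0..h}. - moreau c ?w x - (4 * e1) * t \<le> - moreau c ?w (traj x a b t) + acc 0 l x a b t" for x
  proof -
    let ?y = "prox c ?w x"
    have "w z - c / 2 * (norm (x - z))\<^sup>2 \<le> w ?y - c / 2 * (norm (x - ?y))\<^sup>2" for z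
      using moreau_le[OF w' c, of x z] by (simp add: moreau_def)
    then have "hamiltonian A B f l ?y (c *\<^sub>R (?y - x)) \<le> 0"
      using sub quadratic_C1_gradient[of c x] unfolding viscosity_subsolution_def
      by (meson always_eventually)
    then obtain \<beta> where \<beta>: "\<beta> \<in> B" "\<And>a. a \<in> A \<Longrightarrow> - 0 - e1 \<le> f ?y a \<beta> \<bullet> (c *\<^sub>R (?y - x)) + l ?y a \<beta>"
      using e1(1) unfolding hamiltonian_le_iff[OF l] by blast
    define b where "b = restrict (\<lambda>t::real. \<beta>) {0..}"
    have b: "b \<in> controls B" unfolding b_def by (rule constant_control[OF \<beta>(1)])
    show ?thesis
    proof (rule bexI[OF _ b], intro ballI)
      fix a t assume a: "a \<in> controls A" and t: "t \<in> {0..h}"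
      have "\<forall>s\<ge>0. f ?y (a s) (b s) \<bullet> (c *\<^sub>R (x - ?y)) + - l ?y (a s) (b s) \<le> e1"
      proof (intro allI impI)
        fix s :: real assume s: "0 \<le> s"
        have "c *\<^sub>R (?y - x) = - (c *\<^sub>R (x - ?y))" by (simp add: algebra_simps)
        then show "f ?y (a s) (b s) \<bullet> (c *\<^sub>R (x - ?y)) + - l ?y (a s) (b s) \<le> e1"
          using \<beta>(2)[OF controls_space[OF a s]] s by (simp add: b_def)
      qed
      from step[OF a b this t]
      show "- moreau c ?w x - (4 * e1) * t \<le> - moreau c ?w (traj x a b t) + acc 0 l x a b t"
        by (simp add: acc_minus)
    qed
  qed
  obtain n where n: "T / h \<le> real n" using real_arch_simple by blast
  then have nT: "T \<le> real n * h" using h by (simp add: divide_le_eq)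
  from concatenate_controls[OF l h one \<alpha>, of n x] obtain b where b: "b \<in> controls B"
    "\<And>t. t \<in> {0..real n * h} \<Longrightarrow> - moreau c ?w x - (4 * e1) * t \<le> - moreau c ?w (traj x (\<alpha> b) b t) + acc 0 l x (\<alpha> b) b t"
    by blast
  show ?thesis
  proof (rule bexI[OF _ b(1)], intro ballI)
    fix t assume t: "t \<in> {0..T}"
    have "4 * e1 * t \<le> 4 * e1 * T" using t e1(1) by (intro mult_left_mono) auto
    moreover have "- moreau c ?w x - (4 * e1) * t \<le> - moreau c ?w (traj x (\<alpha> b) b t) + acc 0 l x (\<alpha> b) b t"
      by (rule b(2)) (use t nT in auto)
    ultimately show "w x - e \<le> w (traj x (\<alpha> b) b t) + acc 0 l x (\<alpha> b) b t"
      using near(1)[of "traj x (\<alpha> b) b t"] near(2)[of x] e1(2) by (simp add: algebra_simps)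
  qed
qed

end

section \<open>Periodic sets and the torus\<close>

lemma infdist_periodic:
  fixes D :: "(real^'n) set"
  assumes D: "\<And>x k. x \<in> D \<Longrightarrow> k \<in> int_lattice \<Longrightarrow> x + k \<in> D" and ne: "D \<noteq> {}"
  shows "lattice_periodic (\<lambda>x. infdist x D)"
proof -
  have le: "infdist (x + k) D \<le> infdist x D" if k: "k \<in> int_lattice" for x k
    unfolding infdist_notempty[OF ne, of x]
  proof (rule cINF_greatest[OF ne])
    fix d assume "d \<in> D"
    then have "infdist (x + k) D \<le> dist (x + k) (d + k)" using D k by (intro infdist_le) auto
    then show "infdist (x + k) D \<le> dist x d" by simp
  qed
  have "infdist (x + k) D = infdist x D" if k: "k \<in> int_lattice" for x k
    using le[OF k, of x] le[OF int_lattice_closed(3)[OF k k], of "x + k"] by simp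
  then show ?thesis by (simp add: lattice_periodic_def)
qed

text \<open>
  Points that are almost minimal are close to the minimum set, by compactness of the unit cube and
  periodicity. This converts a guarantee on values of \<open>w\<close> into one on the distance to a dominion.
\<close>

lemma near_minimum_set:
  fixes w :: "real^'n \<Rightarrow> real"
  assumes w: "continuous_on UNIV w" "lattice_periodic w" and x0: "\<And>y. w x0 \<le> w y" and e: "0 < e"
  shows "\<exists>\<eta>>0. \<forall>z. w z \<le> w x0 + \<eta> \<longrightarrow> infdist z {x. w x = w x0} < e"
proof -
  let ?D = "{x. w x = w x0}"
  have per: "lattice_periodic (\<lambda>x. infdist x ?D)"
    by (rule infdist_periodic) (use w(2) in \<open>auto simp: lattice_periodic_def\<close>)
  let ?K = "cbox 0 1 \<inter> {z. e \<le> infdist z ?D}"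
  have "closed {z. e \<le> infdist z ?D}" by (intro closed_Collect_le continuous_intros)
  then have K: "compact ?K" by (intro compact_Int_closed compact_cbox)
  have "\<exists>\<eta>>0. \<forall>z\<in>?K. w x0 + \<eta> < w z"
  proof (cases "?K = {}")
    case False
    then obtain z0 where z0: "z0 \<in> ?K" "\<forall>z\<in>?K. w z0 \<le> w z"
      using continuous_attains_inf[OF K, of w] continuous_on_subset[OF w(1)] by blast
    have "z0 \<notin> ?D" using z0(1) e infdist_zero[of z0 ?D] by force
    then have lt: "w x0 < w z0" using x0[of z0] by simp
    show ?thesis
    proof (rule exI[of _ "(w z0 - w x0) / 2"], intro conjI ballI)
      show "0 < (w z0 - w x0) / 2" using lt by simp
      fix z assume "z \<in> ?K"
      then have "w z0 \<le> w z" using z0(2) by blast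
      then show "w x0 + (w z0 - w x0) / 2 < w z" using lt by (simp add: field_simps)
    qed
  qed (auto intro: exI[of _ 1])
  then obtain \<eta> where \<eta>: "0 < \<eta>" "\<forall>z\<in>?K. w x0 + \<eta> < w z" by blast
  have "infdist z ?D < e" if z: "w z \<le> w x0 + \<eta>" for z
  proof (rule ccontr)
    assume far: "\<not> infdist z ?D < e"
    obtain k where k: "k \<in> int_lattice" "z + k \<in> cbox 0 1" by (rule translate_to_cube)
    have "w (z + k) = w z" "infdist (z + k) ?D = infdist z ?D"
      using w(2) per k(1) by (auto simp: lattice_periodic_def)
    then have "z + k \<in> ?K" using far k(2) by simp
    then have "w x0 + \<eta> < w (z + k)" using \<eta>(2) by blast
    then show False using z \<open>w (z + k) = w z\<close> by simp
  qed
  then show ?thesis using \<eta>(1) by blast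
qed

lemma torus_proj_eq_iff: "torus_proj x = torus_proj y \<longleftrightarrow> y - x \<in> int_lattice"
proof
  assume "torus_proj x = torus_proj y"
  moreover have "y \<in> torus_proj y" by (simp add: torus_proj_def int_lattice_def)
  ultimately have "y \<in> torus_proj x" by blast
  then show "y - x \<in> int_lattice" by (simp add: torus_proj_def)
next
  assume k: "y - x \<in> int_lattice"
  show "torus_proj x = torus_proj y"
  proof (rule set_eqI)
    fix z
    have "z - x \<in> int_lattice \<longleftrightarrow> z - y \<in> int_lattice"
      using int_lattice_closed(2)[OF _ k, of "z - x"] int_lattice_closed(1)[OF _ k, of "z - y"] by auto
    then show "z \<in> torus_proj x \<longleftrightarrow> z \<in> torus_proj y" by (simp add: torus_proj_def)
  qed
qed

lemma closedin_torus_iff: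
  assumes "U \<subseteq> range torus_proj"
  shows "closedin torus_topology U \<longleftrightarrow> closed (torus_proj -` U)"
proof -
  have "\<forall>U \<subseteq> range torus_proj. closed (torus_proj -` U) = closedin torus_topology U"
    using quotient_map_torus_proj unfolding quotient_map_closedin
    by (simp add: topspace_torus_topology vimage_def)
  then show ?thesis using assms by blast
qed

text \<open>
  Level sets of periodic functions are closed and saturated for the projection, so their images in
  the quotient are closed already.
\<close>

lemma torus_closure_level_set:
  fixes w :: "real^'n \<Rightarrow> real"
  assumes w: "continuous_on UNIV w" "lattice_periodic w"
  shows "torus_topology closure_of (torus_proj ` {x. w x = c}) = torus_proj ` {x. w x = c}"
proof -
  have "torus_proj -` (torus_proj ` {x. w x = c}) = {x. w x = c}"
  proof (intro set_eqI iffI)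
    fix x assume "x \<in> torus_proj -` (torus_proj ` {x. w x = c})"
    then obtain y where "torus_proj y = torus_proj x" "w y = c" by auto
    then have "x - y \<in> int_lattice" by (simp add: torus_proj_eq_iff)
    then have "w (y + (x - y)) = w y" using w(2) unfolding lattice_periodic_def by blast
    then show "x \<in> {x. w x = c}" using \<open>w y = c\<close> by simp
  qed auto
  moreover have "closed {x. w x = c}" by (intro closed_Collect_eq w(1) continuous_on_const)
  ultimately have "closedin torus_topology (torus_proj ` {x. w x = c})"
    by (subst closedin_torus_iff) auto
  then show ?thesis by (rule closure_of_closedin)
qed

lemma torus_closure_preimage:
  fixes D :: "(real^'n) set"
  defines "F \<equiv> torus_proj -` (torus_topology closure_of (torus_proj ` D))"
  shows "closed F" "D \<subseteq> F" "x \<in> F \<Longrightarrow> k \<in> int_lattice \<Longrightarrow> x + k \<in> F"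
proof -
  have sub: "torus_topology closure_of (torus_proj ` D) \<subseteq> range torus_proj"
    using closure_of_subset_topspace[of torus_topology "torus_proj ` D"] by (simp add: topspace_torus_topology)
  show "closed F"
    unfolding F_def using closedin_torus_iff[OF sub] closedin_closure_of by blast
  have "torus_proj ` D \<subseteq> torus_topology closure_of (torus_proj ` D)"
    by (rule closure_of_subset) (auto simp: topspace_torus_topology)
  then show "D \<subseteq> F" by (auto simp: F_def)
  show "x + k \<in> F" if "x \<in> F" "k \<in> int_lattice"
  proof -
    have "torus_proj x = torus_proj (x + k)" using that(2) by (simp add: torus_proj_eq_iff)
    then show ?thesis using that(1) by (simp add: F_def)
  qed
qed

context game_dynamics
begin

section \<open>Extremal level sets are dominions\<close>

abbreviation no_disjoint_dominions :: bool where
  "no_disjoint_dominions \<equiv> \<forall>E1\<in>torus_dominions1 A B f. \<forall>E2\<in>torus_dominions2 A B f. E1 \<inter> E2 \<noteq> {}"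

lemma minimum_set_dominion1:
  fixes w :: "real^'n \<Rightarrow> real"
  assumes w: "continuous_on UNIV w" "lattice_periodic w" and x0: "\<And>y. w x0 \<le> w y"
    and g: "\<And>x T e. 0 \<le> T \<Longrightarrow> 0 < e \<Longrightarrow> \<exists>\<alpha>\<in>strats. \<forall>b\<in>controls B. \<forall>t\<in>{0..T}. w (traj x (\<alpha> b) b t) \<le> w x + e"
  shows "dominion1 A B f {x. w x = w x0}"
  unfolding dominion1_def
proof (intro conjI ballI allI impI)
  show "{x. w x = w x0} \<noteq> {}" by auto
  show "closed {x. w x = w x0}" by (intro closed_Collect_eq w(1) continuous_on_const)
  fix x and e T :: real assume x: "x \<in> {x. w x = w x0}" and e: "0 < e" and T: "0 \<le> T"
  obtain \<eta> where \<eta>: "0 < \<eta>" "\<forall>z. w z \<le> w x0 + \<eta> \<longrightarrow> infdist z {x. w x = w x0} < e"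
    using near_minimum_set[OF w x0 e] by blast
  obtain \<alpha> where \<alpha>: "\<alpha> \<in> strats" "\<forall>b\<in>controls B. \<forall>t\<in>{0..T}. w (traj x (\<alpha> b) b t) \<le> w x + \<eta>"
    using g[OF T \<eta>(1)] by blast
  show "\<exists>\<alpha>\<in>strats. \<forall>b\<in>controls B. \<forall>t\<in>{0..T}. infdist (traj x (\<alpha> b) b t) {x. w x = w x0} \<le> e"
    using \<alpha> \<eta>(2) x by (intro bexI[OF _ \<alpha>(1)]) (auto intro: less_imp_le)
qed

lemma maximum_set_dominion2:
  fixes w :: "real^'n \<Rightarrow> real"
  assumes w: "continuous_on UNIV w" "lattice_periodic w" and x0: "\<And>y. w y \<le> w x0"
    and g: "\<And>x T e \<alpha>. 0 \<le> T \<Longrightarrow> 0 < e \<Longrightarrow> \<alpha> \<in> strats \<Longrightarrow> \<exists>b\<in>controls B. \<forall>t\<in>{0..T}. w x - e \<le> w (traj x (\<alpha> b) b t)"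
  shows "dominion2 A B f {x. w x = w x0}"
  unfolding dominion2_def
proof (intro conjI ballI allI impI)
  show "{x. w x = w x0} \<noteq> {}" by auto
  show "closed {x. w x = w x0}" by (intro closed_Collect_eq w(1) continuous_on_const)
  fix x and e T :: real and \<alpha> assume x: "x \<in> {x. w x = w x0}" and e: "0 < e" and T: "0 \<le> T" and \<alpha>: "\<alpha> \<in> strats"
  have w': "continuous_on UNIV (\<lambda>x. - w x)" "lattice_periodic (\<lambda>x. - w x)"
    using w by (auto simp: lattice_periodic_def intro: continuous_intros)
  have "\<exists>\<eta>>0. \<forall>z. - w z \<le> - w x0 + \<eta> \<longrightarrow> infdist z {x. - w x = - w x0} < e"
    by (rule near_minimum_set[OF w' _ e]) (use x0 in simp)
  then obtain \<eta> where \<eta>: "0 < \<eta>" "\<forall>z. - w z \<le> - w x0 + \<eta> \<longrightarrow> infdist z {x. w x = w x0} < e"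
    by auto
  obtain b where b: "b \<in> controls B" "\<forall>t\<in>{0..T}. w x - \<eta> \<le> w (traj x (\<alpha> b) b t)"
    using g[OF T \<eta>(1) \<alpha>] by blast
  show "\<exists>b\<in>controls B. \<forall>t\<in>{0..T}. infdist (traj x (\<alpha> b) b t) {x. w x = w x0} \<le> e"
  proof (rule bexI[OF _ b(1)], rule ballI)
    fix t assume "t \<in> {0..T}"
    then have "w x - \<eta> \<le> w (traj x (\<alpha> b) b t)" using b(2) by blast
    then have "- w (traj x (\<alpha> b) b t) \<le> - w x0 + \<eta>" using x by simp
    then show "infdist (traj x (\<alpha> b) b t) {x. w x = w x0} \<le> e" using \<eta>(2) by (auto intro: less_imp_le)
  qed
qed

text \<open>
  The minimum set is a dominion of player 1 and the maximum set one of player 2. A common point of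
  their images in the torus is a point of both sets up to a lattice vector.
\<close>

lemma guaranteed_function_constant:
  fixes w :: "real^'n \<Rightarrow> real"
  assumes nd: no_disjoint_dominions
    and w: "continuous_on UNIV w" "lattice_periodic w"
    and g1: "\<And>x T e. 0 \<le> T \<Longrightarrow> 0 < e \<Longrightarrow> \<exists>\<alpha>\<in>strats. \<forall>b\<in>controls B. \<forall>t\<in>{0..T}. w (traj x (\<alpha> b) b t) \<le> w x + e"
    and g2: "\<And>x T e \<alpha>. 0 \<le> T \<Longrightarrow> 0 < e \<Longrightarrow> \<alpha> \<in> strats \<Longrightarrow> \<exists>b\<in>controls B. \<forall>t\<in>{0..T}. w x - e \<le> w (traj x (\<alpha> b) b t)"
  shows "\<exists>c. \<forall>x. w x = c"
proof -
  have w': "continuous_on UNIV (\<lambda>x. - w x)" "lattice_periodic (\<lambda>x. - w x)"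
    using w by (auto simp: lattice_periodic_def intro: continuous_intros)
  obtain x1 where x1: "\<forall>y. w x1 \<le> w y" using periodic_attains_min[OF w] by blast
  obtain x2 where x2: "\<forall>y. w y \<le> w x2" using periodic_attains_min[OF w'] by auto
  have d1: "dominion1 A B f {x. w x = w x1}" by (rule minimum_set_dominion1[OF w x1[rule_format] g1])
  have d2: "dominion2 A B f {x. w x = w x2}" by (rule maximum_set_dominion2[OF w x2[rule_format] g2])
  have "torus_proj ` {x. w x = w x1} \<in> torus_dominions1 A B f"
    unfolding torus_dominions1_def using d1 torus_closure_level_set[OF w, of "w x1"] by blast
  moreover have "torus_proj ` {x. w x = w x2} \<in> torus_dominions2 A B f"
    unfolding torus_dominions2_def using d2 torus_closure_level_set[OF w, of "w x2"] by blast
  ultimately have "torus_proj ` {x. w x = w x1} \<inter> torus_proj ` {x. w x = w x2} \<noteq> {}"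
    using nd by blast
  then obtain y z where yz: "w y = w x1" "w z = w x2" "torus_proj y = torus_proj z" by auto
  have "z - y \<in> int_lattice" using yz(3) by (simp add: torus_proj_eq_iff)
  then have "w (y + (z - y)) = w y" using w(2) unfolding lattice_periodic_def by blast
  then have "w x1 = w x2" using yz by simp
  then have "w x = w x1" for x using x1[rule_format, of x] x2[rule_format, of x] by simp
  then show ?thesis by blast
qed

section \<open>The strong maximum principle\<close>

text \<open>
  Where a test function touches a constant its gradient vanishes, and the recession Hamiltonian is
  0 at slope 0.
\<close>

lemma constant_solves_recession:
  "continuous_viscosity_solution (\<lambda>x r p. recession_hamiltonian A B f x p) (\<lambda>x. c)"
proof -
  have zero: "D\<phi> x = 0" if C1: "C1_gradient \<phi> D\<phi>"
    and ext: "(\<forall>\<^sub>F y in nhds x. \<phi> x \<le> \<phi> y) \<or> (\<forall>\<^sub>F y in nhds x. \<phi> y \<le> \<phi> x)" for \<phi> D\<phi> and x :: "real^'n"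
  proof -
    have D: "(\<phi> has_derivative (\<lambda>h. h \<bullet> D\<phi> x)) (at x)" using C1 by (simp add: C1_gradient_def gderiv_def)
    obtain S where S: "open S" "x \<in> S" "(\<forall>y\<in>S. \<phi> x \<le> \<phi> y) \<or> (\<forall>y\<in>S. \<phi> y \<le> \<phi> x)"
      using ext unfolding eventually_nhds by blast
    have "(\<lambda>h. h \<bullet> D\<phi> x) = (\<lambda>h. 0)"
      by (rule differential_zero_maxmin[OF S(2,1) D]) (use S(3) in blast)
    then have "D\<phi> x \<bullet> D\<phi> x = 0" by meson
    then show ?thesis by simp
  qed
  have H0: "recession_hamiltonian A B f x 0 = 0" for x
    using nonempty_A nonempty_B by (simp add: recession_hamiltonian_def)
  show ?thesis
    unfolding continuous_viscosity_solution_def viscosity_subsolution_def viscosity_supersolution_def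
  proof (intro conjI allI impI, goal_cases)
    case 1 show ?case by (rule continuous_on_const)
  next
    case (2 \<phi> D\<phi> x)
    then have "D\<phi> x = 0" by (intro zero[of \<phi>]) auto
    then show ?case by (simp add: H0)
  next
    case (3 \<phi> D\<phi> x)
    then have "D\<phi> x = 0" by (intro zero[of \<phi>]) auto
    then show ?case by (simp add: H0)
  qed
qed

lemma strong_maximum_principle:
  assumes nd: no_disjoint_dominions
  shows "{w. lattice_periodic w \<and> continuous_viscosity_solution (\<lambda>x r p. recession_hamiltonian A B f x p) w} = range (\<lambda>c x. c)"
proof (intro set_eqI iffI)
  fix w assume "w \<in> {w. lattice_periodic w \<and> continuous_viscosity_solution (\<lambda>x r p. recession_hamiltonian A B f x p) w}"
  then have w: "continuous_on UNIV w" "lattice_periodic w"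
    and sub: "viscosity_subsolution (\<lambda>x r p. hamiltonian A B f (\<lambda>x a b. 0) x p) w"
    and super: "viscosity_supersolution (\<lambda>x r p. hamiltonian A B f (\<lambda>x a b. 0) x p) w"
    by (auto simp: continuous_viscosity_solution_def recession_hamiltonian_eq)
  have acc0: "acc 0 (\<lambda>x a b. 0) x a b t = 0" for x a b t by (simp add: acc_def)
  have "\<exists>c. \<forall>x. w x = c"
  proof (rule guaranteed_function_constant[OF nd w])
    fix x and T e :: real assume "0 \<le> T" "0 < e"
    from supersolution_guarantee[OF payoff_zero w super this, of x]
    show "\<exists>\<alpha>\<in>strats. \<forall>b\<in>controls B. \<forall>t\<in>{0..T}. w (traj x (\<alpha> b) b t) \<le> w x + e" by (simp add: acc0)
  next
    fix x and T e :: real and \<alpha> assume "0 \<le> T" "0 < e" "\<alpha> \<in> strats"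
    from subsolution_guarantee[OF payoff_zero w sub this, of x]
    show "\<exists>b\<in>controls B. \<forall>t\<in>{0..T}. w x - e \<le> w (traj x (\<alpha> b) b t)" by (simp add: acc0)
  qed
  then show "w \<in> range (\<lambda>c x. c)" by auto
next
  fix w assume "w \<in> range (\<lambda>c x::real^'n. c::real)"
  then show "w \<in> {w. lattice_periodic w \<and> continuous_viscosity_solution (\<lambda>x r p. recession_hamiltonian A B f x p) w}"
    using constant_solves_recession by (auto simp: lattice_periodic_def)
qed

section \<open>Disjoint dominions destroy ergodicity\<close>

lemma discounted_payoff_minus: "discounted_payoff f (\<lambda>x a b. - l x a b) \<delta> x a b = - discounted_payoff f l \<delta> x a b"
  by (simp add: discounted_payoff_def set_lebesgue_integral_def)

text \<open>
  The bound \<open>q\<close> is used up to time \<open>T\<close> and the global bound \<open>C\<close> afterwards.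
\<close>

lemma payoff_upper_estimate:
  assumes l: "running_payoff l" and C: "\<forall>x. \<forall>a\<in>A. \<forall>b\<in>B. \<bar>l x a b\<bar> \<le> C"
    and a: "a \<in> controls A" and b: "b \<in> controls B" and \<delta>: "0 < \<delta>" and T: "0 \<le> T"
    and q: "\<And>s. s \<in> {0..T} \<Longrightarrow> l (traj x a b s) (a s) (b s) \<le> q"
  shows "\<delta> * discounted_payoff f l \<delta> x a b \<le> q + (C + \<bar>q\<bar>) * exp (- \<delta> * T)"
proof -
  let ?E = "exp (- \<delta> * T)"
  have ie: "((\<lambda>s. exp (- \<delta> * s) * q) has_integral (- (q * exp (- \<delta> * T) / \<delta>) - - (q * exp (- \<delta> * 0) / \<delta>))) {0..T}"
    by (rule fundamental_theorem_of_calculus[OF T])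
      (use \<delta> in \<open>auto intro!: derivative_eq_intros simp flip: has_real_derivative_iff_has_vector_derivative\<close>)
  have "acc \<delta> l x a b T \<le> integral {0..T} (\<lambda>s. exp (- \<delta> * s) * q)"
    unfolding acc_def
  proof (rule integral_le)
    show "(\<lambda>s. exp (- \<delta> * s) * l (traj x a b s) (a s) (b s)) integrable_on {0..T}"
      using discounted_rate_integrable[OF l a b] \<delta> by simp
    show "(\<lambda>s. exp (- \<delta> * s) * q) integrable_on {0..T}" using ie by blast
  qed (use q in auto)
  also have "\<dots> = (q - q * ?E) / \<delta>" using integral_unique[OF ie] by (simp add: diff_divide_distrib)
  finally have "\<delta> * acc \<delta> l x a b T \<le> q - q * ?E" using \<delta> by (simp add: field_simps)
  moreover have "discounted_payoff f l \<delta> x a b \<le> acc \<delta> l x a b T + C * ?E / \<delta>"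
    using payoff_tail[OF l C a b \<delta> T, of x] by linarith
  then have "\<delta> * discounted_payoff f l \<delta> x a b \<le> \<delta> * (acc \<delta> l x a b T + C * ?E / \<delta>)"
    using \<delta> by (intro mult_left_mono) auto
  moreover have "\<delta> * (acc \<delta> l x a b T + C * ?E / \<delta>) = \<delta> * acc \<delta> l x a b T + C * ?E"
    using \<delta> by (simp add: algebra_simps)
  moreover have "(- q) * ?E \<le> \<bar>q\<bar> * ?E" by (intro mult_right_mono) auto
  ultimately show ?thesis by (simp add: algebra_simps)
qed

lemma exponential_horizon:
  fixes \<delta> :: real assumes "0 < \<delta>" "0 < e"
  shows "\<exists>T\<ge>0. K * exp (- \<delta> * T) \<le> e"
proof -
  have "((\<lambda>t. K * exp (- \<delta> * t) / \<delta>) \<longlongrightarrow> 0) at_top" by (rule exponential_decay[OF assms(1)])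
  then have "\<forall>\<^sub>F t in at_top. K * exp (- \<delta> * t) / \<delta> < e / \<delta>" using assms by (intro order_tendstoD) auto
  then have "\<forall>\<^sub>F t in at_top. 0 \<le> t \<and> K * exp (- \<delta> * t) / \<delta> < e / \<delta>"
    using eventually_ge_at_top[of "0::real"] by eventually_elim auto
  then obtain T where "0 \<le> T" "K * exp (- \<delta> * T) / \<delta> < e / \<delta>" by (auto dest: eventually_happens)
  then show ?thesis using assms by (auto simp: divide_less_cancel intro: less_imp_le)
qed

lemma near_set_payoff:
  assumes l: "running_payoff l" and D: "D \<noteq> {}" "closed D" and e: "0 < e"
    and q: "\<And>z a b. z \<in> D \<Longrightarrow> a \<in> A \<Longrightarrow> b \<in> B \<Longrightarrow> l z a b \<le> q"
  shows "\<exists>\<rho>>0. \<forall>y. infdist y D \<le> \<rho> \<longrightarrow> (\<forall>a\<in>A. \<forall>b\<in>B. l y a b \<le> q + e)"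
proof -
  obtain d where d: "0 < d" "\<And>x y a b. norm (x - y) < d \<Longrightarrow> a \<in> A \<Longrightarrow> b \<in> B \<Longrightarrow> \<bar>l x a b - l y a b\<bar> < e"
    using payoff_uniform[OF l e] by blast
  have "l y a b \<le> q + e" if y: "infdist y D \<le> d / 2" and a: "a \<in> A" and b: "b \<in> B" for y a b
  proof -
    obtain z where z: "z \<in> D" "infdist y D = dist y z"
      using infdist_attains_inf[OF D(2,1), of y] by blast
    have "norm (y - z) < d" using y z(2) d(1) by (simp add: dist_norm)
    then show ?thesis using d(2)[OF _ a b, of y z] q[OF z(1) a b] by linarith
  qed
  then show ?thesis using d(1) by (intro exI[of _ "d / 2"]) auto
qed

text \<open>
  Player 1 can stay so close to \<open>D\<close>, for so long, that the payoff rate hardly exceeds \<open>q\<close> as long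
  as the discount factor is not negligible.
\<close>

lemma value_on_dominion1:
  assumes l: "running_payoff l" and D: "dominion1 A B f D" and x: "x \<in> D" and \<delta>: "0 < \<delta>"
    and q: "\<And>z a b. z \<in> D \<Longrightarrow> a \<in> A \<Longrightarrow> b \<in> B \<Longrightarrow> l z a b \<le> q"
  shows "\<delta> * lval \<delta> l x \<le> q"
proof (rule field_le_epsilon)
  fix e :: real assume e: "0 < e"
  then have e2: "0 < e / 2" by simp
  obtain C where C0: "0 \<le> C" and C: "\<forall>x. \<forall>a\<in>A. \<forall>b\<in>B. \<bar>l x a b\<bar> \<le> C" using payoff_bounded[OF l] by blast
  have D': "D \<noteq> {}" "closed D" using D by (auto simp: dominion1_def)
  obtain \<rho> where \<rho>: "0 < \<rho>" "\<forall>y. infdist y D \<le> \<rho> \<longrightarrow> (\<forall>a\<in>A. \<forall>b\<in>B. l y a b \<le> q + e / 2)"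
    using near_set_payoff[OF l D' e2 q] by blast
  obtain T where T: "0 \<le> T" "(C + \<bar>q + e / 2\<bar>) * exp (- \<delta> * T) \<le> e / 2"
    using exponential_horizon[OF \<delta> e2] by blast
  obtain \<alpha> where \<alpha>: "\<alpha> \<in> strats" "\<forall>b\<in>controls B. \<forall>t\<in>{0..T}. infdist (traj x (\<alpha> b) b t) D \<le> \<rho>"
    using D x \<rho>(1) T(1) unfolding dominion1_def by blast
  have "lval \<delta> l x \<le> (q + e) / \<delta>"
  proof (rule value_le[OF l \<delta> \<alpha>(1)])
    fix b assume b: "b \<in> controls B"
    have ab: "\<alpha> b \<in> controls A" using \<alpha>(1) b by blast
    have "\<delta> * discounted_payoff f l \<delta> x (\<alpha> b) b \<le> (q + e / 2) + (C + \<bar>q + e / 2\<bar>) * exp (- \<delta> * T)"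
    proof (rule payoff_upper_estimate[OF l C ab b \<delta> T(1)])
      fix s assume s: "s \<in> {0..T}"
      then have "infdist (traj x (\<alpha> b) b s) D \<le> \<rho>" using \<alpha>(2) b by blast
      then show "l (traj x (\<alpha> b) b s) (\<alpha> b s) (b s) \<le> q + e / 2"
        using \<rho>(2) controls_space[OF ab, of s] controls_space[OF b, of s] s by auto
    qed
    then have "\<delta> * discounted_payoff f l \<delta> x (\<alpha> b) b \<le> q + e" using T(2) by linarith
    then show "discounted_payoff f l \<delta> x (\<alpha> b) b \<le> (q + e) / \<delta>" using \<delta> by (simp add: field_simps)
  qed
  then show "\<delta> * lval \<delta> l x \<le> q + e" using \<delta> by (simp add: field_simps)
qed

lemma value_on_dominion2:
  assumes l: "running_payoff l" and D: "dominion2 A B f D" and x: "x \<in> D" and \<delta>: "0 < \<delta>"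
    and q: "\<And>z a b. z \<in> D \<Longrightarrow> a \<in> A \<Longrightarrow> b \<in> B \<Longrightarrow> q \<le> l z a b"
  shows "q \<le> \<delta> * lval \<delta> l x"
proof (rule field_le_epsilon)
  fix e :: real assume e: "0 < e"
  then have e2: "0 < e / 2" by simp
  let ?l = "\<lambda>x a b. - l x a b"
  have l': "running_payoff ?l" by (rule payoff_minus[OF l])
  obtain C where C0: "0 \<le> C" and C: "\<forall>x. \<forall>a\<in>A. \<forall>b\<in>B. \<bar>?l x a b\<bar> \<le> C" using payoff_bounded[OF l'] by blast
  have D': "D \<noteq> {}" "closed D" using D by (auto simp: dominion2_def)
  have "\<exists>\<rho>>0. \<forall>y. infdist y D \<le> \<rho> \<longrightarrow> (\<forall>a\<in>A. \<forall>b\<in>B. ?l y a b \<le> - q + e / 2)"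
    by (rule near_set_payoff[OF l' D' e2]) (use q in simp)
  then obtain \<rho> where \<rho>: "0 < \<rho>" "\<forall>y. infdist y D \<le> \<rho> \<longrightarrow> (\<forall>a\<in>A. \<forall>b\<in>B. ?l y a b \<le> - q + e / 2)"
    by blast
  obtain T where T: "0 \<le> T" "(C + \<bar>- q + e / 2\<bar>) * exp (- \<delta> * T) \<le> e / 2"
    using exponential_horizon[OF \<delta> e2] by blast
  have "(q - e) / \<delta> \<le> lval \<delta> l x"
  proof (rule value_ge[OF l \<delta>])
    fix \<alpha> assume \<alpha>: "\<alpha> \<in> strats"
    obtain b where b: "b \<in> controls B" and near: "\<forall>t\<in>{0..T}. infdist (traj x (\<alpha> b) b t) D \<le> \<rho>"
      using D x \<rho>(1) T(1) \<alpha> unfolding dominion2_def by blast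
    have ab: "\<alpha> b \<in> controls A" using \<alpha> b by blast
    have "\<delta> * discounted_payoff f ?l \<delta> x (\<alpha> b) b \<le> (- q + e / 2) + (C + \<bar>- q + e / 2\<bar>) * exp (- \<delta> * T)"
    proof (rule payoff_upper_estimate[OF l' C ab b \<delta> T(1)])
      fix s assume s: "s \<in> {0..T}"
      then have "infdist (traj x (\<alpha> b) b s) D \<le> \<rho>" using near by blast
      then show "?l (traj x (\<alpha> b) b s) (\<alpha> b s) (b s) \<le> - q + e / 2"
        using \<rho>(2) controls_space[OF ab, of s] controls_space[OF b, of s] s by auto
    qed
    then have "\<delta> * discounted_payoff f ?l \<delta> x (\<alpha> b) b \<le> - q + e" using T(2) by linarith
    then have "(q - e) / \<delta> \<le> discounted_payoff f l \<delta> x (\<alpha> b) b"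
      unfolding discounted_payoff_minus using \<delta> by (simp add: field_simps)
    then show "\<exists>b\<in>controls B. (q - e) / \<delta> \<le> discounted_payoff f l \<delta> x (\<alpha> b) b" using b by blast
  qed
  then show "q \<le> \<delta> * lval \<delta> l x + e" using \<delta> by (simp add: field_simps)
qed

text \<open>
  The perturbation interpolates between \<open>- (C + 1)\<close> on the preimage of the one closure and
  \<open>C + 1\<close> on that of the other, by means of distances. As \<open>C\<close> bounds \<open>l\<close>, the total payoff is at most
  \<open>- 1\<close> on the first dominion and at least \<open>1\<close> on the second.
\<close>

lemma uniquely_ergodic_no_disjoint_dominions:
  assumes l: "running_payoff l" and erg: "uniquely_ergodic A B f l"
  shows no_disjoint_dominions
proof (intro ballI notI)
  fix E1 E2 assume "E1 \<in> torus_dominions1 A B f" "E2 \<in> torus_dominions2 A B f" and disj: "E1 \<inter> E2 = {}"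
  then obtain D1 D2 where D1: "dominion1 A B f D1" "E1 = torus_topology closure_of (torus_proj ` D1)"
    and D2: "dominion2 A B f D2" "E2 = torus_topology closure_of (torus_proj ` D2)"
    by (auto simp: torus_dominions1_def torus_dominions2_def)
  define F1 where "F1 = torus_proj -` E1"
  define F2 where "F2 = torus_proj -` E2"
  note F1 = torus_closure_preimage[where D=D1, folded D1(2), folded F1_def]
  note F2 = torus_closure_preimage[where D=D2, folded D2(2), folded F2_def]
  have F12: "F1 \<inter> F2 = {}" using disj by (auto simp: F1_def F2_def)
  obtain x1 x2 where x: "x1 \<in> D1" "x2 \<in> D2" using D1(1) D2(1) by (auto simp: dominion1_def dominion2_def)
  then have ne: "F1 \<noteq> {}" "F2 \<noteq> {}" using F1(2) F2(2) by auto
  have pos: "0 < infdist y F1 + infdist y F2" for y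
  proof -
    have "infdist y F1 \<noteq> 0 \<or> infdist y F2 \<noteq> 0"
      using F12 in_closed_iff_infdist_zero[OF F1(1) ne(1)] in_closed_iff_infdist_zero[OF F2(1) ne(2)] by blast
    then show ?thesis using infdist_nonneg[of y F1] infdist_nonneg[of y F2] by linarith
  qed
  obtain C where C0: "0 \<le> C" and C: "\<forall>x. \<forall>a\<in>A. \<forall>b\<in>B. \<bar>l x a b\<bar> \<le> C" using payoff_bounded[OF l] by blast
  define g where "g = (\<lambda>y. (C + 1) * ((infdist y F1 - infdist y F2) / (infdist y F1 + infdist y F2)))"
  have g: "continuous_on UNIV g" "lattice_periodic g"
  proof -
    show "continuous_on UNIV g"
      unfolding g_def using pos by (intro continuous_intros) (auto simp: less_imp_neq[THEN not_sym])
    have "lattice_periodic (\<lambda>y. infdist y F1)" "lattice_periodic (\<lambda>y. infdist y F2)"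
      using infdist_periodic[OF F1(3) ne(1)] infdist_periodic[OF F2(3) ne(2)] by auto
    then show "lattice_periodic g" by (simp add: lattice_periodic_def g_def)
  qed
  have g1: "g y = - (C + 1)" if "y \<in> D1" for y
  proof -
    have "infdist y F1 = 0" using that F1(2) by auto
    then show ?thesis using pos[of y] by (simp add: g_def)
  qed
  have g2: "g y = C + 1" if "y \<in> D2" for y
  proof -
    have "infdist y F2 = 0" using that F2(2) by auto
    then show ?thesis using pos[of y] by (simp add: g_def)
  qed
  let ?l = "\<lambda>x a b. l x a b + g x"
  have l': "running_payoff ?l" by (rule payoff_add_function[OF l g])
  have low: "\<delta> * lval \<delta> ?l x1 \<le> -1" if "0 < \<delta>" for \<delta>
  proof (rule value_on_dominion1[OF l' D1(1) x(1) that])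
    fix z a b assume z: "z \<in> D1" "a \<in> A" "b \<in> B"
    then have "\<bar>l z a b\<bar> \<le> C" using C by blast
    then show "l z a b + g z \<le> -1" using g1[OF z(1)] by linarith
  qed
  have high: "1 \<le> \<delta> * lval \<delta> ?l x2" if "0 < \<delta>" for \<delta>
  proof (rule value_on_dominion2[OF l' D2(1) x(2) that])
    fix z a b assume z: "z \<in> D2" "a \<in> A" "b \<in> B"
    then have "\<bar>l z a b\<bar> \<le> C" using C by blast
    then show "1 \<le> l z a b + g z" using g2[OF z(1)] by linarith
  qed
  obtain c where c: "uniform_limit UNIV (\<lambda>\<delta> x. \<delta> * lval \<delta> ?l x) (\<lambda>x. c) (at_right 0)"
    using erg g unfolding uniquely_ergodic_def ergodic_def by blast
  have ev: "\<forall>\<^sub>F \<delta> in at_right 0. 0 < (\<delta>::real)" by (simp add: eventually_at_right_less)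
  have lim: "((\<lambda>\<delta>. \<delta> * lval \<delta> ?l x) \<longlongrightarrow> c) (at_right 0)" for x
    by (rule tendsto_uniform_limitI[OF c]) simp
  have "c \<le> -1" using ev by (intro tendsto_upperbound[OF lim[of x1]]) (auto elim!: eventually_mono intro: low)
  moreover have "1 \<le> c" using ev by (intro tendsto_lowerbound[OF lim[of x2]]) (auto elim!: eventually_mono intro: high)
  ultimately show False by simp
qed

section \<open>Ergodicity from intersecting dominions\<close>

text \<open>
  The discounted equation for \<open>v\<close> is the undiscounted one for the payoff \<open>l - \<delta> v\<close>, to which the
  guarantees for the two players apply.
\<close>

lemma value_undiscounted:
  assumes l: "running_payoff l" and \<delta>: "0 < \<delta>"
  defines "m \<equiv> \<lambda>x a b. l x a b + - (\<delta> * lval \<delta> l x)"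
  shows "running_payoff m"
    and "viscosity_supersolution (\<lambda>x r p. hamiltonian A B f m x p) (lval \<delta> l)"
    and "viscosity_subsolution (\<lambda>x r p. hamiltonian A B f m x p) (lval \<delta> l)"
proof -
  have g: "continuous_on UNIV (\<lambda>x. - (\<delta> * lval \<delta> l x))" "lattice_periodic (\<lambda>x. - (\<delta> * lval \<delta> l x))"
    using value_continuous[OF l \<delta>] value_periodic[OF l, of \<delta>]
    by (auto simp: lattice_periodic_def intro!: continuous_intros)
  show m: "running_payoff m" unfolding m_def by (rule payoff_add_function[OF l g])
  have H: "hamiltonian A B f m x p = \<delta> * lval \<delta> l x + hamiltonian A B f l x p" for x p
    using hamiltonian_add_function[OF l m[unfolded m_def], of x p] by (simp add: m_def)
  show "viscosity_supersolution (\<lambda>x r p. hamiltonian A B f m x p) (lval \<delta> l)"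
    using value_supersolution[OF l \<delta>] unfolding viscosity_supersolution_def H .
  show "viscosity_subsolution (\<lambda>x r p. hamiltonian A B f m x p) (lval \<delta> l)"
    using value_subsolution[OF l \<delta>] unfolding viscosity_subsolution_def H .
qed

text \<open>
  By the second mean value theorem, an integral against the decreasing weight \<open>exp (- \<delta> s)\<close> is
  a convex combination of values of the undiscounted primitive.
\<close>

lemma discounted_le_of_accumulated:
  assumes l: "running_payoff l" and \<delta>: "0 < \<delta>"
  shows "\<exists>T\<ge>0. \<forall>x. \<forall>a\<in>controls A. \<forall>b\<in>controls B. \<forall>Q. (\<forall>t\<in>{0..T}. acc 0 l x a b t \<le> Q) \<longrightarrow>
    discounted_payoff f l \<delta> x a b \<le> Q + 1"
proof -
  obtain C where C0: "0 \<le> C" and C: "\<forall>x. \<forall>a\<in>A. \<forall>b\<in>B. \<bar>l x a b\<bar> \<le> C" using payoff_bounded[OF l] by blast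
  obtain T where T: "0 \<le> T" "C * exp (- \<delta> * T) \<le> \<delta>"
    using exponential_horizon[OF \<delta> \<delta>] by blast
  have "discounted_payoff f l \<delta> x a b \<le> Q + 1"
    if a: "a \<in> controls A" and b: "b \<in> controls B" and Q: "\<forall>t\<in>{0..T}. acc 0 l x a b t \<le> Q" for x a b Q
  proof -
    let ?r = "\<lambda>s. l (traj x a b s) (a s) (b s)" and ?E = "exp (- \<delta> * T)"
    have int: "?r integrable_on {0..T}" using rate_integrable[OF l a b] by simp
    obtain c where c: "c \<in> {0..T}"
      "integral {0..T} (\<lambda>s. - exp (- \<delta> * s) * ?r s) = - exp (- \<delta> * 0) * integral {0..c} ?r + - exp (- \<delta> * T) * integral {c..T} ?r"
      by (rule second_mean_value_theorem[OF int T(1), of "\<lambda>s. - exp (- \<delta> * s)"]) (use \<delta> in auto)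
    have "integral {0..c} ?r + integral {c..T} ?r = integral {0..T} ?r"
      by (rule Henstock_Kurzweil_Integration.integral_combine) (use c(1) int in auto)
    then have cT: "integral {c..T} ?r = acc 0 l x a b T - acc 0 l x a b c" by (simp add: acc_def)
    have "acc \<delta> l x a b T = acc 0 l x a b c + ?E * (acc 0 l x a b T - acc 0 l x a b c)"
      using c(2) unfolding cT by (simp add: acc_def algebra_simps)
    also have "\<dots> = (1 - ?E) * acc 0 l x a b c + ?E * acc 0 l x a b T" by (simp add: algebra_simps)
    also have "\<dots> \<le> (1 - ?E) * Q + ?E * Q"
    proof (intro add_mono mult_left_mono)
      show "acc 0 l x a b c \<le> Q" "acc 0 l x a b T \<le> Q" using Q c(1) T(1) by auto
    qed (use \<delta> T(1) in auto)
    finally have "acc \<delta> l x a b T \<le> Q" by (simp add: algebra_simps)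
    moreover have "C * ?E / \<delta> \<le> 1" using T(2) \<delta> by simp
    ultimately show ?thesis using payoff_tail[OF l C a b \<delta> T(1), of x] by linarith
  qed
  then show ?thesis using T(1) by blast
qed

lemma payoff_add_const:
  assumes l: "running_payoff l" shows "running_payoff (\<lambda>x a b. l x a b + q)"
  by (rule payoff_add_function[OF l, of "\<lambda>x. q"]) (auto simp: lattice_periodic_def)

lemma discounted_payoff_add_const:
  assumes l: "running_payoff l" and a: "a \<in> controls A" and b: "b \<in> controls B" and \<delta>: "0 < \<delta>"
  shows "discounted_payoff f (\<lambda>x a b. l x a b + q) \<delta> x a b = discounted_payoff f l \<delta> x a b + q / \<delta>"
proof -
  have l': "running_payoff (\<lambda>x a b. l x a b + q)" by (rule payoff_add_const[OF l])
  have acc: "acc \<delta> (\<lambda>x a b. l x a b + q) x a b t = acc \<delta> l x a b t + (q / \<delta> - q * exp (- \<delta> * t) / \<delta>)" if t: "0 \<le> t" for t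
  proof -
    have ie: "((\<lambda>s. exp (- \<delta> * s) * q) has_integral (- (q * exp (- \<delta> * t) / \<delta>) - - (q * exp (- \<delta> * 0) / \<delta>))) {0..t}"
      by (rule fundamental_theorem_of_calculus[OF t])
        (use \<delta> in \<open>auto intro!: derivative_eq_intros simp flip: has_real_derivative_iff_has_vector_derivative\<close>)
    have int: "(\<lambda>s. exp (- \<delta> * s) * l (traj x a b s) (a s) (b s)) integrable_on {0..t}"
      using discounted_rate_integrable[OF l a b] \<delta> by simp
    have "acc \<delta> (\<lambda>x a b. l x a b + q) x a b t = integral {0..t} (\<lambda>s. exp (- \<delta> * s) * l (traj x a b s) (a s) (b s) + exp (- \<delta> * s) * q)"
      by (simp add: acc_def distrib_left)
    also have "\<dots> = acc \<delta> l x a b t + integral {0..t} (\<lambda>s. exp (- \<delta> * s) * q)"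
      unfolding acc_def by (rule Henstock_Kurzweil_Integration.integral_add[OF int has_integral_integrable[OF ie]])
    finally show ?thesis using integral_unique[OF ie] by simp
  qed
  have "((\<lambda>t. acc \<delta> l x a b t + (q / \<delta> - q * exp (- \<delta> * t) / \<delta>)) \<longlongrightarrow> discounted_payoff f l \<delta> x a b + (q / \<delta> - 0)) at_top"
    by (intro tendsto_intros payoff_limit[OF l a b \<delta>] exponential_decay[OF \<delta>])
  moreover have "\<forall>\<^sub>F t in at_top. acc \<delta> l x a b t + (q / \<delta> - q * exp (- \<delta> * t) / \<delta>) = acc \<delta> (\<lambda>x a b. l x a b + q) x a b t"
    using eventually_ge_at_top[of "0::real"] by eventually_elim (simp add: acc)
  ultimately have "((\<lambda>t. acc \<delta> (\<lambda>x a b. l x a b + q) x a b t) \<longlongrightarrow> discounted_payoff f l \<delta> x a b + (q / \<delta> - 0)) at_top"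
    by (rule Lim_transform_eventually)
  from tendsto_unique[OF trivial_limit_at_top_linorder payoff_limit[OF l' a b \<delta>] this] show ?thesis by simp
qed

lemma acc_mono:
  assumes l: "running_payoff l" "running_payoff m" and le: "\<And>x a b. a \<in> A \<Longrightarrow> b \<in> B \<Longrightarrow> l x a b \<le> m x a b"
    and a: "a \<in> controls A" and b: "b \<in> controls B"
  shows "acc 0 l x a b t \<le> acc 0 m x a b t"
  unfolding acc_def
proof (rule integral_le)
  show "(\<lambda>s. exp (- 0 * s) * l (traj x a b s) (a s) (b s)) integrable_on {0..t}"
    using rate_integrable[OF l(1) a b] by simp
  show "(\<lambda>s. exp (- 0 * s) * m (traj x a b s) (a s) (b s)) integrable_on {0..t}"
    using rate_integrable[OF l(2) a b] by simp
  show "exp (- 0 * s) * l (traj x a b s) (a s) (b s) \<le> exp (- 0 * s) * m (traj x a b s) (a s) (b s)" if "s \<in> {0..t}" for s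
    using le controls_space[OF a] controls_space[OF b] that by simp
qed

text \<open>
  If \<open>\<delta> v\<^sub>\<delta>\<close> is within \<open>e\<close> of \<open>c\<close>, the guarantees for \<open>v\<^sub>\<delta>\<close> bound the undiscounted integral of
  \<open>l - (c + e)\<close> from above, respectively that of \<open>l - (c - e)\<close> from below, by a constant \<open>Q\<close> that
  does not depend on time. Hence the values for a rate \<open>\<delta>'\<close> differ from \<open>c / \<delta>'\<close> by at most
  \<open>e / \<delta>' + Q\<close>.
\<close>

lemma almost_constant_propagates:
  assumes l: "running_payoff l" and \<delta>: "0 < \<delta>" and e: "0 < e"
    and near: "\<And>x. \<bar>\<delta> * lval \<delta> l x - c\<bar> \<le> e"
  shows "\<exists>\<delta>1>0. \<forall>\<delta>'. 0 < \<delta>' \<and> \<delta>' < \<delta>1 \<longrightarrow> (\<forall>x. \<bar>\<delta>' * lval \<delta>' l x - c\<bar> \<le> 2 * e)"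
proof -
  let ?v = "lval \<delta> l"
  define m where "m = (\<lambda>x a b. l x a b + - (\<delta> * ?v x))"
  note m = value_undiscounted[OF l \<delta>, folded m_def]
  note v = value_continuous[OF l \<delta>] value_periodic[OF l, of \<delta>]
  obtain W where W: "\<forall>x. \<bar>?v x\<bar> \<le> W" using periodic_bounded[OF v] by blast
  \<comment> \<open>A bound for the oscillation of \<open>v\<close>, plus 1 for the tolerance of the guarantee and 1 for the tail of the discounted integral.\<close>
  define Q where "Q = 2 * W + 2"
  have Q: "0 < Q" using W[rule_format, of 0] by (simp add: Q_def)
  have main: "\<bar>\<delta>' * lval \<delta>' l x - c\<bar> \<le> 2 * e" if d': "0 < \<delta>'" "\<delta>' < e / Q" for \<delta>' x
  proof -
    have dQ: "\<delta>' * Q \<le> e" using d' Q by (simp add: field_simps)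
    have "lval \<delta>' l x \<le> Q + (c + e) / \<delta>'"
    proof -
      let ?k = "\<lambda>x a b. l x a b + - (c + e)"
      have k: "running_payoff ?k" by (rule payoff_add_const[OF l])
      have km: "?k x a b \<le> m x a b" for x a b using near[of x] by (simp add: m_def abs_le_iff)
      obtain T where T: "0 \<le> T" "\<forall>x. \<forall>a\<in>controls A. \<forall>b\<in>controls B. \<forall>Q. (\<forall>t\<in>{0..T}. acc 0 ?k x a b t \<le> Q) \<longrightarrow>
          discounted_payoff f ?k \<delta>' x a b \<le> Q + 1"
        using discounted_le_of_accumulated[OF k d'(1)] by blast
      obtain \<alpha> where \<alpha>: "\<alpha> \<in> strats" "\<forall>b\<in>controls B. \<forall>t\<in>{0..T}. ?v (traj x (\<alpha> b) b t) + acc 0 m x (\<alpha> b) b t \<le> ?v x + 1"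
        using supersolution_guarantee[OF m(1) v m(2) T(1) zero_less_one, of x] by blast
      show ?thesis
      proof (rule value_le[OF l d'(1) \<alpha>(1)])
        fix b assume b: "b \<in> controls B"
        have ab: "\<alpha> b \<in> controls A" using \<alpha>(1) b by blast
        have "\<forall>t\<in>{0..T}. acc 0 ?k x (\<alpha> b) b t \<le> 2 * W + 1"
        proof
          fix t assume t: "t \<in> {0..T}"
          have "acc 0 ?k x (\<alpha> b) b t \<le> acc 0 m x (\<alpha> b) b t" by (rule acc_mono[OF k m(1) km ab b])
          moreover have "?v (traj x (\<alpha> b) b t) + acc 0 m x (\<alpha> b) b t \<le> ?v x + 1" using \<alpha>(2) b t by blast
          ultimately show "acc 0 ?k x (\<alpha> b) b t \<le> 2 * W + 1"
            using W[rule_format, of x] W[rule_format, of "traj x (\<alpha> b) b t"] by linarith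
        qed
        then have "discounted_payoff f ?k \<delta>' x (\<alpha> b) b \<le> 2 * W + 1 + 1" using T(2) ab b by blast
        then show "discounted_payoff f l \<delta>' x (\<alpha> b) b \<le> Q + (c + e) / \<delta>'"
          using discounted_payoff_add_const[OF l ab b d'(1), of "- (c + e)" x] minus_divide_left[of "c + e" \<delta>']
          unfolding Q_def by linarith
      qed
    qed
    then have "\<delta>' * lval \<delta>' l x \<le> \<delta>' * (Q + (c + e) / \<delta>')" using d'(1) by (intro mult_left_mono) auto
    also have "\<dots> = \<delta>' * Q + (c + e)" by (subst distrib_left) (use d'(1) in simp)
    finally have up: "\<delta>' * lval \<delta>' l x \<le> c + 2 * e" using dQ by linarith
    have "- Q + (c - e) / \<delta>' \<le> lval \<delta>' l x"
    proof -
      let ?n = "\<lambda>x a b. l x a b + - (c - e)"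
      let ?k = "\<lambda>x a b. - (l x a b + - (c - e))"
      have n: "running_payoff ?n" by (rule payoff_add_const[OF l])
      have k: "running_payoff ?k" by (rule payoff_minus[OF n])
      have mn: "m x a b \<le> ?n x a b" for x a b using near[of x] by (simp add: m_def abs_le_iff)
      obtain T where T: "0 \<le> T" "\<forall>x. \<forall>a\<in>controls A. \<forall>b\<in>controls B. \<forall>Q. (\<forall>t\<in>{0..T}. acc 0 ?k x a b t \<le> Q) \<longrightarrow>
          discounted_payoff f ?k \<delta>' x a b \<le> Q + 1"
        using discounted_le_of_accumulated[OF k d'(1)] by blast
      show ?thesis
      proof (rule value_ge[OF l d'(1)])
        fix \<alpha> assume \<alpha>: "\<alpha> \<in> strats"
        obtain b where b: "b \<in> controls B" and sb: "\<forall>t\<in>{0..T}. ?v x - 1 \<le> ?v (traj x (\<alpha> b) b t) + acc 0 m x (\<alpha> b) b t"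
          using subsolution_guarantee[OF m(1) v m(3) T(1) zero_less_one \<alpha>, of x] by blast
        have ab: "\<alpha> b \<in> controls A" using \<alpha> b by blast
        have "\<forall>t\<in>{0..T}. acc 0 ?k x (\<alpha> b) b t \<le> 2 * W + 1"
        proof
          fix t assume t: "t \<in> {0..T}"
          have "acc 0 m x (\<alpha> b) b t \<le> acc 0 ?n x (\<alpha> b) b t" by (rule acc_mono[OF m(1) n mn ab b])
          moreover have "acc 0 ?k x (\<alpha> b) b t = - acc 0 ?n x (\<alpha> b) b t" by (rule acc_minus)
          moreover have "?v x - 1 \<le> ?v (traj x (\<alpha> b) b t) + acc 0 m x (\<alpha> b) b t" using sb t by blast
          ultimately show "acc 0 ?k x (\<alpha> b) b t \<le> 2 * W + 1"
            using W[rule_format, of x] W[rule_format, of "traj x (\<alpha> b) b t"] by linarith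
        qed
        then have "discounted_payoff f ?k \<delta>' x (\<alpha> b) b \<le> 2 * W + 1 + 1" using T(2) ab b by blast
        then have "- Q \<le> discounted_payoff f ?n \<delta>' x (\<alpha> b) b"
          unfolding discounted_payoff_minus by (simp add: Q_def)
        then have "- Q + (c - e) / \<delta>' \<le> discounted_payoff f l \<delta>' x (\<alpha> b) b"
          using discounted_payoff_add_const[OF l ab b d'(1), of "- (c - e)" x] minus_divide_left[of "c - e" \<delta>']
          by linarith
        then show "\<exists>b\<in>controls B. - Q + (c - e) / \<delta>' \<le> discounted_payoff f l \<delta>' x (\<alpha> b) b" using b by blast
      qed
    qed
    then have "\<delta>' * (- Q + (c - e) / \<delta>') \<le> \<delta>' * lval \<delta>' l x" using d'(1) by (intro mult_left_mono) auto
    moreover have "\<delta>' * (- Q + (c - e) / \<delta>') = - (\<delta>' * Q) + (c - e)" by (subst distrib_left) (use d'(1) in simp)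
    ultimately have "c - 2 * e \<le> \<delta>' * lval \<delta>' l x" using dQ by linarith
    with up show ?thesis by (simp add: abs_le_iff)
  qed
  have "0 < e / Q" using e Q by simp
  with main show ?thesis by blast
qed

text \<open>
  Over a fixed horizon the guarantee for \<open>v\<^sub>\<delta>\<close> loses a constant that does not depend on \<open>\<delta>\<close>,
  and multiplication by \<open>\<delta>\<close> makes it vanish in the limit.
\<close>

lemma vanishing_discount_limit_guarantees:
  fixes w :: "real^'n \<Rightarrow> real"
  assumes l: "running_payoff l" and \<delta>n: "\<And>n. 0 < \<delta> n" "\<delta> \<longlonglongrightarrow> 0"
    and lim: "\<And>e. 0 < e \<Longrightarrow> \<exists>N. \<forall>n\<ge>N. \<forall>x. \<bar>\<delta> n * lval (\<delta> n) l x - w x\<bar> < e"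
    and T: "0 \<le> T" and e: "0 < e"
  shows "\<exists>\<alpha>\<in>strats. \<forall>b\<in>controls B. \<forall>t\<in>{0..T}. w (traj x (\<alpha> b) b t) \<le> w x + e"
    and "\<alpha> \<in> strats \<Longrightarrow> \<exists>b\<in>controls B. \<forall>t\<in>{0..T}. w x - e \<le> w (traj x (\<alpha> b) b t)"
proof -
  obtain C where C0: "0 \<le> C" and C: "\<forall>x. \<forall>a\<in>A. \<forall>b\<in>B. \<bar>l x a b\<bar> \<le> C" using payoff_bounded[OF l] by blast
  \<comment> \<open>Loss over the horizon: tolerance 1 of the guarantee plus the integral of a payoff bounded by \<open>2 C\<close>.\<close>
  define K where "K = 1 + 2 * C * T"
  have K: "0 < K" using C0 T by (simp add: K_def add_pos_nonneg)
  have "0 < e / 4" "0 < e / (4 * K)" using e K by auto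
  then obtain N where N: "\<forall>n\<ge>N. \<forall>x. \<bar>\<delta> n * lval (\<delta> n) l x - w x\<bar> < e / 4"
    using lim by blast
  obtain N' where N': "\<forall>n\<ge>N'. \<delta> n < e / (4 * K)"
    using order_tendstoD(2)[OF \<delta>n(2) \<open>0 < e / (4 * K)\<close>] unfolding eventually_sequentially by blast
  define d where "d = \<delta> (max N N')"
  have d: "0 < d" "d * K \<le> e / 2" "\<And>x. \<bar>d * lval d l x - w x\<bar> < e / 4"
  proof -
    show "0 < d" using \<delta>n(1) by (simp add: d_def)
    have "d < e / (4 * K)" using N' by (simp add: d_def)
    then have "d * K \<le> e / (4 * K) * K" using K by (intro mult_right_mono) auto
    then show "d * K \<le> e / 2" using K e by simp
    show "\<bar>d * lval d l x - w x\<bar> < e / 4" for x using N by (simp add: d_def)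
  qed
  let ?v = "lval d l"
  define m where "m = (\<lambda>x a b. l x a b + - (d * ?v x))"
  note m = value_undiscounted[OF l d(1), folded m_def]
  note v = value_continuous[OF l d(1)] value_periodic[OF l, of d]
  have mC: "\<forall>x. \<forall>a\<in>A. \<forall>b\<in>B. \<bar>m x a b\<bar> \<le> 2 * C"
  proof (intro allI ballI)
    fix x a b assume ab: "a \<in> A" "b \<in> B"
    have "\<bar>d * ?v x\<bar> \<le> C" using value_bound[OF l C d(1), of x] d(1) by (simp add: abs_mult field_simps)
    moreover have "\<bar>l x a b\<bar> \<le> C" using C ab by blast
    ultimately show "\<bar>m x a b\<bar> \<le> 2 * C" unfolding m_def by linarith
  qed
  have accm: "\<bar>acc 0 m x a b t\<bar> \<le> 2 * C * T" if "a \<in> controls A" "b \<in> controls B" "t \<in> {0..T}" for x a b t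
  proof -
    have "\<bar>acc 0 m x a b t\<bar> \<le> 2 * C * t" using acc_bound[OF m(1) mC that(1,2) order_refl] that(3) by simp
    also have "\<dots> \<le> 2 * C * T" using that(3) C0 by (intro mult_left_mono) auto
    finally show ?thesis .
  qed
  show "\<exists>\<alpha>\<in>strats. \<forall>b\<in>controls B. \<forall>t\<in>{0..T}. w (traj x (\<alpha> b) b t) \<le> w x + e"
  proof -
    obtain \<alpha> where \<alpha>: "\<alpha> \<in> strats" "\<forall>b\<in>controls B. \<forall>t\<in>{0..T}. ?v (traj x (\<alpha> b) b t) + acc 0 m x (\<alpha> b) b t \<le> ?v x + 1"
      using supersolution_guarantee[OF m(1) v m(2) T zero_less_one, of x] by blast
    show ?thesis
    proof (rule bexI[OF _ \<alpha>(1)], intro ballI)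
      fix b t assume b: "b \<in> controls B" and t: "t \<in> {0..T}"
      have ab: "\<alpha> b \<in> controls A" using \<alpha>(1) b by blast
      let ?y = "traj x (\<alpha> b) b t"
      have "?v ?y + acc 0 m x (\<alpha> b) b t \<le> ?v x + 1" using \<alpha>(2) b t by blast
      then have "?v ?y \<le> ?v x + K" using accm[OF ab b t, of x] unfolding K_def by linarith
      then have "d * ?v ?y \<le> d * (?v x + K)" using d(1) by (intro mult_left_mono) auto
      then show "w ?y \<le> w x + e" using d(2) d(3)[of x] d(3)[of ?y] distrib_left[of d "?v x" K] by linarith
    qed
  qed
  show "\<exists>b\<in>controls B. \<forall>t\<in>{0..T}. w x - e \<le> w (traj x (\<alpha> b) b t)" if \<alpha>: "\<alpha> \<in> strats"
  proof -
    obtain b where b: "b \<in> controls B" and sb: "\<forall>t\<in>{0..T}. ?v x - 1 \<le> ?v (traj x (\<alpha> b) b t) + acc 0 m x (\<alpha> b) b t"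
      using subsolution_guarantee[OF m(1) v m(3) T zero_less_one \<alpha>, of x] by blast
    have ab: "\<alpha> b \<in> controls A" using \<alpha> b by blast
    show ?thesis
    proof (rule bexI[OF _ b], intro ballI)
      fix t assume t: "t \<in> {0..T}"
      let ?y = "traj x (\<alpha> b) b t"
      have "?v x - 1 \<le> ?v ?y + acc 0 m x (\<alpha> b) b t" using sb t by blast
      then have "?v x - K \<le> ?v ?y" using accm[OF ab b t, of x] unfolding K_def by linarith
      then have "d * (?v x - K) \<le> d * ?v ?y" using d(1) by (intro mult_left_mono) auto
      then show "w x - e \<le> w ?y" using d(2) d(3)[of x] d(3)[of ?y] right_diff_distrib[of d "?v x" K] by linarith
    qed
  qed
qed

text \<open>
  The limit exists on the unit cube and is extended by periodicity; its continuity across the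
  boundary of the cube comes from uniform convergence on the whole space.
\<close>

lemma periodic_Arzela_Ascoli:
  fixes F :: "nat \<Rightarrow> real^'m \<Rightarrow> real"
  assumes per: "\<And>n. lattice_periodic (F n)" and bound: "\<And>n x. \<bar>F n x\<bar> \<le> C"
    and equi: "\<And>x e. 0 < e \<Longrightarrow> \<exists>d>0. \<forall>n y. dist y x < d \<longrightarrow> dist (F n y) (F n x) < e"
  shows "\<exists>w k. strict_mono (k :: nat \<Rightarrow> nat) \<and> continuous_on UNIV w \<and> lattice_periodic w \<and>
    (\<forall>e>0. \<exists>N. \<forall>n\<ge>N. \<forall>x. \<bar>F (k n) x - w x\<bar> < e)"
proof -
  obtain g and k :: "nat \<Rightarrow> nat" where gk: "continuous_on (cbox 0 1) g" "strict_mono k"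
    "\<And>e. 0 < e \<Longrightarrow> \<exists>N. \<forall>n x. n \<ge> N \<and> x \<in> cbox 0 1 \<longrightarrow> norm (F (k n) x - g x) < e"
  proof (rule Arzela_Ascoli[of "cbox (0::real^'m) 1" F C])
    fix x :: "real^'m" and e :: real assume "0 < e"
    from equi[OF this, of x] show "\<exists>d. 0 < d \<and> (\<forall>n y. y \<in> cbox 0 1 \<and> norm (x - y) < d \<longrightarrow> norm (F n x - F n y) < e)"
      by (auto simp: dist_norm norm_minus_commute abs_minus_commute)
  qed (use bound in auto)
  \<comment> \<open>Representative of \<open>x\<close> in the unit cube.\<close>
  define r where "r = (\<lambda>x::real^'m. x + - (\<chi> i. of_int \<lfloor>x $ i\<rfloor>))"
  have r: "r x \<in> cbox 0 1" "F n (r x) = F n x" for x n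
  proof -
    show "r x \<in> cbox 0 1" by (auto simp: r_def mem_box_cart) linarith
    show "F n (r x) = F n x"
      unfolding r_def using per[of n] int_lattice_floor[of x] unfolding lattice_periodic_def by blast
  qed
  define w where "w = (\<lambda>x. g (r x))"
  have lim: "\<exists>N. \<forall>n\<ge>N. \<forall>x. \<bar>F (k n) x - w x\<bar> < e" if "0 < e" for e
    using gk(3)[OF that] r unfolding w_def real_norm_def by metis
  have "lattice_periodic w"
    unfolding lattice_periodic_def
  proof (intro allI ballI)
    fix x k' :: "real^'m" assume k': "k' \<in> int_lattice"
    have small: "\<bar>w (x + k') - w x\<bar> \<le> e" if e: "0 < e" for e
    proof -
      have "0 < e / 2" using e by simp
      from lim[OF this] obtain N where N: "\<forall>n\<ge>N. \<forall>x. \<bar>F (k n) x - w x\<bar> < e / 2" by blast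
      have "F (k N) (x + k') = F (k N) x" using per k' unfolding lattice_periodic_def by blast
      then show ?thesis using N[rule_format, OF order_refl, of x] N[rule_format, OF order_refl, of "x + k'"] by linarith
    qed
    have "\<bar>w (x + k') - w x\<bar> \<le> 0"
    proof (rule field_le_epsilon)
      fix e :: real assume "0 < e"
      from small[OF this] show "\<bar>w (x + k') - w x\<bar> \<le> 0 + e" by simp
    qed
    then show "w (x + k') = w x" by simp
  qed
  moreover have "continuous_on UNIV w"
  proof (rule uniform_limit_theorem[where F=sequentially and f="\<lambda>n. F (k n)"])
    have "continuous_on UNIV (F n)" for n
      using equi unfolding continuous_on_iff by blast
    then show "\<forall>\<^sub>F n in sequentially. continuous_on UNIV (F (k n))" by simp
    show "uniform_limit UNIV (\<lambda>n. F (k n)) w sequentially"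
      unfolding uniform_limit_sequentially_iff using lim by (auto simp: dist_real_def)
  qed simp
  ultimately show ?thesis using gk(2) lim by blast
qed

text \<open>
  Equicontinuity is applied with \<open>- g\<close> in the role of the perturbation, since the Hamiltonian of
  the payoff \<open>l + g\<close> is that of \<open>l\<close> minus \<open>g\<close>.
\<close>

lemma ergodic_if_no_disjoint_dominions:
  assumes nd: no_disjoint_dominions and l: "running_payoff l" and eq: "structural_equicontinuity A B f l"
  shows "uniquely_ergodic A B f l"
  unfolding uniquely_ergodic_def
proof (intro allI impI, elim conjE)
  fix g :: "real^'n \<Rightarrow> real" assume g: "continuous_on UNIV g" "lattice_periodic g"
  let ?l = "\<lambda>x a b. l x a b + g x"
  have l': "running_payoff ?l" by (rule payoff_add_function[OF l g])
  obtain C where C0: "0 \<le> C" and C: "\<forall>x. \<forall>a\<in>A. \<forall>b\<in>B. \<bar>?l x a b\<bar> \<le> C" using payoff_bounded[OF l'] by blast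
  have g': "continuous_on UNIV (\<lambda>x. - g x)" "lattice_periodic (\<lambda>x. - g x)"
    using g by (auto simp: lattice_periodic_def intro: continuous_intros)
  have sol: "continuous_viscosity_solution (\<lambda>x r p. \<delta> * r + - g x + hamiltonian A B f l x p) (lval \<delta> ?l)"
    if \<delta>: "0 < \<delta>" for \<delta>
  proof -
    have "(\<lambda>x r p. \<delta> * r + - g x + hamiltonian A B f l x p) = (\<lambda>x r p. \<delta> * r + hamiltonian A B f ?l x p)"
      by (simp add: hamiltonian_add_function[OF l l'] fun_eq_iff)
    then show ?thesis
      unfolding continuous_viscosity_solution_def
      using value_continuous[OF l' \<delta>] value_subsolution[OF l' \<delta>] value_supersolution[OF l' \<delta>] by simp
  qed
  have equi: "equicontinuous_family {0<..1} (\<lambda>\<delta> x. \<delta> * lval \<delta> ?l x)"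
    using eq[unfolded structural_equicontinuity_def, rule_format, of "\<lambda>x. - g x" "\<lambda>\<delta>. lval \<delta> ?l"]
      g' sol value_periodic[OF l'] by auto
  define \<delta> where "\<delta> = (\<lambda>n. 1 / real (Suc n))"
  have \<delta>: "0 < \<delta> n" "\<delta> n \<in> {0<..1}" for n by (auto simp: \<delta>_def)
  have \<delta>0: "\<delta> \<longlonglongrightarrow> 0" unfolding \<delta>_def using LIMSEQ_inverse_real_of_nat by (simp add: inverse_eq_divide)
  have "\<exists>w k. strict_mono (k :: nat \<Rightarrow> nat) \<and> continuous_on UNIV w \<and> lattice_periodic w \<and>
    (\<forall>e>0. \<exists>N. \<forall>n\<ge>N. \<forall>x. \<bar>\<delta> (k n) * lval (\<delta> (k n)) ?l x - w x\<bar> < e)"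
  proof (rule periodic_Arzela_Ascoli[where F="\<lambda>n x. \<delta> n * lval (\<delta> n) ?l x" and C=C])
    show "lattice_periodic (\<lambda>x. \<delta> n * lval (\<delta> n) ?l x)" for n
      using value_periodic[OF l', of "\<delta> n"] by (simp add: lattice_periodic_def)
    show "\<bar>\<delta> n * lval (\<delta> n) ?l x\<bar> \<le> C" for n x
      using value_bound[OF l' C \<delta>(1), of n x] \<delta>(1)[of n] by (simp add: abs_mult field_simps)
    show "\<exists>d>0. \<forall>n y. dist y x < d \<longrightarrow> dist (\<delta> n * lval (\<delta> n) ?l y) (\<delta> n * lval (\<delta> n) ?l x) < e" if "0 < e" for x e
      using equi[unfolded equicontinuous_family_def, rule_format, OF that, of x] \<delta>(2) by meson
  qed
  then obtain w and k :: "nat \<Rightarrow> nat" where k: "strict_mono k" and w: "continuous_on UNIV w" "lattice_periodic w"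
    and lim: "\<And>e. 0 < e \<Longrightarrow> \<exists>N. \<forall>n\<ge>N. \<forall>x. \<bar>\<delta> (k n) * lval (\<delta> (k n)) ?l x - w x\<bar> < e"
    by blast
  have dk: "(\<lambda>n. \<delta> (k n)) \<longlonglongrightarrow> 0" using LIMSEQ_subseq_LIMSEQ[OF \<delta>0 k] by (simp add: o_def)
  note guar = vanishing_discount_limit_guarantees[OF l' \<delta>(1) dk lim]
  obtain c where c: "\<forall>x. w x = c"
    using guaranteed_function_constant[OF nd w guar] by blast
  show "ergodic A B f ?l"
    unfolding ergodic_def
  proof (rule exI[of _ c], rule uniform_limitI)
    fix e :: real assume e: "0 < e"
    then have e3: "0 < e / 3" by simp
    from lim[OF this] obtain N where N: "\<forall>n\<ge>N. \<forall>x. \<bar>\<delta> (k n) * lval (\<delta> (k n)) ?l x - w x\<bar> < e / 3" by blast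
    have "\<bar>\<delta> (k N) * lval (\<delta> (k N)) ?l x - c\<bar> \<le> e / 3" for x
      using N[rule_format, OF order_refl, of x] c by (simp add: less_imp_le)
    from almost_constant_propagates[OF l' \<delta>(1) e3 this]
    obtain d where d: "0 < d" "\<And>\<delta>' x. 0 < \<delta>' \<Longrightarrow> \<delta>' < d \<Longrightarrow> \<bar>\<delta>' * lval \<delta>' ?l x - c\<bar> \<le> 2 * (e / 3)"
      by blast
    show "\<forall>\<^sub>F \<delta>' in at_right 0. \<forall>x\<in>UNIV. dist (\<delta>' * lval \<delta>' ?l x) c < e"
      unfolding eventually_at_right_field
    proof (intro exI[of _ d] conjI allI impI ballI)
      fix \<delta>' x assume "0 < \<delta>'" "\<delta>' < d"
      from d(2)[OF this, of x] show "dist (\<delta>' * lval \<delta>' ?l x) c < e" using e by (simp add: dist_real_def)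
    qed (fact d(1))
  qed
qed

end

section \<open>Dynamics and payoff of a differential game\<close>

text \<open>
  A bound on the velocities exists because \<open>f\<close> is continuous and periodic and the control sets
  are compact.
\<close>

lemma differential_game_dynamics:
  fixes f :: "real^'n \<Rightarrow> 'a::metric_space \<Rightarrow> 'b::metric_space \<Rightarrow> real^'n"
  assumes "differential_game A B f l"
  shows "\<exists>L M. game_dynamics A B f L M"
proof -
  interpret differential_game A B f l by (rule assms)
  obtain L where L: "0 \<le> L" "\<forall>x y. \<forall>a\<in>A. \<forall>b\<in>B. norm (f x a b - f y a b) \<le> L * norm (x - y)"
    using lipschitz_f by blast
  let ?K = "cbox (0::real^'n) 1 \<times> A \<times> B"
  have "compact ((\<lambda>(x, a, b). f x a b) ` ?K)"
    by (intro compact_continuous_image compact_Times compact_A compact_B compact_cbox continuous_on_subset[OF continuous_f]) auto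
  then have "bounded ((\<lambda>(x, a, b). f x a b) ` ?K)" by (rule compact_imp_bounded)
  then obtain M where M: "\<And>x a b. x \<in> cbox 0 1 \<Longrightarrow> a \<in> A \<Longrightarrow> b \<in> B \<Longrightarrow> norm (f x a b) \<le> M"
    unfolding bounded_iff by force
  have "game_dynamics A B f L M"
  proof
    fix x :: "real^'n" and a b assume ab: "a \<in> A" "b \<in> B"
    obtain k where k: "k \<in> int_lattice" "x + k \<in> cbox 0 1" by (rule translate_to_cube)
    have "f (x + k) a b = f x a b" using periodic_f[OF ab] k(1) by (simp add: lattice_periodic_def)
    then show "norm (f x a b) \<le> M" using M[OF k(2) ab] by simp
  qed (use compact_A nonempty_A compact_B nonempty_B continuous_f L periodic_f in \<open>auto simp: lattice_periodic_def\<close>)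
  then show ?thesis by blast
qed

lemma differential_game_running_payoff:
  fixes f :: "real^'n \<Rightarrow> 'a::metric_space \<Rightarrow> 'b::metric_space \<Rightarrow> real^'n"
  assumes game: "differential_game A B f l"
  shows "game_dynamics.running_payoff A B l"
proof -
  interpret differential_game A B f l by (rule game)
  obtain L M where "game_dynamics A B f L M" using differential_game_dynamics[OF game] by blast
  then interpret game_dynamics A B f L M .
  obtain \<omega> :: "real \<Rightarrow> real" where \<omega>: "mono_on {0..} \<omega>" "\<omega> 0 = 0" "continuous (at 0 within {0..}) \<omega>"
    "\<forall>x y. \<forall>a\<in>A. \<forall>b\<in>B. \<bar>l x a b - l y a b\<bar> \<le> \<omega> (norm (x - y))"
    using modulus_l by blast
  have "\<exists>d>0. \<forall>x y. norm (x - y) < d \<longrightarrow> (\<forall>a\<in>A. \<forall>b\<in>B. \<bar>l x a b - l y a b\<bar> < e)" if e: "0 < e" for e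
  proof -
    obtain d where d: "0 < d" "\<forall>r\<in>{0..}. dist r 0 < d \<longrightarrow> dist (\<omega> r) (\<omega> 0) < e"
      using \<omega>(3) e unfolding continuous_within_eps_delta by blast
    have "\<bar>l x a b - l y a b\<bar> < e" if "norm (x - y) < d" "a \<in> A" "b \<in> B" for x y a b
    proof -
      have "dist (\<omega> (norm (x - y))) (\<omega> 0) < e" using d(2) that(1) by simp
      moreover have "\<bar>l x a b - l y a b\<bar> \<le> \<omega> (norm (x - y))" using \<omega>(4) that(2,3) by blast
      ultimately show ?thesis using \<omega>(2) by (simp add: dist_real_def)
    qed
    then show ?thesis using d(1) by blast
  qed
  then show ?thesis
    unfolding running_payoff_def using continuous_l bounded_l periodic_l by (auto simp: lattice_periodic_def)
qed

theorem theorem4p13: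
  fixes A :: "'a::metric_space set" and B :: "'b::metric_space set"
    and f :: "real^'n \<Rightarrow> 'a \<Rightarrow> 'b \<Rightarrow> real^'n"
    and l :: "real^'n \<Rightarrow> 'a \<Rightarrow> 'b \<Rightarrow> real"
  assumes game: "differential_game A B f l"
  shows
    "((\<forall>E1\<in>torus_dominions1 A B f. \<forall>E2\<in>torus_dominions2 A B f. E1 \<inter> E2 \<noteq> {})
        \<longrightarrow> {w. lattice_periodic w \<and>
                continuous_viscosity_solution (\<lambda>x r p. recession_hamiltonian A B f x p) w}
            = range (\<lambda>c x. c)) \<and>
     (structural_equicontinuity A B f l
        \<longrightarrow> (uniquely_ergodic A B f l \<longleftrightarrow>
              (\<forall>E1\<in>torus_dominions1 A B f. \<forall>E2\<in>torus_dominions2 A B f. E1 \<inter> E2 \<noteq> {})))"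
proof -
  obtain L M where dyn: "game_dynamics A B f L M"
    using differential_game_dynamics[OF game] by blast
  interpret game_dynamics A B f L M by (rule dyn)
  have l: "running_payoff l" by (rule differential_game_running_payoff[OF game])
  show ?thesis
    using strong_maximum_principle uniquely_ergodic_no_disjoint_dominions[OF l]
      ergodic_if_no_disjoint_dominions[OF _ l] by blast
qed

end
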